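(* Let $G$ be a finitely generated left-orderable group. Then every left-order on $G$ is a regular left-order if and only if $G$ is a Tararin poly-$\mathbb{Z}$ group.
   Context: A left-order on $G$ is a total order invariant under left multiplication, with positive cone $P=\{g:1\prec g\}$. It is regular if there are a finite set $X$, a surjective monoid homomorphism $\pi\colon X^*\to G$ and a regular language $\mathcal{L}\subseteq X^*$ (accepted by a finite state automaton) with $\pi(\mathcal{L})=P$. A group $G$ is a Tararin group if it admits a unique subnormal series $G=G_0\unrhd G_1\unrhd\cdots\unrhd G_n=\{1\}$ such that all factors $G_i/G_{i+1}$ are torsion-free abelian of rank $1$ and no quotient $G_i/G_{i+2}$ is bi-orderable (admits a total order invariant under both left and right multiplication). A group is poly-$\mathbb{Z}$ if it has a finite subnormal series with all factors infinite cyclic. A Tararin poly-$\mathbb{Z}$ group is a Tararin group that is poly-$\mathbb{Z}$. *)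

theory Defs
  imports "HOL-Algebra.Algebra"
begin

definition left_order :: "('a, 'b) monoid_scheme \<Rightarrow> ('a \<Rightarrow> 'a \<Rightarrow> bool) \<Rightarrow> bool" where
  "left_order G lt \<longleftrightarrow>
     (\<forall>x\<in>carrier G. \<not> lt x x) \<and>
     (\<forall>x\<in>carrier G. \<forall>y\<in>carrier G. \<forall>z\<in>carrier G. lt x y \<longrightarrow> lt y z \<longrightarrow> lt x z) \<and>
     (\<forall>x\<in>carrier G. \<forall>y\<in>carrier G. x \<noteq> y \<longrightarrow> lt x y \<or> lt y x) \<and>
     (\<forall>g\<in>carrier G. \<forall>x\<in>carrier G. \<forall>y\<in>carrier G.
        lt x y \<longrightarrow> lt (g \<otimes>\<^bsub>G\<^esub> x) (g \<otimes>\<^bsub>G\<^esub> y))"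

definition bi_order :: "('a, 'b) monoid_scheme \<Rightarrow> ('a \<Rightarrow> 'a \<Rightarrow> bool) \<Rightarrow> bool" where
  "bi_order G lt \<longleftrightarrow> left_order G lt \<and>
     (\<forall>g\<in>carrier G. \<forall>x\<in>carrier G. \<forall>y\<in>carrier G.
        lt x y \<longrightarrow> lt (x \<otimes>\<^bsub>G\<^esub> g) (y \<otimes>\<^bsub>G\<^esub> g))"

definition left_orderable :: "('a, 'b) monoid_scheme \<Rightarrow> bool" where
  "left_orderable G \<longleftrightarrow> (\<exists>lt. left_order G lt)"

definition bi_orderable :: "('a, 'b) monoid_scheme \<Rightarrow> bool" where
  "bi_orderable G \<longleftrightarrow> (\<exists>lt. bi_order G lt)"

definition pos_cone :: "('a, 'b) monoid_scheme \<Rightarrow> ('a \<Rightarrow> 'a \<Rightarrow> bool) \<Rightarrow> 'a set" where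
  "pos_cone G lt = {g. g \<in> carrier G \<and> lt \<one>\<^bsub>G\<^esub> g}"

text \<open>Alphabets and automaton states are encoded as finite sets of naturals
  (no loss of generality, any finite set is in bijection with one).\<close>
definition regular_lang :: "nat set \<Rightarrow> nat list set \<Rightarrow> bool" where
  "regular_lang Alph L \<longleftrightarrow>
     (\<exists>(states::nat set) (start::nat) (tr::nat \<Rightarrow> nat \<Rightarrow> nat) (acc::nat set).
        finite states \<and> start \<in> states \<and> (\<forall>q\<in>states. \<forall>x\<in>Alph. tr q x \<in> states) \<and>
        acc \<subseteq> states \<and> L = {w. w \<in> lists Alph \<and> foldl tr start w \<in> acc})"

definition word_eval :: "('a, 'b) monoid_scheme \<Rightarrow> (nat \<Rightarrow> 'a) \<Rightarrow> nat list \<Rightarrow> 'a" where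
  "word_eval G f w = foldr (\<lambda>x acc. f x \<otimes>\<^bsub>G\<^esub> acc) w \<one>\<^bsub>G\<^esub>"

definition regular_left_order :: "('a, 'b) monoid_scheme \<Rightarrow> ('a \<Rightarrow> 'a \<Rightarrow> bool) \<Rightarrow> bool" where
  "regular_left_order G lt \<longleftrightarrow>
     (\<exists>(Alph::nat set) (f::nat \<Rightarrow> 'a) L.
        finite Alph \<and> f ` Alph \<subseteq> carrier G \<and> word_eval G f ` lists Alph = carrier G \<and>
        L \<subseteq> lists Alph \<and> regular_lang Alph L \<and> word_eval G f ` L = pos_cone G lt)"

definition finitely_generated :: "('a, 'b) monoid_scheme \<Rightarrow> bool" where
  "finitely_generated G \<longleftrightarrow> (\<exists>S. finite S \<and> S \<subseteq> carrier G \<and> generate G S = carrier G)"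

definition subnormal_series :: "('a, 'b) monoid_scheme \<Rightarrow> 'a set list \<Rightarrow> bool" where
  "subnormal_series G Hs \<longleftrightarrow> Hs \<noteq> [] \<and> hd Hs = carrier G \<and> last Hs = {\<one>\<^bsub>G\<^esub>} \<and>
     (\<forall>i. Suc i < length Hs \<longrightarrow> Hs ! Suc i \<lhd> G\<lparr>carrier := Hs ! i\<rparr>)"

definition series_factor :: "('a, 'b) monoid_scheme \<Rightarrow> 'a set list \<Rightarrow> nat \<Rightarrow> 'a set monoid" where
  "series_factor G Hs i = G\<lparr>carrier := Hs ! i\<rparr> Mod (Hs ! Suc i)"

definition poly_Z :: "('a, 'b) monoid_scheme \<Rightarrow> bool" where
  "poly_Z G \<longleftrightarrow> (\<exists>Hs. subnormal_series G Hs \<and>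
     (\<forall>i. Suc i < length Hs \<longrightarrow> series_factor G Hs i \<cong> integer_group))"

definition tf_abelian_rank1 :: "('c, 'd) monoid_scheme \<Rightarrow> bool" where
  "tf_abelian_rank1 Q \<longleftrightarrow> comm_group Q \<and> carrier Q \<noteq> {\<one>\<^bsub>Q\<^esub>} \<and>
     (\<forall>x\<in>carrier Q. \<forall>n::nat. n > 0 \<longrightarrow> x [^]\<^bsub>Q\<^esub> n = \<one>\<^bsub>Q\<^esub> \<longrightarrow> x = \<one>\<^bsub>Q\<^esub>) \<and>
     (\<forall>a\<in>carrier Q. \<forall>b\<in>carrier Q. \<exists>(m::int) (n::int). (m \<noteq> 0 \<or> n \<noteq> 0) \<and>
        a [^]\<^bsub>Q\<^esub> m \<otimes>\<^bsub>Q\<^esub> b [^]\<^bsub>Q\<^esub> n = \<one>\<^bsub>Q\<^esub>)"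

definition tararin_series :: "('a, 'b) monoid_scheme \<Rightarrow> 'a set list \<Rightarrow> bool" where
  "tararin_series G Hs \<longleftrightarrow> subnormal_series G Hs \<and>
     (\<forall>i. Suc i < length Hs \<longrightarrow> tf_abelian_rank1 (series_factor G Hs i)) \<and>
     (\<forall>i. Suc (Suc i) < length Hs \<longrightarrow>
        Hs ! Suc (Suc i) \<lhd> G\<lparr>carrier := Hs ! i\<rparr> \<and>
        \<not> bi_orderable (G\<lparr>carrier := Hs ! i\<rparr> Mod (Hs ! Suc (Suc i))))"

definition tararin_group :: "('a, 'b) monoid_scheme \<Rightarrow> bool" where
  "tararin_group G \<longleftrightarrow> (\<exists>!Hs. tararin_series G Hs)"

end

theory Submission
  imports Defs "HOL-Analysis.Analysis"
begin

text \<open>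
  A left-order is determined by its positive cone, and a cone is the image of a regular language
  iff it is the set of labels of the accepted paths of a finite graph labelled by group elements.
  If \<open>G\<close> is finitely generated there are only countably many such graphs. So if all left-orders
  are regular, then the compact space of cones, on which \<open>G\<close> acts by conjugation, is countable
  and contains a finite orbit. A cone \<open>P\<close> with finite orbit is invariant under a normal subgroup
  \<open>N\<close> of finite index. Counting powers of a cofinal element of \<open>N\<close> gives a quasimorphism on \<open>G\<close>
  whose homogenisation is a homomorphism on the bi-ordered group \<open>N\<close>; its transfer to \<open>G\<close> is
  nonzero, hence \<open>G\<close> maps onto the integers.

  The kernel \<open>K\<close> of such a map is convex in the lexicographic orders, and a window argument on the
  graph shows that every cone of \<open>K\<close> is again given by a finite graph. Iterating yields a series
  with infinite cyclic factors. It is finite, as otherwise arbitrary signs on the factors would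
  give uncountably many orders. Two independent homomorphisms to the integers would also give
  uncountably many orders; this makes each kernel unique and excludes that two consecutive factors
  form a bi-orderable group.

  Conversely, in a Tararin poly-\<open>\<int>\<close> group the factors are infinite cyclic and each one inverts the
  next, which forces all elements of positive height over \<open>G\<^sub>1\<close> to have the same sign; so
  every cone is a lexicographic one, and these are read off from a graph by induction.
\<close>
section \<open>Cones and labelled graphs\<close>

text \<open>A finitely generated left-orderable group need not map onto the integers, so
  countability of the set of cones has to enter. It restores some right invariance: if conjugation
  by \<open>N\<close> preserves \<open>P\<close>, then \<open>N\<close> is bi-ordered, and counting
  powers of a fixed \<open>y \<in> N\<close> is compatible with products on both sides. The slope is
  additive on \<open>N\<close>, which is why the transfer is needed to come back to
  \<open>G\<close>. Its real values are made rational by a functional over the rationals, then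
  integral by finite generation. Passing to a kernel asks a graph to track height zero, and a finite
  graph cannot count; the lexicographic cone itself bounds the count. A rational cone also makes the
  kernel finitely generated again, so the iteration can go on. For the converse, the Tararin series
  and the poly-infinite-cyclic series are not assumed to be related. The latter makes every subgroup
  finitely generated, which turns the rank one factors of the former into infinite cyclic ones and
  lets a graph list generators of the kernels.\<close>

definition positive_cone :: "('a, 'b) monoid_scheme \<Rightarrow> 'a set \<Rightarrow> bool" where
  "positive_cone G P \<longleftrightarrow> P \<subseteq> carrier G \<and> (\<forall>x\<in>P. \<forall>y\<in>P. x \<otimes>\<^bsub>G\<^esub> y \<in> P) \<and> \<one>\<^bsub>G\<^esub> \<notin> P \<and>
     (\<forall>x\<in>carrier G. x \<noteq> \<one>\<^bsub>G\<^esub> \<longrightarrow> x \<in> P \<or> inv\<^bsub>G\<^esub> x \<in> P)"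

lemma (in group) cancel_inv [simp]:
  assumes "x \<in> carrier G" "y \<in> carrier G"
  shows "x \<otimes> (inv x \<otimes> y) = y" "inv x \<otimes> (x \<otimes> y) = y"
  using assms by (simp_all flip: m_assoc)

lemma (in group) positive_coneD:
  assumes "positive_cone G P"
  shows "P \<subseteq> carrier G" "\<And>x y. x \<in> P \<Longrightarrow> y \<in> P \<Longrightarrow> x \<otimes> y \<in> P" "\<one> \<notin> P"
    "\<And>x. x \<in> carrier G \<Longrightarrow> x \<noteq> \<one> \<Longrightarrow> x \<in> P \<or> inv x \<in> P"
    "\<And>x. x \<in> P \<Longrightarrow> inv x \<notin> P"
proof -
  show 1: "P \<subseteq> carrier G" "\<And>x y. x \<in> P \<Longrightarrow> y \<in> P \<Longrightarrow> x \<otimes> y \<in> P" "\<one> \<notin> P"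
    "\<And>x. x \<in> carrier G \<Longrightarrow> x \<noteq> \<one> \<Longrightarrow> x \<in> P \<or> inv x \<in> P"
    using assms by (auto simp: positive_cone_def)
  show "inv x \<notin> P" if "x \<in> P" for x
    using 1(2)[OF that, of "inv x"] 1(1,3) that by (auto simp: r_inv subset_iff)
qed

lemma (in group) positive_cone_pos_cone:
  assumes "left_order G lt"
  shows "positive_cone G (pos_cone G lt)"
proof -
  note lo = assms[unfolded left_order_def]
  have mult: "lt \<one> (x \<otimes> y)" if "x \<in> carrier G" "y \<in> carrier G" "lt \<one> x" "lt \<one> y" for x y
  proof -
    have "lt (x \<otimes> \<one>) (x \<otimes> y)" using lo that by blast
    then have "lt x (x \<otimes> y)" using that by simp
    with lo that show ?thesis by (meson m_closed one_closed)
  qed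
  moreover have "lt \<one> x \<or> lt \<one> (inv x)" if "x \<in> carrier G" "x \<noteq> \<one>" for x
  proof (rule disjCI)
    assume "\<not> lt \<one> (inv x)"
    then have "lt (inv x) \<one>" using lo that by (metis inv_closed inv_eq_1_iff one_closed)
    then have "lt (x \<otimes> inv x) (x \<otimes> \<one>)" using lo that by (metis inv_closed one_closed)
    then show "lt \<one> x" using that by simp
  qed
  ultimately show ?thesis using lo by (auto simp: positive_cone_def pos_cone_def)
qed

lemma (in group) ex_left_order_pos_cone:
  assumes "positive_cone G P"
  shows "\<exists>lt. left_order G lt \<and> pos_cone G lt = P"
proof (intro exI conjI)
  let ?lt = "\<lambda>x y. inv x \<otimes> y \<in> P"
  note P = positive_coneD[OF assms]
  have "inv x \<otimes> z \<in> P" if "x \<in> carrier G" "y \<in> carrier G" "z \<in> carrier G"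
      "inv x \<otimes> y \<in> P" "inv y \<otimes> z \<in> P" for x y z
  proof -
    have "(inv x \<otimes> y) \<otimes> (inv y \<otimes> z) = inv x \<otimes> z"
      using that by (simp add: m_assoc)
    then show ?thesis using P(2)[OF that(4,5)] by simp
  qed
  moreover have "inv x \<otimes> y \<in> P \<or> inv y \<otimes> x \<in> P"
    if "x \<in> carrier G" "y \<in> carrier G" "x \<noteq> y" for x y
  proof -
    have "inv x \<otimes> y \<noteq> \<one>" using that
      by (metis cancel_inv(1) inv_closed r_one)
    moreover have "inv (inv x \<otimes> y) = inv y \<otimes> x" using that by (simp add: inv_mult_group)
    ultimately show ?thesis using P(4)[of "inv x \<otimes> y"] that by auto
  qed
  moreover have "inv (g \<otimes> x) \<otimes> (g \<otimes> y) = inv x \<otimes> y"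
    if "g \<in> carrier G" "x \<in> carrier G" "y \<in> carrier G" for g x y
    using that by (simp add: inv_mult_group m_assoc)
  moreover have "inv x \<otimes> x \<notin> P" if "x \<in> carrier G" for x using P(3) that by simp
  ultimately show "left_order G ?lt" unfolding left_order_def by (intro conjI ballI impI) metis+
  show "pos_cone G ?lt = P" using P(1) by (auto simp: pos_cone_def)
qed

lemma (in group) left_orderable_iff: "left_orderable G \<longleftrightarrow> (\<exists>P. positive_cone G P)"
  unfolding left_orderable_def using positive_cone_pos_cone ex_left_order_pos_cone by blast

section \<open>Rational subsets of a group and regular left-orders\<close>

inductive gpath :: "('a, 'b) monoid_scheme \<Rightarrow> ('q \<times> 'a \<times> 'q) set \<Rightarrow> 'q \<Rightarrow> 'a \<Rightarrow> 'q \<Rightarrow> bool"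
  for G (structure) and E where
  nil: "gpath G E p \<one> p"
| step: "(p, x, r) \<in> E \<Longrightarrow> gpath G E r g q \<Longrightarrow> gpath G E p (x \<otimes> g) q"

text \<open>The image in \<open>G\<close> of the language of a nondeterministic finite automaton,
  with the letters already evaluated. States are naturals so that all such graphs over a countable
  group can be counted.\<close>

definition rational :: "('a, 'b) monoid_scheme \<Rightarrow> 'a set \<Rightarrow> bool" where
  "rational G P \<longleftrightarrow> (\<exists>(E :: (nat \<times> 'a \<times> nat) set) I F.
     finite E \<and> finite I \<and> finite F \<and> (\<forall>(p, x, q)\<in>E. x \<in> carrier G) \<and>
     P = {g. \<exists>p\<in>I. \<exists>q\<in>F. gpath G E p g q})"

text \<open>Allows any countable type of states, in particular pairs of a vertex and an integer
  height.\<close>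

lemma rationalI:
  fixes E :: "('q::countable \<times> 'a \<times> 'q) set"
  assumes fin: "finite E" "finite I" "finite F"
    and E: "\<And>p x q. (p, x, q) \<in> E \<Longrightarrow> x \<in> carrier G"
    and P: "P = {g. \<exists>p\<in>I. \<exists>q\<in>F. gpath G E p g q}"
  shows "rational G P"
proof -
  define E' where "E' = (\<lambda>(p, x, q). (to_nat p, x, to_nat q)) ` E"
  have 1: "gpath G E' (to_nat p) g (to_nat q)" if "gpath G E p g q" for p g q
    using that
  proof induction
    case (step p x r g q)
    then have "(to_nat p, x, to_nat r) \<in> E'" by (force simp: E'_def)
    then show ?case using step by (auto intro: gpath.step)
  qed (rule gpath.nil)
  have 2: "\<exists>q. q' = to_nat q \<and> gpath G E p g q" if "gpath G E' p' g q'" "p' = to_nat p" for p' g q' p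
    using that
  proof (induction arbitrary: p)
    case (step p' x r' g q')
    then obtain r where r: "r' = to_nat r" "(p, x, r) \<in> E" by (auto simp: E'_def)
    with step.IH[of r] show ?case by (auto intro: gpath.step)
  qed (auto intro: gpath.nil)
  have "gpath G E' (to_nat p) g (to_nat q) \<longleftrightarrow> gpath G E p g q" for p g q
    using 1 2[OF _ refl] by fastforce
  then have "P = {g. \<exists>p\<in>to_nat ` I. \<exists>q\<in>to_nat ` F. gpath G E' p g q}"
    unfolding P by auto
  then show ?thesis unfolding rational_def
    using fin E by (intro exI[of _ E'] exI[of _ "to_nat ` I"] exI[of _ "to_nat ` F"]) (auto simp: E'_def)
qed

lemma (in group) gpath_closed:
  assumes "gpath G E p g q" "\<And>p x q. (p, x, q) \<in> E \<Longrightarrow> x \<in> carrier G"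
  shows "g \<in> carrier G"
  using assms by induction auto

lemma (in group) gpath_append:
  assumes "gpath G E p g q" "gpath G E q h r" "\<And>p x q. (p, x, q) \<in> E \<Longrightarrow> x \<in> carrier G"
  shows "gpath G E p (g \<otimes> h) r"
  using assms
proof induction
  case (nil p)
  then have "h \<in> carrier G" by (auto dest: gpath_closed)
  with nil show ?case by simp
next
  case (step p x s g q)
  then have "gpath G E p (x \<otimes> (g \<otimes> h)) r" by (auto intro: gpath.step)
  moreover have "x \<in> carrier G" "g \<in> carrier G" "h \<in> carrier G" using step by (auto dest: gpath_closed)
  ultimately show ?case by (simp add: m_assoc)
qed

lemma word_eval_simps [simp]:
  "word_eval G f [] = \<one>\<^bsub>G\<^esub>" "word_eval G f (x # w) = f x \<otimes>\<^bsub>G\<^esub> word_eval G f w"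
  by (simp_all add: word_eval_def)

lemma (in group) word_eval_closed: "w \<in> lists A \<Longrightarrow> f ` A \<subseteq> carrier G \<Longrightarrow> word_eval G f w \<in> carrier G"
  by (induction w) auto

lemma (in group) word_eval_append:
  assumes "f ` A \<subseteq> carrier G" "v \<in> lists A" "w \<in> lists A"
  shows "word_eval G f (v @ w) = word_eval G f v \<otimes> word_eval G f w"
  using assms(2)
proof (induction v)
  case Nil
  then show ?case using word_eval_closed[OF assms(3,1)] by simp
next
  case (Cons a v)
  then show ?case using word_eval_closed[OF assms(3,1)] word_eval_closed[OF _ assms(1), of v] assms(1)
    by (auto simp: m_assoc)
qed

lemma regular_imp_rational:
  assumes "regular_left_order G lt"
  shows "rational G (pos_cone G lt)"
proof -
  obtain Alph and f :: "nat \<Rightarrow> 'a" and L where A: "finite Alph" "f ` Alph \<subseteq> carrier G"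
    and L: "regular_lang Alph L" "word_eval G f ` L = pos_cone G lt"
    using assms unfolding regular_left_order_def by (elim exE conjE) (rule that; assumption)
  obtain states acc :: "nat set" and start tr where S: "finite states" "start \<in> states"
    "\<forall>q\<in>states. \<forall>x\<in>Alph. tr q x \<in> states" "acc \<subseteq> states"
    and L': "L = {w. w \<in> lists Alph \<and> foldl tr start w \<in> acc}"
    using L(1) unfolding regular_lang_def by blast
  define E where "E = (\<lambda>(q, x). (q, f x, tr q x)) ` (states \<times> Alph)"
  have 1: "gpath G E q (word_eval G f w) (foldl tr q w)" if "w \<in> lists Alph" "q \<in> states" for w q
    using that
  proof (induction w arbitrary: q)
    case (Cons a w)
    then have "(q, f a, tr q a) \<in> E" "gpath G E (tr q a) (word_eval G f w) (foldl tr (tr q a) w)"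
      using S(3) by (auto simp: E_def)
    then show ?case by (auto intro: gpath.step)
  qed (auto intro: gpath.nil)
  have 2: "\<exists>w\<in>lists Alph. g = word_eval G f w \<and> q' = foldl tr q w" if "gpath G E q g q'" for q g q'
    using that
  proof induction
    case (nil p)
    show ?case by (rule bexI[of _ "[]"]) auto
  next
    case (step p x r g q)
    then obtain a w where "a \<in> Alph" "x = f a" "r = tr p a" "w \<in> lists Alph" "g = word_eval G f w" "q = foldl tr r w"
      by (auto simp: E_def)
    then show ?case by (intro bexI[of _ "a # w"]) auto
  qed
  show ?thesis
  proof (rule rationalI)
    show "finite E" "finite {start}" "finite acc" using A S by (auto simp: E_def intro: finite_subset)
    show "x \<in> carrier G" if "(p, x, q) \<in> E" for p x q using that A by (auto simp: E_def)
    show "pos_cone G lt = {g. \<exists>p\<in>{start}. \<exists>q\<in>acc. gpath G E p g q}"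
      unfolding L(2)[symmetric] L' using 1[OF _ S(2)] 2 by fastforce
  qed
qed

text \<open>Taking the edges of the graph as letters makes the automaton deterministic; the extra letters
  for the inverse labels are needed only for the evaluation map to be onto.\<close>

lemma (in group) rational_imp_regular:
  assumes lo: "left_order G lt" and rat: "rational G (pos_cone G lt)"
  shows "regular_left_order G lt"
proof -
  define P where "P = pos_cone G lt"
  have "positive_cone G P" unfolding P_def by (rule positive_cone_pos_cone[OF lo])
  note P = positive_coneD[OF this]
  obtain E :: "(nat \<times> 'a \<times> nat) set" and I F where fin: "finite E" "finite I" "finite F"
    and E: "\<forall>(p, x, q)\<in>E. x \<in> carrier G" and PE: "P = {g. \<exists>p\<in>I. \<exists>q\<in>F. gpath G E p g q}"
    using rat unfolding rational_def P_def by blast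
  obtain h where h: "bij_betw h {0..<card E} E"
    using ex_bij_betw_nat_finite[OF fin(1)] by blast
  define m where "m = card E"
  define src lab tgt where "src = (\<lambda>i. fst (h i))" and "lab = (\<lambda>i. fst (snd (h i)))"
    and "tgt = (\<lambda>i. snd (snd (h i)))"
  have hE: "(src i, lab i, tgt i) \<in> E" if "i < m" for i
    using h that unfolding m_def src_def lab_def tgt_def bij_betw_def by force
  have Eh: "\<exists>i<m. p = src i \<and> x = lab i \<and> q = tgt i" if "(p, x, q) \<in> E" for p x q
  proof -
    have "(p, x, q) \<in> h ` {0..<m}" using h that by (simp add: bij_betw_def m_def)
    then obtain i where "i < m" "h i = (p, x, q)" by auto
    then show ?thesis by (auto simp: src_def lab_def tgt_def)
  qed
  have lab: "lab i \<in> carrier G" if "i < m" for i using hE[OF that] E by auto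
  define f where "f i = (if i < m then lab i else inv (lab (i - m)))" for i
  define A where "A = {0..<2 * m}"
  have fA: "f ` A \<subseteq> carrier G" using lab by (auto simp: f_def A_def)
  \<comment> \<open>State 0 is the start, 1 is a sink, and \<open>Suc (Suc v)\<close> stands for the
    vertex \<open>v\<close>. The letter of an edge is accepted only at the source of that edge, or
    at 0 if this source is initial.\<close>
  define tr where "tr s i = (if i < m \<and> (s = 0 \<and> src i \<in> I \<or> s = Suc (Suc (src i)))
    then Suc (Suc (tgt i)) else 1)" for s i
  have f1: "f i = lab i" and tr2: "tr (Suc (Suc (src i))) i = Suc (Suc (tgt i))"
    and tr0: "src i \<in> I \<Longrightarrow> tr 0 i = Suc (Suc (tgt i))" if "i < m" for i
    using that by (auto simp: f_def tr_def)
  \<comment> \<open>After one letter only targets of edges can be reached, which keeps the set of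
    states finite.\<close>
  define Q where "Q = tgt ` {0..<m}"
  define states where "states = {0, 1} \<union> (Suc \<circ> Suc) ` Q"
  define acc where "acc = (Suc \<circ> Suc) ` (F \<inter> Q)"
  define L where "L = {w. w \<in> lists A \<and> foldl tr 0 w \<in> acc}"
  have "regular_lang A L" unfolding regular_lang_def
    by (intro exI[of _ states] exI[of _ 0] exI[of _ tr] exI[of _ acc])
      (auto simp: states_def acc_def L_def Q_def tr_def)
  have sink: "foldl tr 1 w = 1" for w by (induction w) (auto simp: tr_def)
  have path: "gpath G E p (word_eval G f w) r"
    if "w \<in> lists A" "foldl tr (Suc (Suc p)) w = Suc (Suc r)" for w p r
    using that
  proof (induction w arbitrary: p)
    case (Cons i w)
    have i: "i < m \<and> src i = p"
    proof (rule ccontr)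
      assume "\<not> ?thesis"
      then have "tr (Suc (Suc p)) i = 1" by (auto simp: tr_def)
      then show False using Cons.prems sink[of w] by simp
    qed
    then have "gpath G E (tgt i) (word_eval G f w) r" using Cons by (auto simp: tr_def)
    then show ?case using hE[of i] i by (auto simp: f1 intro: gpath.step)
  qed (auto intro: gpath.nil)
  have word: "\<exists>w\<in>lists A. word_eval G f w = g \<and> foldl tr (Suc (Suc p)) w = Suc (Suc r) \<and> (p \<in> Q \<longrightarrow> r \<in> Q)"
    if "gpath G E p g r" for p g r
    using that
  proof induction
    case (nil p)
    show ?case by (rule bexI[of _ "[]"]) auto
  next
    case (step p x s g q)
    then obtain i where i: "i < m" "p = src i" "x = lab i" "s = tgt i" using Eh by blast
    obtain w where w: "w \<in> lists A" "word_eval G f w = g" "foldl tr (Suc (Suc s)) w = Suc (Suc q)"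
      "s \<in> Q \<longrightarrow> q \<in> Q" using step by blast
    moreover have "i # w \<in> lists A" using i w by (auto simp: A_def)
    ultimately show ?case using i by (intro bexI[of _ "i # w"]) (auto simp: f1 tr2 Q_def)
  qed
  have "word_eval G f w \<in> P" if "w \<in> L" for w
  proof -
    obtain r where w: "w \<in> lists A" "foldl tr 0 w = Suc (Suc r)" "r \<in> F"
      using \<open>w \<in> L\<close> by (auto simp: L_def acc_def)
    then obtain i v where iv: "w = i # v" by (cases w) auto
    have i: "i < m \<and> src i \<in> I"
    proof (rule ccontr)
      assume "\<not> ?thesis"
      then have "tr 0 i = 1" by (auto simp: tr_def)
      then show False using w iv sink[of v] by simp
    qed
    then have "gpath G E (tgt i) (word_eval G f v) r" using w iv by (intro path) (auto simp: tr_def)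
    then have "gpath G E (src i) (word_eval G f w) r" using hE[of i] i iv
      by (auto simp: f1 intro: gpath.step)
    then show ?thesis using i w PE by auto
  qed
  moreover have PL: "\<exists>w\<in>L. word_eval G f w = g" if "g \<in> P" for g
  proof -
    obtain p q where pq: "p \<in> I" "q \<in> F" "gpath G E p g q" using \<open>g \<in> P\<close> PE by auto
    from pq(3) show ?thesis
    \<comment> \<open>State 0 is not accepting, so the empty path has to be excluded: it would put
      \<one> into \<open>P\<close>.\<close>
    proof cases
      case nil
      then show ?thesis using \<open>g \<in> P\<close> P(3) by simp
    next
      case (step x s g')
      then obtain i where i: "i < m" "p = src i" "x = lab i" "s = tgt i" using Eh by blast
      obtain w where w: "w \<in> lists A" "word_eval G f w = g'" "foldl tr (Suc (Suc s)) w = Suc (Suc q)"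
        "s \<in> Q \<longrightarrow> q \<in> Q" using word[OF step(3)] by blast
      moreover have "i # w \<in> lists A" using i w by (auto simp: A_def)
      moreover have "s \<in> Q" using i by (auto simp: Q_def)
      ultimately show ?thesis using i step pq
        by (intro bexI[of _ "i # w"]) (auto simp: f1 tr0 L_def acc_def)
    qed
  qed
  ultimately have LP: "word_eval G f ` L = P" by (auto simp: image_iff)
  \<comment> \<open>The evaluation map is onto because \<open>G\<close> consists of \<one>,
    \<open>P\<close> and the inverses of \<open>P\<close>; the set \<open>M\<close> of values
    contains \<open>P\<close> and is closed under inverses.\<close>
  define M where "M = word_eval G f ` lists A"
  have PM: "P \<subseteq> M" using PL by (force simp: M_def L_def)
  have inv: "inv (word_eval G f w) \<in> M" if "w \<in> lists A" for w
    using that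
  proof (induction w)
    case Nil
    show ?case unfolding M_def by (rule image_eqI[of _ _ "[]"]) auto
  next
    case (Cons i w)
    have "word_eval G f w \<in> carrier G" "f i \<in> carrier G" using Cons fA word_eval_closed[OF _ fA] by auto
    then have "inv (word_eval G f (i # w)) = inv (word_eval G f w) \<otimes> inv (f i)" by (simp add: inv_mult_group)
    moreover obtain v where v: "v \<in> lists A" "inv (word_eval G f w) = word_eval G f v"
      using Cons by (auto simp: M_def)
    moreover obtain j where j: "j \<in> A" "inv (f i) = f j"
    proof (cases "i < m")
      case True
      then show ?thesis by (intro that[of "i + m"]) (auto simp: f_def A_def)
    next
      case False
      then have "i - m < m" using Cons by (auto simp: A_def)
      then show ?thesis using False lab by (intro that[of "i - m"]) (auto simp: f_def A_def)
    qed
    ultimately have "inv (word_eval G f (i # w)) = word_eval G f (v @ [j])"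
      using word_eval_append[OF fA v(1), of "[j]"] fA by auto
    then show ?case using v j by (auto simp: M_def)
  qed
  have "x \<in> M" if "x \<in> carrier G" for x
  proof (cases "x = \<one> \<or> x \<in> P")
    case True
    then show ?thesis using PM by (auto simp: M_def intro: image_eqI[of _ _ "[]"])
  next
    case False
    then have "inv x \<in> P" using P(4)[OF that] by auto
    then obtain w where "w \<in> lists A" "inv x = word_eval G f w" using PM by (auto simp: M_def)
    then show ?thesis using inv[of w] that by (metis inv_inv)
  qed
  then have "word_eval G f ` lists A = carrier G" using word_eval_closed[OF _ fA] by (auto simp: M_def)
  then show ?thesis unfolding regular_left_order_def
    using fA \<open>regular_lang A L\<close> LP by (intro exI[of _ A] exI[of _ f] exI[of _ L]) (auto simp: A_def L_def P_def)
qed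

lemma (in group) all_regular_iff:
  "(\<forall>lt. left_order G lt \<longrightarrow> regular_left_order G lt) \<longleftrightarrow> (\<forall>P. positive_cone G P \<longrightarrow> rational G P)"
  using positive_cone_pos_cone ex_left_order_pos_cone regular_imp_rational rational_imp_regular by metis

section \<open>Lexicographic orders and uncountable families of cones\<close>

text \<open>The letters of the automaton for one cone generate. This supplies finite generation for
  the kernels met in the iteration, about which nothing else is known in advance.\<close>

lemma (in group) rational_cone_generated:
  assumes "positive_cone G P" "rational G P"
  shows "\<exists>S. finite S \<and> S \<subseteq> carrier G \<and> generate G S = carrier G" "countable (carrier G)"
proof -
  obtain lt where lt: "left_order G lt" "pos_cone G lt = P" using ex_left_order_pos_cone[OF assms(1)] by blast
  with rational_imp_regular[of lt] assms(2) have "regular_left_order G lt" by simp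
  then obtain A and f :: "nat \<Rightarrow> 'a" where A: "finite A" "f ` A \<subseteq> carrier G"
    "word_eval G f ` lists A = carrier G"
    unfolding regular_left_order_def by (elim exE conjE) (rule that; assumption)
  have "word_eval G f w \<in> generate G (f ` A)" if "w \<in> lists A" for w
    using that by (induction w) (auto intro: generate.intros)
  then have "carrier G \<subseteq> generate G (f ` A)" unfolding A(3)[symmetric] by blast
  moreover have "generate G (f ` A) \<subseteq> carrier G" using generate_incl[OF A(2)] .
  ultimately show "\<exists>S. finite S \<and> S \<subseteq> carrier G \<and> generate G S = carrier G"
    using A by (intro exI[of _ "f ` A"]) auto
  show "countable (carrier G)" unfolding A(3)[symmetric] by (intro countable_image) simp
qed

text \<open>Existence of a cone is included so that the property is not vacuous when it is passed on
  to subgroups.\<close>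

definition all_rational :: "('a, 'b) monoid_scheme \<Rightarrow> bool" where
  "all_rational G \<longleftrightarrow> (\<exists>P. positive_cone G P) \<and> (\<forall>P. positive_cone G P \<longrightarrow> rational G P)"

lemma (in group) countable_cones:
  assumes "all_rational G"
  shows "countable {P. positive_cone G P}"
proof -
  have c: "countable (carrier G)" using assms rational_cone_generated(2) unfolding all_rational_def by blast
  define Es where "Es = {E. finite E \<and> E \<subseteq> (UNIV :: nat set) \<times> carrier G \<times> (UNIV :: nat set)}"
  define Fs where "Fs = {A :: nat set. finite A}"
  have "countable Es" unfolding Es_def using c by (intro countable_Collect_finite_subset) auto
  moreover have "countable Fs" unfolding Fs_def by (rule countable_Collect_finite)
  ultimately have "countable (Es \<times> Fs \<times> Fs)" by auto
  moreover have "{P. positive_cone G P} \<subseteq>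
    (\<lambda>(E, I, F). {g. \<exists>p\<in>I. \<exists>q\<in>F. gpath G E p g q}) ` (Es \<times> Fs \<times> Fs)"
  proof
    fix P assume "P \<in> {P. positive_cone G P}"
    then have "rational G P" using assms by (simp add: all_rational_def)
    then obtain E :: "(nat \<times> 'a \<times> nat) set" and I F where *: "finite E" "finite I" "finite F"
       "\<forall>(p, x, q)\<in>E. x \<in> carrier G" "P = {g. \<exists>p\<in>I. \<exists>q\<in>F. gpath G E p g q}"
      unfolding rational_def by blast
    then have "(E, I, F) \<in> Es \<times> Fs \<times> Fs" by (auto simp: Es_def Fs_def)
    then show "P \<in> (\<lambda>(E, I, F). {g. \<exists>p\<in>I. \<exists>q\<in>F. gpath G E p g q}) ` (Es \<times> Fs \<times> Fs)"
      using *(5) by (intro image_eqI[of _ _ "(E, I, F)"]) auto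
  qed
  ultimately show ?thesis by (meson countable_image countable_subset)
qed

section \<open>Homomorphisms to ordered abelian groups\<close>

definition add_hom :: "('a, 'b) monoid_scheme \<Rightarrow> ('a \<Rightarrow> 'c::ab_group_add) \<Rightarrow> bool" where
  "add_hom G \<phi> \<longleftrightarrow> (\<forall>x\<in>carrier G. \<forall>y\<in>carrier G. \<phi> (x \<otimes>\<^bsub>G\<^esub> y) = \<phi> x + \<phi> y)"

definition add_ker :: "('a, 'b) monoid_scheme \<Rightarrow> ('a \<Rightarrow> 'c::ab_group_add) \<Rightarrow> 'a set" where
  "add_ker G \<phi> = {x \<in> carrier G. \<phi> x = 0}"

lemma add_hom_mult: "add_hom G \<phi> \<Longrightarrow> x \<in> carrier G \<Longrightarrow> y \<in> carrier G \<Longrightarrow> \<phi> (x \<otimes>\<^bsub>G\<^esub> y) = \<phi> x + \<phi> y"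
  by (simp add: add_hom_def)

context group begin

lemma add_hom_one: "add_hom G \<phi> \<Longrightarrow> \<phi> \<one> = 0"
  using add_hom_mult[of G \<phi> \<one> \<one>] by simp

lemma add_hom_inv: "add_hom G \<phi> \<Longrightarrow> x \<in> carrier G \<Longrightarrow> \<phi> (inv x) = - \<phi> x"
  using add_hom_mult[of G \<phi> x "inv x"] add_hom_one[of \<phi>] by (simp add: eq_neg_iff_add_eq_0 add.commute)

lemma add_hom_nat_pow: "add_hom G \<phi> \<Longrightarrow> x \<in> carrier G \<Longrightarrow> \<phi> (x [^] (n::nat)) = int n * (\<phi> x :: int)"
  by (induction n) (auto simp: add_hom_one add_hom_mult algebra_simps)

lemma add_hom_int_pow: "add_hom G \<phi> \<Longrightarrow> x \<in> carrier G \<Longrightarrow> \<phi> (x [^] (n::int)) = n * (\<phi> x :: int)"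
  by (cases n rule: int_cases2) (auto simp: int_pow_int int_pow_neg_int add_hom_nat_pow add_hom_inv)

lemma add_ker_subgroup: "add_hom G \<phi> \<Longrightarrow> subgroup (add_ker G \<phi>) G"
  by (rule subgroupI) (auto simp: add_ker_def add_hom_one add_hom_inv add_hom_mult intro: exI[of _ \<one>])

lemma add_ker_normal:
  assumes "add_hom G \<phi>"
  shows "add_ker G \<phi> \<lhd> G"
proof (rule normalI[OF add_ker_subgroup[OF assms]])
  have *: "inv x \<otimes> (h \<otimes> x) \<in> add_ker G \<phi> \<and> x \<otimes> (h \<otimes> inv x) \<in> add_ker G \<phi>"
    if "x \<in> carrier G" "h \<in> add_ker G \<phi>" for x h
    using that assms by (auto simp: add_ker_def add_hom_mult add_hom_inv)
  show "\<forall>x\<in>carrier G. add_ker G \<phi> #> x = x <# add_ker G \<phi>"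
  proof (intro ballI equalityI subsetI)
    fix x y assume x: "x \<in> carrier G" and "y \<in> add_ker G \<phi> #> x"
    then obtain h where h: "h \<in> add_ker G \<phi>" "y = h \<otimes> x" by (auto simp: r_coset_def)
    then have "y = x \<otimes> (inv x \<otimes> (h \<otimes> x))" using x by (auto simp: add_ker_def)
    then show "y \<in> x <# add_ker G \<phi>" using *[OF x h(1)] by (auto simp: l_coset_def)
  next
    fix x y assume x: "x \<in> carrier G" and "y \<in> x <# add_ker G \<phi>"
    then obtain h where h: "h \<in> add_ker G \<phi>" "y = x \<otimes> h" by (auto simp: l_coset_def)
    then have "y = x \<otimes> (h \<otimes> inv x) \<otimes> x" using x by (auto simp: add_ker_def m_assoc)
    then show "y \<in> add_ker G \<phi> #> x" using *[OF x h(1)] by (auto simp: r_coset_def)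
  qed
qed

lemma positive_cone_subgroup_iff:
  assumes "subgroup H G"
  shows "positive_cone (G\<lparr>carrier := H\<rparr>) P \<longleftrightarrow> P \<subseteq> H \<and> (\<forall>x\<in>P. \<forall>y\<in>P. x \<otimes> y \<in> P) \<and> \<one> \<notin> P \<and>
     (\<forall>x\<in>H. x \<noteq> \<one> \<longrightarrow> x \<in> P \<or> inv x \<in> P)"
  using m_inv_consistent[OF assms] by (auto simp: positive_cone_def)

lemma positive_cone_restrict:
  assumes "subgroup H G" "positive_cone G P"
  shows "positive_cone (G\<lparr>carrier := H\<rparr>) (P \<inter> H)"
  using positive_coneD[OF assms(2)] subgroup.m_closed[OF assms(1)] subgroup.m_inv_closed[OF assms(1)]
    subgroup.mem_carrier[OF assms(1)]
  by (auto simp: positive_cone_subgroup_iff[OF assms(1)])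

text \<open>The codomain is a general ordered group because the kernels need integer heights while
  the uncountable family below needs real ones.\<close>

lemma positive_cone_lex:
  fixes \<phi> :: "'a \<Rightarrow> 'c::linordered_ab_group_add"
  assumes \<phi>: "add_hom G \<phi>" and Q: "positive_cone (G\<lparr>carrier := add_ker G \<phi>\<rparr>) Q"
  shows "positive_cone G ({x \<in> carrier G. \<phi> x > 0} \<union> Q)" (is "positive_cone G ?P")
proof -
  have Q: "Q \<subseteq> add_ker G \<phi>" "\<forall>x\<in>Q. \<forall>y\<in>Q. x \<otimes> y \<in> Q" "\<one> \<notin> Q"
     "\<forall>x\<in>add_ker G \<phi>. x \<noteq> \<one> \<longrightarrow> x \<in> Q \<or> inv x \<in> Q"
    using Q unfolding positive_cone_subgroup_iff[OF add_ker_subgroup[OF \<phi>]] by blast+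
  show ?thesis unfolding positive_cone_def
  proof (intro conjI ballI impI)
    show "?P \<subseteq> carrier G" "\<one> \<notin> ?P" using Q add_hom_one[OF \<phi>] by (auto simp: add_ker_def)
    show "x \<otimes> y \<in> ?P" if "x \<in> ?P" "y \<in> ?P" for x y
      using that Q(1,2) add_hom_mult[OF \<phi>, of x y] by (auto simp: add_ker_def subset_iff add_pos_pos)
    show "x \<in> ?P \<or> inv x \<in> ?P" if "x \<in> carrier G" "x \<noteq> \<one>" for x
      using that Q(4) add_hom_inv[OF \<phi>, of x] by (cases "\<phi> x" "0 :: 'c" rule: linorder_cases) (auto simp: add_ker_def)
  qed
qed

lemma uncountable_cones_rank2:
  fixes \<phi> \<psi> :: "'a \<Rightarrow> int"
  assumes \<phi>: "add_hom G \<phi>" and \<psi>: "add_hom G \<psi>" and P: "positive_cone G P"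
    and ab: "a \<in> carrier G" "b \<in> carrier G" "\<phi> a * \<psi> b \<noteq> \<phi> b * \<psi> a"
  shows "uncountable {P. positive_cone G P}"
proof -
  define \<kappa> where "\<kappa> \<alpha> x = real_of_int (\<phi> x) + \<alpha> * real_of_int (\<psi> x)" for \<alpha> x
  have \<kappa>: "add_hom G (\<kappa> \<alpha>)" for \<alpha>
    using \<phi> \<psi> by (auto simp: add_hom_def \<kappa>_def algebra_simps)
  define C where "C \<alpha> = {x \<in> carrier G. \<kappa> \<alpha> x > 0} \<union> (P \<inter> add_ker G (\<kappa> \<alpha>))" for \<alpha>
  have C: "positive_cone G (C \<alpha>)" for \<alpha>
    unfolding C_def by (intro positive_cone_lex positive_cone_restrict \<kappa> P add_ker_subgroup)
  have sep: "\<exists>x\<in>carrier G. \<kappa> \<alpha> x < 0 \<and> \<kappa> \<beta> x > 0" if less: "\<alpha> < \<beta>" for \<alpha> \<beta>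
  proof -
    obtain r where "r \<in> \<rat>" "\<alpha> < r" "r < \<beta>" using Rats_dense_in_real[OF less] by blast
    then obtain p q where q: "q > 0" and r: "r = of_int p / of_int q" by (meson Rats_cases')
    define D where "D = \<phi> a * \<psi> b - \<phi> b * \<psi> a"
    \<comment> \<open>Cramer's rule: the exponents are chosen such that (\<phi> x, \<psi> x) is
      \<open>D\<close> times (- p, q). The height of \<open>x\<close> then vanishes at the slope
      \<open>r\<close> and changes sign there, so it separates \<alpha> from \<beta>.\<close>
    define x where "x = a [^] (- p * \<psi> b - q * \<phi> b) \<otimes> b [^] (q * \<phi> a + p * \<psi> a)"
    have x: "x \<in> carrier G" using ab by (simp add: x_def)
    have "\<phi> x = - p * D" "\<psi> x = q * D"
      using ab by (simp_all add: x_def D_def add_hom_mult[OF \<phi>] add_hom_mult[OF \<psi>]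
        add_hom_int_pow[OF \<phi>] add_hom_int_pow[OF \<psi>] algebra_simps)
    then have "\<kappa> \<gamma> x = real_of_int q * D * (\<gamma> - r)" for \<gamma>
      using q by (simp add: \<kappa>_def r field_simps)
    then have *: "\<kappa> \<alpha> x = real_of_int q * D * (\<alpha> - r)" "\<kappa> \<beta> x = real_of_int q * D * (\<beta> - r)" by auto
    have "\<alpha> - r < 0" "\<beta> - r > 0" using \<open>\<alpha> < r\<close> \<open>r < \<beta>\<close> by auto
    moreover have "D \<noteq> 0" using ab by (simp add: D_def)
    then have "real_of_int D \<noteq> 0" by simp
    ultimately have "if D > 0 then \<kappa> \<alpha> x < 0 \<and> \<kappa> \<beta> x > 0 else \<kappa> \<alpha> x > 0 \<and> \<kappa> \<beta> x < 0"
      using q unfolding * by (auto simp: mult_less_0_iff zero_less_mult_iff)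
    then show ?thesis using x add_hom_inv[OF \<kappa> x, of \<alpha>] add_hom_inv[OF \<kappa> x, of \<beta>]
      by (cases "D > 0") (auto intro: bexI[of _ x] bexI[of _ "inv x"])
  qed
  have "C \<alpha> \<noteq> C \<beta>" if "\<alpha> < \<beta>" for \<alpha> \<beta>
    using sep[OF that] by (force simp: C_def add_ker_def)
  then have "inj C" by (metis injI linorder_neq_iff)
  then have "uncountable (range C)" using countable_image_inj_on uncountable_UNIV_real by blast
  then show ?thesis using C by (meson countable_subset image_subsetI mem_Collect_eq)
qed

text \<open>If \<psi> is nonzero, countability forces \<phi> to be proportional to it. Used in both
  directions to identify kernels, and with \<phi> a conjugate of \<psi> to show that a kernel is
  invariant.\<close>

lemma add_ker_mono_of_countable_cones:
  fixes \<phi> \<psi> :: "'a \<Rightarrow> int"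
  assumes "countable {P. positive_cone G P}" "positive_cone G P" "add_hom G \<phi>" "add_hom G \<psi>"
    and "b \<in> carrier G" "\<psi> b \<noteq> 0"
  shows "add_ker G \<psi> \<subseteq> add_ker G \<phi>"
proof
  fix a assume "a \<in> add_ker G \<psi>"
  then have a: "a \<in> carrier G" "\<psi> a = 0" by (auto simp: add_ker_def)
  then have "\<phi> a * \<psi> b = \<phi> b * \<psi> a"
    using uncountable_cones_rank2[OF assms(3,4,2), of a b] assms by blast
  then show "a \<in> add_ker G \<phi>" using a assms by (auto simp: add_ker_def)
qed

end

section \<open>Restricting rational cones to a kernel\<close>

lemma gpath_carrier [simp]: "gpath (G\<lparr>carrier := H\<rparr>) E p g q \<longleftrightarrow> gpath G E p g q"
proof
  show "gpath G E p g q" if "gpath (G\<lparr>carrier := H\<rparr>) E p g q"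
    using that by induction (auto intro: gpath.intros)
  show "gpath (G\<lparr>carrier := H\<rparr>) E p g q" if "gpath G E p g q"
    using that
  proof induction
    case (nil p)
    show ?case using gpath.nil[of "G\<lparr>carrier := H\<rparr>"] by simp
  next
    case (step p x r g q)
    then show ?case using gpath.step[of p x r E "G\<lparr>carrier := H\<rparr>" g q] by simp
  qed
qed

text \<open>A prefix \<open>g\<close> of a word for an element of the kernel can be completed, from the state it leads
  to, by one of finitely many words to a positive element, and likewise for the remaining suffix.
  As elements of negative height are never positive, the height of \<open>g\<close> is bounded on both sides.
  So only a finite window of heights is visited.\<close>

lemma (in group) rational_add_ker:
  fixes \<phi> :: "'a \<Rightarrow> int"
  assumes \<phi>: "add_hom G \<phi>" and t: "t \<in> carrier G" "\<phi> t = 1"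
    and Q: "positive_cone (G\<lparr>carrier := add_ker G \<phi>\<rparr>) Q"
    and rat: "rational G ({x \<in> carrier G. \<phi> x > 0} \<union> Q)"
  shows "rational (G\<lparr>carrier := add_ker G \<phi>\<rparr>) Q"
proof -
  define P where "P = {x \<in> carrier G. \<phi> x > 0} \<union> Q"
  have Qker: "Q \<subseteq> add_ker G \<phi>" using Q by (simp add: positive_cone_def)
  have Q0: "\<phi> x = 0" if "x \<in> Q" for x using Qker that by (auto simp: add_ker_def)
  have Ppos: "\<phi> x \<ge> 0" if "x \<in> P" for x using that Q0[of x] unfolding P_def by (elim UnE) simp_all
  have PQ: "x \<in> Q \<longleftrightarrow> x \<in> P \<and> \<phi> x = 0" for x using Q0[of x] unfolding P_def by force
  obtain E :: "(nat \<times> 'a \<times> nat) set" and I F where fin: "finite E" "finite I" "finite F"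
    and E: "\<forall>(p, x, q)\<in>E. x \<in> carrier G" and PE: "P = {g. \<exists>p\<in>I. \<exists>q\<in>F. gpath G E p g q}"
    using rat unfolding rational_def P_def by blast
  have E': "x \<in> carrier G" if "(p, x, q) \<in> E" for p x q using E that by auto
  have closed: "g \<in> carrier G" if "gpath G E p g q" for p g q
    using gpath_closed[OF that E'] .
  have append: "gpath G E p (g \<otimes> h) r" if "gpath G E p g q" "gpath G E q h r" for p g q h r
    using gpath_append[OF that E'] .
  define V where "V = I \<union> (\<lambda>(p, x, q). q) ` E"
  have finV: "finite V" using fin by (simp add: V_def)
  have V: "q \<in> V" if "gpath G E p g q" "p \<in> V" for p g q
    using that by induction (force simp: V_def)+
  \<comment> \<open>A label leading from an initial vertex to \<open>q\<close>, and below one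
    leading from \<open>q\<close> to a final vertex. Where no such path exists the value is
    arbitrary, which can only enlarge the bound \<open>W\<close>.\<close>
  define u where "u q = (SOME u. \<exists>p\<in>I. gpath G E p u q)" for q
  define v where "v q = (SOME v. \<exists>r\<in>F. gpath G E q v r)" for q
  define W where "W = (\<Sum>q\<in>V. \<bar>\<phi> (u q)\<bar> + \<bar>\<phi> (v q)\<bar>)"
  have W: "\<bar>\<phi> (u q)\<bar> + \<bar>\<phi> (v q)\<bar> \<le> W" if "q \<in> V" for q
    unfolding W_def using finV that by (intro member_le_sum) auto
  have window: "\<bar>\<phi> g\<bar> \<le> W"
    if *: "p \<in> I" "gpath G E p g q" "gpath G E q h r" "r \<in> F" "g \<otimes> h \<in> Q" for p g q h r
  proof -
    have qV: "q \<in> V" using V[OF *(2)] *(1) by (simp add: V_def)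
    have "\<exists>p\<in>I. gpath G E p (u q) q" unfolding u_def by (rule someI[of _ g]) (use * in blast)
    then have u: "u q \<otimes> h \<in> P" "u q \<in> carrier G" using * append closed unfolding PE by blast+
    have "\<exists>r\<in>F. gpath G E q (v q) r" unfolding v_def by (rule someI[of _ h]) (use * in blast)
    then have v: "g \<otimes> v q \<in> P" "v q \<in> carrier G" using * append closed unfolding PE by blast+
    have gh: "g \<in> carrier G" "h \<in> carrier G" using * closed by blast+
    have "\<phi> g + \<phi> h = 0" using *(5) gh by (simp add: PQ add_hom_mult[OF \<phi>])
    moreover have "\<phi> (u q) + \<phi> h \<ge> 0" using Ppos[OF u(1)] u gh by (simp add: add_hom_mult[OF \<phi>])
    moreover have "\<phi> g + \<phi> (v q) \<ge> 0" using Ppos[OF v(1)] v gh by (simp add: add_hom_mult[OF \<phi>])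
    ultimately show ?thesis using W[OF qV] by linarith
  qed
  \<comment> \<open>The new state remembers the height \<open>k\<close> read so far. Multiplying by
    powers of \<open>t\<close> on both sides brings each label into the kernel, as for Schreier
    generators, and these powers cancel along a path.\<close>
  define ed where "ed = (\<lambda>((p::nat, x, q::nat), k::int). ((p, k), t [^] k \<otimes> x \<otimes> inv (t [^] (k + \<phi> x)), (q, k + \<phi> x)))"
  define E2 where "E2 = ed ` (E \<times> {- W..W})"
  have tk: "t [^] k \<in> carrier G" for k :: int using t by simp
  have \<phi>t: "\<phi> (t [^] k) = k" for k :: int using add_hom_int_pow[OF \<phi> t(1)] t by simp
  have sound: "\<exists>g. gpath G E (fst p') g (fst q') \<and> snd q' = snd p' + \<phi> g \<and>
      h = t [^] snd p' \<otimes> g \<otimes> inv (t [^] snd q')"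
    if "gpath G E2 p' h q'" for p' q' h
    using that
  proof induction
    case (nil p')
    show ?case using tk t by (intro exI[of _ \<one>] conjI gpath.nil) (auto simp: add_hom_one[OF \<phi>] int_pow_mult)
  next
    case (step p' y r' h q')
    obtain p x r k where e: "(p, x, r) \<in> E" "p' = (p, k)" "r' = (r, k + \<phi> x)"
      "y = t [^] k \<otimes> x \<otimes> inv (t [^] (k + \<phi> x))"
      using step.hyps(1) by (auto simp: E2_def ed_def)
    obtain g where g: "gpath G E r g (fst q')" "snd q' = k + \<phi> x + \<phi> g"
      "h = t [^] (k + \<phi> x) \<otimes> g \<otimes> inv (t [^] snd q')" using step.IH e by auto
    have "x \<in> carrier G" "g \<in> carrier G" using E' closed e g by blast+
    then have "y \<otimes> h = t [^] k \<otimes> (x \<otimes> g) \<otimes> inv (t [^] snd q')" "\<phi> (x \<otimes> g) = \<phi> x + \<phi> g"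
      using tk e g by (simp_all add: m_assoc add_hom_mult[OF \<phi>])
    then show ?case using e g by (intro exI[of _ "x \<otimes> g"]) (auto intro: gpath.step)
  qed
  \<comment> \<open>The induction runs over the suffix with the prefix \<open>g\<close> kept
    arbitrary, since the window bound speaks about a complete accepted path through the current
    vertex.\<close>
  have complete: "gpath G E2 (q, \<phi> g) (t [^] \<phi> g \<otimes> h) (r, 0)"
    if "gpath G E q h r" "r \<in> F" "p \<in> I" "gpath G E p g q" "g \<otimes> h \<in> Q" for q h r p g
    using that
  proof (induction arbitrary: g)
    case (nil q)
    then have "g \<in> carrier G" using closed by blast
    then have "\<phi> g = 0" using nil by (simp add: PQ)
    then show ?case using gpath.nil[of G E2 "(q, 0)"] by simp
  next
    case (step q x s h r)
    have xh: "x \<in> carrier G" "h \<in> carrier G" "g \<in> carrier G" using E' closed step by blast+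
    have "gpath G E q (x \<otimes> \<one>) s" using gpath.step[OF step.hyps(1) gpath.nil] .
    then have "gpath G E q x s" using xh by simp
    then have "gpath G E p (g \<otimes> x) s" using append step by blast
    moreover have "g \<otimes> x \<otimes> h \<in> Q" using step xh by (simp add: m_assoc)
    ultimately have IH: "gpath G E2 (s, \<phi> g + \<phi> x) (t [^] (\<phi> g + \<phi> x) \<otimes> h) (r, 0)"
      using step.IH[of "g \<otimes> x"] step.prems xh by (simp add: add_hom_mult[OF \<phi>])
    have "gpath G E q (x \<otimes> h) r" using step by (auto intro: gpath.step)
    then have "\<bar>\<phi> g\<bar> \<le> W" using window step.prems by blast
    then have "((q, x, s), \<phi> g) \<in> E \<times> {- W..W}" using step.hyps(1) by auto
    then have "ed ((q, x, s), \<phi> g) \<in> E2" unfolding E2_def by (rule imageI)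
    then have "((q, \<phi> g), t [^] \<phi> g \<otimes> x \<otimes> inv (t [^] (\<phi> g + \<phi> x)), (s, \<phi> g + \<phi> x)) \<in> E2"
      by (simp add: ed_def)
    from gpath.step[OF this IH] show ?case using xh tk by (simp add: m_assoc)
  qed
  show ?thesis
  proof (rule rationalI)
    show "finite E2" "finite (I \<times> {0::int})" "finite (F \<times> {0::int})" using fin by (auto simp: E2_def)
    show "x \<in> carrier (G\<lparr>carrier := add_ker G \<phi>\<rparr>)" if "(p', x, q') \<in> E2" for p' x q'
      using that E' tk by (auto simp: E2_def ed_def add_ker_def add_hom_mult[OF \<phi>] add_hom_inv[OF \<phi>] \<phi>t)
    show "Q = {g. \<exists>p\<in>I \<times> {0}. \<exists>q\<in>F \<times> {0}. gpath (G\<lparr>carrier := add_ker G \<phi>\<rparr>) E2 p g q}" (is "_ = ?R")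
    proof (intro equalityI subsetI)
      fix g assume "g \<in> Q"
      then obtain p r where pr: "p \<in> I" "r \<in> F" "gpath G E p g r" using PQ PE by auto
      then have "g \<in> carrier G" using closed by blast
      then have "gpath G E2 (p, 0) g (r, 0)"
        using complete[OF pr(3,2,1) gpath.nil] \<open>g \<in> Q\<close> by (simp add: add_hom_one[OF \<phi>])
      then show "g \<in> ?R" using pr by auto
    next
      fix h assume "h \<in> ?R"
      then obtain p q where pq: "p \<in> I" "q \<in> F" "gpath G E2 (p, 0) h (q, 0)" by auto
      from sound[OF pq(3)] obtain g where g: "gpath G E p g q" "\<phi> g = 0" "h = \<one> \<otimes> g \<otimes> inv \<one>"
        by auto
      then have "h = g" using closed by auto
      then show "h \<in> Q" using g pq PQ PE by auto
    qed
  qed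
qed

lemma (in group) all_rational_add_ker:
  fixes \<phi> :: "'a \<Rightarrow> int"
  assumes \<phi>: "add_hom G \<phi>" "t \<in> carrier G" "\<phi> t = 1" and "all_rational G"
  shows "all_rational (G\<lparr>carrier := add_ker G \<phi>\<rparr>)"
  unfolding all_rational_def
proof (intro conjI allI impI)
  show "\<exists>P. positive_cone (G\<lparr>carrier := add_ker G \<phi>\<rparr>) P"
    using assms(4) positive_cone_restrict[OF add_ker_subgroup[OF \<phi>(1)]] unfolding all_rational_def by blast
next
  fix Q assume Q: "positive_cone (G\<lparr>carrier := add_ker G \<phi>\<rparr>) Q"
  show "rational (G\<lparr>carrier := add_ker G \<phi>\<rparr>) Q"
    using rational_add_ker[OF \<phi> Q] positive_cone_lex[OF \<phi>(1) Q] assms(4) by (simp add: all_rational_def)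
qed

text \<open>An element that leaves the chain is compared at the last \<open>K n\<close> containing
  it, with a sign chosen freely for each \<open>n\<close>. The intersection of the chain may be
  nontrivial; there \<open>P\<close> decides.\<close>

lemma (in group) uncountable_cones_chain:
  fixes \<phi> :: "nat \<Rightarrow> 'a \<Rightarrow> int"
  assumes K: "K 0 = carrier G" "\<And>n. subgroup (K n) G" "\<And>n. K (Suc n) = add_ker (G\<lparr>carrier := K n\<rparr>) (\<phi> n)"
    and \<phi>: "\<And>n. add_hom (G\<lparr>carrier := K n\<rparr>) (\<phi> n)" and s: "\<And>n. s n \<in> K n" "\<And>n. \<phi> n (s n) = 1"
    and P: "positive_cone G P"
  shows "uncountable {P. positive_cone G P}"
proof -
  note P = positive_coneD[OF P]
  have KS: "K (Suc n) = {x \<in> K n. \<phi> n x = 0}" for n using K(3) by (simp add: add_ker_def)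
  have dec: "K m \<subseteq> K n" if "n \<le> m" for n m
    using that by (induction rule: dec_induct) (auto simp: KS)
  have \<phi>m: "\<phi> n (x \<otimes> y) = \<phi> n x + \<phi> n y" if "x \<in> K n" "y \<in> K n" for n x y
    using add_hom_mult[OF \<phi>[of n]] that by simp
  note Km = subgroup.m_closed[OF K(2)] and Kinv = subgroup.m_inv_closed[OF K(2)]
    and K1 = subgroup.one_closed[OF K(2)]
  have \<phi>1: "\<phi> n \<one> = 0" for n using \<phi>m[OF K1 K1, of n] by simp
  have \<phi>inv: "\<phi> n (inv x) = - \<phi> n x" if "x \<in> K n" for n x
    using \<phi>m[OF that Kinv[OF that]] \<phi>1[of n] subgroup.mem_carrier[OF K(2) that] by simp
  define \<sigma> :: "nat set \<Rightarrow> nat \<Rightarrow> int" where "\<sigma> A n = (if n \<in> A then 1 else -1)" for A n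
  define C where "C A = {g. \<exists>n. g \<in> K n \<and> \<sigma> A n * \<phi> n g > 0} \<union> {g. (\<forall>n. g \<in> K n) \<and> g \<in> P}" for A
  have zero: "\<phi> n x = 0" if "x \<in> K m" "n < m" for n m x
    using dec[of "Suc n" m] that KS by auto
  have "positive_cone G (C A)" for A
    unfolding positive_cone_def
  proof (intro conjI ballI impI)
    show "C A \<subseteq> carrier G" using subgroup.mem_carrier[OF K(2)] by (auto simp: C_def)
    show "\<one> \<notin> C A" using \<phi>1 P by (auto simp: C_def)
    show "x \<in> C A \<or> inv x \<in> C A" if x: "x \<in> carrier G" "x \<noteq> \<one>" for x
    proof (cases "\<forall>n. x \<in> K n")
      case True
      then show ?thesis using P(4)[OF x] Kinv by (auto simp: C_def)
    next
      case False
      \<comment> \<open>The least index missing \<open>x\<close> is a successor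
        \<open>Suc n\<close>, and \<phi> at level \<open>n\<close> is nonzero on \<open>x\<close>
        because \<open>x\<close> lies in \<open>K n\<close> but not in the next kernel.\<close>
      define m where "m = (LEAST n. x \<notin> K n)"
      have m: "x \<notin> K m" unfolding m_def using False LeastI_ex[of "\<lambda>n. x \<notin> K n"] by blast
      then obtain n where n: "m = Suc n" using x K(1) by (cases m) auto
      have xn: "x \<in> K n" using not_less_Least[of n "\<lambda>n. x \<notin> K n"] n by (auto simp: m_def)
      then have "\<phi> n x \<noteq> 0" using m n KS by auto
      then have "\<sigma> A n * \<phi> n x > 0 \<or> \<sigma> A n * \<phi> n (inv x) > 0" using \<phi>inv[OF xn] by (auto simp: \<sigma>_def)
      then show ?thesis using xn Kinv[OF xn] unfolding C_def by blast
    qed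
    show "x \<otimes> y \<in> C A" if "x \<in> C A" "y \<in> C A" for x y
    proof -
      have *: "x \<otimes> y \<in> C A"
        if "x \<in> K n" "y \<in> K n" "\<sigma> A n * \<phi> n x + \<sigma> A n * \<phi> n y > 0" for n
        using that \<phi>m[OF that(1,2)] Km[OF that(1,2)] unfolding C_def by (auto simp: algebra_simps)
      from that consider
          (1) n m where "x \<in> K n" "\<sigma> A n * \<phi> n x > 0" "y \<in> K m" "\<sigma> A m * \<phi> m y > 0"
        | (2) n where "x \<in> K n" "\<sigma> A n * \<phi> n x > 0" "\<forall>n. y \<in> K n"
        | (3) n where "y \<in> K n" "\<sigma> A n * \<phi> n y > 0" "\<forall>n. x \<in> K n"
        | (4) "\<forall>n. x \<in> K n" "\<forall>n. y \<in> K n" "x \<in> P" "y \<in> P"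
        unfolding C_def by blast
      then show ?thesis
      proof cases
        case 1
        consider "n < m" | "n = m" | "m < n" by linarith
        then show ?thesis
        proof cases
          case 1
          then show ?thesis using *[of n] zero[of y m n] dec[of n m] \<open>x \<in> K n\<close> \<open>y \<in> K m\<close> \<open>\<sigma> A n * \<phi> n x > 0\<close> by auto
        next
          case 2
          then show ?thesis using *[of n] 1 by auto
        next
          case 3
          then show ?thesis using *[of m] zero[of x n m] dec[of m n] \<open>x \<in> K n\<close> \<open>y \<in> K m\<close> \<open>\<sigma> A m * \<phi> m y > 0\<close> by auto
        qed
      next
        case 2
        then show ?thesis using *[of n] zero[of y "Suc n" n] by auto
      next
        case 3
        then show ?thesis using *[of n] zero[of x "Suc n" n] by auto
      next
        case 4
        then show ?thesis using P(2) Km by (auto simp: C_def)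
      qed
    qed
  qed
  moreover have "inj C"
  proof (rule injI)
    \<comment> \<open>The witness \<open>s n\<close> has height 1 at level \<open>n\<close> and is
      invisible at all others, so membership in the cone reads off the sign chosen there.\<close>
    have sC: "s n \<in> C A \<longleftrightarrow> n \<in> A" for n A
    proof
      assume "n \<in> A"
      then show "s n \<in> C A" using s[of n] by (auto simp: C_def \<sigma>_def intro!: exI[of _ n])
    next
      assume "s n \<in> C A"
      moreover have "s n \<notin> K (Suc n)" using s[of n] by (simp add: KS)
      ultimately obtain m where m: "s n \<in> K m" "\<sigma> A m * \<phi> m (s n) > 0" by (auto simp: C_def)
      have "\<not> m < n" using zero[OF s(1), of m n] m by auto
      moreover have "\<not> n < m" using zero[OF m(1), of n] s by auto
      ultimately have "m = n" by linarith
      then show "n \<in> A" using m s[of n] by (auto simp: \<sigma>_def split: if_splits)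
    qed
    show "A = B" if "C A = C B" for A B using sC that by blast
  qed
  moreover have "uncountable (UNIV :: nat set set)"
    using nat_sets_eqpoll_reals uncountable_UNIV_real countable_lepoll eqpoll_imp_lepoll eqpoll_sym by metis
  ultimately have "range C \<subseteq> {P. positive_cone G P}" "uncountable (range C)"
    using countable_image_inj_on[of C UNIV] by auto
  then show ?thesis using countable_subset by blast
qed

section \<open>Cones with a finite conjugation orbit\<close>

text \<open>A minimal closed invariant set is a single point with finite orbit unless it is perfect,
  in which case it is uncountable.\<close>

lemma countable_compact_finite_orbit:
  assumes S: "compact_space S" "Hausdorff_space S" "countable (topspace S)" "topspace S \<noteq> {}"
    and A: "A \<noteq> {}" "\<And>g. g \<in> A \<Longrightarrow> continuous_map S S (act g)" "\<And>g. g \<in> A \<Longrightarrow> inj_on (act g) (topspace S)"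
    and comp: "\<And>g h x. g \<in> A \<Longrightarrow> h \<in> A \<Longrightarrow> x \<in> topspace S \<Longrightarrow> \<exists>k\<in>A. act k x = act g (act h x)"
  shows "\<exists>x\<in>topspace S. finite ((\<lambda>g. act g x) ` A)"
proof -
  have act: "act g x \<in> topspace S" if "g \<in> A" "x \<in> topspace S" for g x
    using continuous_map_image_subset_topspace[OF A(2)[OF that(1)]] that(2) by blast
  \<comment> \<open>The complements of nonempty closed invariant sets: a maximal member of
    \<open>F\<close> is the complement of a minimal such set \<open>M\<close>.\<close>
  define F where "F = {U. openin S U \<and> U \<noteq> topspace S \<and> (\<forall>g\<in>A. \<forall>x\<in>topspace S - U. act g x \<notin> U)}"
  have "\<exists>U\<in>F. \<forall>V\<in>F. U \<subseteq> V \<longrightarrow> V = U"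
  proof (rule subset_Zorn_nonempty)
    have "{} \<in> F" by (simp add: F_def S(4)[symmetric])
    then show "F \<noteq> {}" by auto
    fix C assume C: "C \<noteq> {}" "subset.chain F C"
    then have CF: "C \<subseteq> F" by (simp add: subset.chain_def)
    \<comment> \<open>By compactness a chain covering the space has a finite subchain covering it,
      and then one member would be the whole space.\<close>
    have "\<Union>C \<noteq> topspace S"
    proof
      assume eq: "\<Union>C = topspace S"
      then obtain D where D: "finite D" "D \<subseteq> C" "topspace S \<subseteq> \<Union>D"
        using S(1) CF unfolding compact_space_alt F_def by (metis (no_types, lifting) mem_Collect_eq order_refl subsetD)
      then have "D \<noteq> {}" using S(4) by auto
      moreover have "subset.chain F D" using C(2) D(2) unfolding subset.chain_def by blast
      ultimately have "\<Union>D \<in> F" using Union_in_chain[OF D(1)] D(2) CF by blast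
      moreover have "\<Union>D = topspace S" using D eq by auto
      ultimately show False by (auto simp: F_def)
    qed
    moreover have "openin S (\<Union>C)" using CF by (intro openin_Union) (auto simp: F_def)
    moreover have "act g x \<notin> \<Union>C" if "g \<in> A" "x \<in> topspace S - \<Union>C" for g x
      using CF that by (fastforce simp: F_def)
    ultimately show "\<Union>C \<in> F" by (auto simp: F_def)
  qed
  then obtain U where U: "U \<in> F" "\<And>V. V \<in> F \<Longrightarrow> U \<subseteq> V \<Longrightarrow> V = U" by blast
  define M where "M = topspace S - U"
  have M: "closedin S M" "M \<noteq> {}" "M \<subseteq> topspace S" "\<And>g x. g \<in> A \<Longrightarrow> x \<in> M \<Longrightarrow> act g x \<in> M"
    using U(1) act openin_subset[of S U] by (auto simp: F_def M_def)
  \<comment> \<open>By minimality the closure of the orbit of any point of \<open>M\<close> is all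
    of \<open>M\<close>.\<close>
  have dense: "\<exists>g\<in>A. act g x \<in> T" if x: "x \<in> M" and T: "openin S T" "z \<in> T \<inter> M" for x T z
  proof -
    define Z where "Z = S closure_of ((\<lambda>g. act g x) ` A)"
    have orbM: "(\<lambda>g. act g x) ` A \<subseteq> M" using M(4) x by auto
    then have ZM: "Z \<subseteq> M" unfolding Z_def using M(1) by (rule closure_of_minimal)
    have "(\<lambda>g. act g x) ` A \<subseteq> Z" unfolding Z_def
      using orbM M(3) by (intro closure_of_subset) simp
    then have "Z \<noteq> {}" using A(1) by auto
    then have "topspace S - Z \<noteq> topspace S" using ZM M(3) by auto
    moreover have "act g y \<in> Z" if g: "g \<in> A" and y: "y \<in> Z" for g y
    proof -
      have "act g y \<in> S closure_of (act g ` (\<lambda>g. act g x) ` A)"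
        using continuous_map_image_closure_subset[OF A(2)[OF g]] y unfolding Z_def by blast
      moreover have "act g ` (\<lambda>g. act g x) ` A \<subseteq> (\<lambda>g. act g x) ` A"
      proof clarify
        fix h assume "h \<in> A"
        then obtain k where "k \<in> A" "act k x = act g (act h x)" using comp[OF g, of h x] x M(3) by blast
        then show "act g (act h x) \<in> (\<lambda>g. act g x) ` A" by (intro image_eqI[of _ _ k]) simp_all
      qed
      ultimately show ?thesis unfolding Z_def using closure_of_mono by blast
    qed
    ultimately have "topspace S - Z \<in> F" unfolding F_def by (auto simp: Z_def)
    moreover have "U \<subseteq> topspace S - Z" using ZM U(1) openin_subset[of S U] by (auto simp: M_def F_def)
    ultimately have "topspace S - Z = U" using U(2) by blast
    then have "z \<in> Z" using T M(3) by (auto simp: M_def)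
    then show ?thesis using T unfolding Z_def in_closure_of by auto
  qed
  have der: "S derived_set_of M \<subseteq> M" using closedin_contains_derived_set[of S M] M(1) by simp
  have "S derived_set_of M \<noteq> M"
  proof
    assume "S derived_set_of M = M"
    then have "(UNIV :: real set) \<lesssim> M"
      by (rule lepoll_perfect_set[OF disjI2[OF conjI[OF compact_imp_locally_compact_space[OF S(1)] S(2)]] _ M(2)])
    moreover have "countable M" using S(3) M(3) countable_subset by blast
    ultimately show False using countable_lepoll uncountable_UNIV_real by blast
  qed
  then obtain p where p: "p \<in> M" "p \<notin> S derived_set_of M"
    using der by blast
  then obtain T where T: "p \<in> T" "openin S T" "\<And>y. y \<in> M \<Longrightarrow> y \<in> T \<Longrightarrow> y = p"
    using M(3) by (auto simp: in_derived_set_of)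
  \<comment> \<open>One isolated point \<open>p\<close> makes every point of \<open>M\<close>
    isolated: some \<open>act g\<close> carries \<open>y\<close> into the neighbourhood of
    \<open>p\<close>, and the preimage of it meets \<open>M\<close> only in \<open>y\<close> by
    injectivity.\<close>
  have iso: "y \<notin> S derived_set_of M" if y: "y \<in> M" for y
  proof -
    obtain g where g: "g \<in> A" "act g y \<in> T" using dense[OF y T(2), of p] T(1) p(1) by blast
    define T' where "T' = {x \<in> topspace S. act g x \<in> T}"
    have "openin S T'" unfolding T'_def using openin_continuous_map_preimage[OF A(2)[OF g(1)] T(2)] .
    moreover have "y \<in> T'" using g y M(3) by (auto simp: T'_def)
    moreover have "z = y" if "z \<in> M" "z \<in> T'" for z
    proof -
      have "act g z = p" "act g y = p" using T(3) M(4)[OF g(1)] that g y by (auto simp: T'_def)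
      then show ?thesis using A(3)[OF g(1)] that y M(3) by (metis inj_onD subsetD)
    qed
    ultimately show ?thesis unfolding in_derived_set_of by blast
  qed
  have "finite M"
  \<comment> \<open>An infinite subset of a compact space has a limit point, and \<open>M\<close>
    has none.\<close>
  proof (rule ccontr)
    assume "infinite M"
    then have "S derived_set_of M \<noteq> {}" using compact_space_imp_Bolzano_Weierstrass[OF S(1)] M(3) by blast
    then show False using iso der by blast
  qed
  obtain x where x: "x \<in> M" using M(2) by blast
  then have "(\<lambda>g. act g x) ` A \<subseteq> M" using M(4) by auto
  then have "finite ((\<lambda>g. act g x) ` A)" using \<open>finite M\<close> by (rule finite_subset)
  then show ?thesis using x M(3) by blast
qed

section \<open>The action by conjugation on the space of cones\<close>

definition conj_set :: "('a, 'b) monoid_scheme \<Rightarrow> 'a \<Rightarrow> 'a set \<Rightarrow> 'a set" where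
  "conj_set G g P = {x \<in> carrier G. inv\<^bsub>G\<^esub> g \<otimes>\<^bsub>G\<^esub> (x \<otimes>\<^bsub>G\<^esub> g) \<in> P}"

context group begin

lemma conj_set_conj_set:
  assumes "g \<in> carrier G" "h \<in> carrier G"
  shows "conj_set G g (conj_set G h P) = conj_set G (g \<otimes> h) P"
  using assms by (auto simp: conj_set_def inv_mult_group m_assoc)

lemma conj_set_one: "P \<subseteq> carrier G \<Longrightarrow> conj_set G \<one> P = P"
  by (auto simp: conj_set_def)

lemma positive_cone_conj_set:
  assumes "positive_cone G P" "g \<in> carrier G"
  shows "positive_cone G (conj_set G g P)"
proof -
  note P = positive_coneD[OF assms(1)]
  have "inv g \<otimes> (x \<otimes> y \<otimes> g) \<in> P" if "x \<in> conj_set G g P" "y \<in> conj_set G g P" for x y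
  proof -
    have "inv g \<otimes> (x \<otimes> y \<otimes> g) = (inv g \<otimes> (x \<otimes> g)) \<otimes> (inv g \<otimes> (y \<otimes> g))"
      using that assms(2) by (auto simp: conj_set_def m_assoc)
    then show ?thesis using that P(2) by (auto simp: conj_set_def)
  qed
  moreover have "x \<in> conj_set G g P \<or> inv x \<in> conj_set G g P" if "x \<in> carrier G" "x \<noteq> \<one>" for x
  proof -
    have "inv g \<otimes> (x \<otimes> g) \<noteq> \<one>"
    proof
      assume "inv g \<otimes> (x \<otimes> g) = \<one>"
      then have "g \<otimes> (inv g \<otimes> (x \<otimes> g)) = g" using assms(2) by simp
      then show False using that assms(2) by simp
    qed
    moreover have "inv (inv g \<otimes> (x \<otimes> g)) = inv g \<otimes> (inv x \<otimes> g)"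
      using that assms(2) by (simp add: inv_mult_group m_assoc)
    ultimately show ?thesis using P(4)[of "inv g \<otimes> (x \<otimes> g)"] that assms(2) by (auto simp: conj_set_def)
  qed
  ultimately show ?thesis using P(3) assms(2) unfolding positive_cone_def
    by (auto simp: conj_set_def)
qed

lemma finite_conj_orbit:
  assumes "countable {P. positive_cone G P}" "positive_cone G P0"
  shows "\<exists>P. positive_cone G P \<and> finite ((\<lambda>g. conj_set G g P) ` carrier G)"
proof -
  define Y where "Y = product_topology (\<lambda>_::'a. discrete_topology (UNIV :: bool set)) UNIV"
  define L where "L = {p. positive_cone G (Collect p)}"
  define S where "S = subtopology Y L"
  have topY: "topspace Y = UNIV" by (auto simp: Y_def)
  then have topS: "topspace S = L" by (simp add: S_def)
  have coord: "continuous_map Y (discrete_topology UNIV) (\<lambda>p. p x)" for x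
    unfolding Y_def by (rule continuous_map_product_projection) simp
  have open1: "openin Y {p. p x}" "openin Y {p. \<not> p x}" for x
    using openin_continuous_map_preimage[OF coord[of x], of "{True}"]
      openin_continuous_map_preimage[OF coord[of x], of "{False}"] by (auto simp: topY)
  \<comment> \<open>Each axiom of a cone involves finitely many coordinates, so its violation is an
    open condition in the product topology.\<close>
  have "- L = (\<Union>x\<in>- carrier G. {p. p x}) \<union>
      (\<Union>x\<in>carrier G. \<Union>y\<in>carrier G. {p. p x} \<inter> {p. p y} \<inter> {p. \<not> p (x \<otimes> y)}) \<union> {p. p \<one>} \<union>
      (\<Union>x\<in>carrier G - {\<one>}. {p. \<not> p x} \<inter> {p. \<not> p (inv x)})"
    by (auto simp: L_def positive_cone_def subset_iff)
  also have "openin Y \<dots>" by (intro openin_Un openin_Int openin_Union open1) (auto intro!: openin_Int open1)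
  finally have "closedin Y L" by (simp add: closedin_def topY Compl_eq_Diff_UNIV)
  moreover have "compact_space Y" unfolding Y_def
    by (auto simp: compact_space_product_topology compact_space_discrete_topology)
  ultimately have "compact_space S" unfolding S_def by (intro compact_space_subtopology closedin_compact_space)
  moreover have "Hausdorff_space S" unfolding S_def Y_def
    by (intro Hausdorff_space_subtopology) (simp add: Hausdorff_space_product_topology)
  moreover have "countable L"
  proof -
    have "inj_on Collect L" by (auto intro: inj_onI)
    moreover have "Collect ` L \<subseteq> {P. positive_cone G P}" by (auto simp: L_def)
    ultimately show ?thesis using assms(1) countable_image_inj_on countable_subset by metis
  qed
  moreover have "L \<noteq> {}" using assms(2) by (auto simp: L_def intro!: exI[of _ "\<lambda>x. x \<in> P0"])
  moreover define act where "act g p = (\<lambda>x. x \<in> conj_set G g (Collect p))" for g p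
  have act: "Collect (act g p) = conj_set G g (Collect p)" for g p by (simp add: act_def)
  have actL: "act g p \<in> L" if "g \<in> carrier G" "p \<in> L" for g p
    using positive_cone_conj_set[of "Collect p"] that by (simp add: L_def act)
  have "\<exists>p\<in>topspace S. finite ((\<lambda>g. act g p) ` carrier G)"
  proof (rule countable_compact_finite_orbit)
    show "compact_space S" "Hausdorff_space S" "countable (topspace S)" "topspace S \<noteq> {}"
      using calculation by (simp_all add: topS)
    show "carrier G \<noteq> {}" by auto
    show "continuous_map S S (act g)" if g: "g \<in> carrier G" for g
    proof -
      \<comment> \<open>Conjugation permutes coordinates: the value at \<open>x\<close> is the old
        value at the conjugate of \<open>x\<close>, or constantly false outside the carrier.\<close>
      have "continuous_map Y (discrete_topology UNIV) (\<lambda>p. act g p x)" for x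
        using coord by (cases "x \<in> carrier G") (simp_all add: act_def conj_set_def)
      then have "continuous_map Y Y (act g)"
        unfolding Y_def by (simp add: continuous_map_componentwise_UNIV)
      then show ?thesis unfolding S_def using actL[OF g] topY
        by (intro continuous_map_into_subtopology) (auto intro: continuous_map_from_subtopology)
    qed
    show "inj_on (act g) (topspace S)" if g: "g \<in> carrier G" for g
    proof (rule inj_onI)
      fix p q assume pq: "p \<in> topspace S" "q \<in> topspace S" "act g p = act g q"
      have "conj_set G g (Collect p) = conj_set G g (Collect q)"
        using arg_cong[OF pq(3), of Collect] by (simp only: act)
      then have "conj_set G (inv g) (conj_set G g (Collect p)) = conj_set G (inv g) (conj_set G g (Collect q))"
        by simp
      moreover have "Collect p \<subseteq> carrier G" "Collect q \<subseteq> carrier G"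
        using pq positive_coneD(1) by (auto simp: topS L_def)
      ultimately have "Collect p = Collect q" using g by (simp add: conj_set_conj_set conj_set_one)
      then show "p = q" by (rule Collect_inj)
    qed
    show "\<exists>k\<in>carrier G. act k p = act g (act h p)" if "g \<in> carrier G" "h \<in> carrier G" for g h p
      using that by (intro bexI[of _ "g \<otimes> h"]) (auto simp: act_def conj_set_conj_set)
  qed
  then obtain p where "p \<in> L" "finite ((\<lambda>g. act g p) ` carrier G)" by (auto simp: topS)
  then have "finite (Collect ` (\<lambda>g. act g p) ` carrier G)" by blast
  then show ?thesis using \<open>p \<in> L\<close> by (auto simp: image_image act L_def)
qed

end

section \<open>The order of a cone\<close>

locale cone_ordered = group G for G (structure) +
  fixes P
  assumes cone: "positive_cone G P"
begin

text \<open>Non-strict, and with membership in the carrier built in, so that chains of inequalities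
  carry their closure conditions along.\<close>

definition le (infix "\<preceq>" 50) where
  "a \<preceq> b \<longleftrightarrow> a \<in> carrier G \<and> b \<in> carrier G \<and> (a = b \<or> inv a \<otimes> b \<in> P)"

lemmas P_subset = positive_coneD(1)[OF cone] and P_mult = positive_coneD(2)[OF cone]
  and P_one = positive_coneD(3)[OF cone] and P_total = positive_coneD(4)[OF cone]
  and P_inv = positive_coneD(5)[OF cone]

lemma le_carrier: "a \<preceq> b \<Longrightarrow> a \<in> carrier G" "a \<preceq> b \<Longrightarrow> b \<in> carrier G"
  by (auto simp: le_def)

lemma le_refl [simp]: "a \<in> carrier G \<Longrightarrow> a \<preceq> a"
  by (simp add: le_def)

lemma le_trans [trans]:
  assumes "a \<preceq> b" "b \<preceq> c"
  shows "a \<preceq> c"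
proof (cases "a = b \<or> b = c")
  case False
  then have "(inv a \<otimes> b) \<otimes> (inv b \<otimes> c) \<in> P" using assms P_mult by (auto simp: le_def)
  then show ?thesis using assms by (auto simp: le_def m_assoc)
qed (use assms in auto)

lemma inv_mult_inv: "a \<in> carrier G \<Longrightarrow> b \<in> carrier G \<Longrightarrow> inv (inv a \<otimes> b) = inv b \<otimes> a"
  by (simp add: inv_mult_group)

lemma inv_mult_eq_one: "a \<in> carrier G \<Longrightarrow> b \<in> carrier G \<Longrightarrow> inv a \<otimes> b = \<one> \<Longrightarrow> a = b"
  by (metis cancel_inv(1) r_one)

lemma le_antisym: "a \<preceq> b \<Longrightarrow> b \<preceq> a \<Longrightarrow> a = b"
  using P_inv[of "inv a \<otimes> b"] by (auto simp: le_def inv_mult_inv)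

lemma le_total: "a \<in> carrier G \<Longrightarrow> b \<in> carrier G \<Longrightarrow> a \<preceq> b \<or> b \<preceq> a"
  using P_total[of "inv a \<otimes> b"] inv_mult_eq_one[of a b] by (auto simp: le_def inv_mult_inv)

lemma le_mult_left:
  assumes "a \<preceq> b" "c \<in> carrier G"
  shows "c \<otimes> a \<preceq> c \<otimes> b"
  using assms by (auto simp: le_def inv_mult_group m_assoc)

lemma le_mult_right:
  assumes "a \<preceq> b" "c \<in> carrier G" "\<And>x. x \<in> P \<Longrightarrow> inv c \<otimes> x \<otimes> c \<in> P"
  shows "a \<otimes> c \<preceq> b \<otimes> c"
  using assms(3)[of "inv a \<otimes> b"] assms(1,2) by (auto simp: le_def inv_mult_group m_assoc)

lemma one_le: "x \<in> P \<Longrightarrow> \<one> \<preceq> x"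
  using P_subset by (auto simp: le_def)

lemma le_max:
  assumes "finite A" "A \<noteq> {}" "A \<subseteq> carrier G"
  shows "\<exists>x\<in>A. \<forall>a\<in>A. a \<preceq> x"
  using assms
proof (induction rule: finite_ne_induct)
  case (insert a A)
  then obtain x where x: "x \<in> A" "\<forall>a\<in>A. a \<preceq> x" by auto
  then consider "a \<preceq> x" | "x \<preceq> a" using le_total insert.prems by blast
  then show ?case using x insert.prems by cases (auto intro: le_trans)
qed auto

end

text \<open>A left-order need not be right invariant; \<open>conj_P\<close> makes right
  multiplication by elements of \<open>N\<close> monotone. The element \<open>y\<close> is the unit
  of length: its powers lie in \<open>N\<close> and bound every element of \<open>G\<close>.\<close>

locale cofinal_ordered = cone_ordered +
  fixes N y
  assumes N: "subgroup N G"
    and conj_P: "\<And>n x. n \<in> N \<Longrightarrow> x \<in> P \<Longrightarrow> inv n \<otimes> x \<otimes> n \<in> P"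
    and conj_N: "\<And>c n. c \<in> carrier G \<Longrightarrow> n \<in> N \<Longrightarrow> c \<otimes> n \<otimes> inv c \<in> N"
    and y: "y \<in> N" "y \<in> P"
    and cofinal: "\<And>g. g \<in> carrier G \<Longrightarrow> \<exists>n::nat. g \<preceq> y [^] n"
begin

lemma N_carrier: "n \<in> N \<Longrightarrow> n \<in> carrier G"
  using subgroup.mem_carrier[OF N] .

lemma y_carrier: "y \<in> carrier G"
  using y N_carrier by blast

lemma N_nat_pow: "n \<in> N \<Longrightarrow> n [^] (k::nat) \<in> N"
  by (induction k) (auto intro: subgroup.m_closed[OF N] subgroup.one_closed[OF N])

lemma N_int_pow: "n \<in> N \<Longrightarrow> n [^] (k::int) \<in> N"
  by (cases k rule: int_cases2)
    (auto simp: int_pow_int int_pow_neg_int N_carrier N_nat_pow subgroup.m_inv_closed[OF N])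

lemma le_mult_right_N: "a \<preceq> b \<Longrightarrow> n \<in> N \<Longrightarrow> a \<otimes> n \<preceq> b \<otimes> n"
  using le_mult_right conj_P N_carrier by blast

lemma y_pow_carrier [simp]: "y [^] (k::int) \<in> carrier G"
  using y_carrier by simp

lemma y_nat_pow: "k > 0 \<Longrightarrow> y [^] (k::nat) \<in> P"
proof (induction k)
  case (Suc k)
  then show ?case using y P_mult y_carrier by (cases "k = 0") auto
qed simp

lemma y_pow_le_iff: "y [^] (k::int) \<preceq> y [^] (l::int) \<longleftrightarrow> k \<le> l"
proof -
  have *: "y [^] k \<preceq> y [^] l \<and> y [^] k \<noteq> y [^] l" if "k < l" for k l :: int
  proof -
    have "inv (y [^] k) \<otimes> y [^] l = y [^] (- k + l)"
      using y_carrier by (simp add: int_pow_neg[symmetric] int_pow_mult[symmetric])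
    also have "\<dots> = y [^] nat (l - k)" using that by (simp flip: int_pow_int)
    finally have "inv (y [^] k) \<otimes> y [^] l = y [^] nat (l - k)" .
    moreover have "y [^] nat (l - k) \<in> P" using that by (intro y_nat_pow) simp
    ultimately have "inv (y [^] k) \<otimes> y [^] l \<in> P" by (simp only:)
    then show ?thesis using P_one by (auto simp: le_def)
  qed
  show ?thesis using *[of k l] *[of l k] le_antisym by (cases k l rule: linorder_cases) auto
qed

text \<open>The upper bound is cofinality for \<open>g\<close>. The lower one is cofinality for
  \<open>inv g\<close>, moved across by right multiplication with a power of \<open>y\<close>, which
  is monotone because \<open>y \<in> N\<close>.\<close>

lemma ex_floor:
  assumes g: "g \<in> carrier G"
  shows "\<exists>e. \<forall>k::int. y [^] k \<preceq> g \<longleftrightarrow> k \<le> e"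
proof -
  obtain n :: nat where n: "g \<preceq> y [^] n" using cofinal[OF g] by blast
  obtain m :: nat where "inv g \<preceq> y [^] m" using cofinal g by blast
  then have "g \<otimes> inv g \<preceq> g \<otimes> y [^] m" using le_mult_left g by blast
  then have "\<one> \<preceq> g \<otimes> y [^] m" using g by simp
  then have "\<one> \<otimes> y [^] (- int m) \<preceq> g \<otimes> y [^] m \<otimes> y [^] (- int m)"
    using le_mult_right_N N_int_pow[OF y(1)] by blast
  then have m: "y [^] (- int m) \<preceq> g"
    using g y_carrier by (simp add: m_assoc int_pow_neg_int)
  define S where "S = {k::int. y [^] k \<preceq> g}"
  have ub: "k \<le> int n" if "k \<in> S" for k
    using that le_trans[OF _ n] y_pow_le_iff[of k "int n"] by (auto simp: S_def int_pow_int)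
  have down: "k \<in> S" if "k \<le> l" "l \<in> S" for k l
    using that le_trans[of "y [^] k" "y [^] l" g] y_pow_le_iff[of k l] by (auto simp: S_def)
  define T where "T = S \<inter> {- int m..int n}"
  have "finite T" "- int m \<in> T" using m ub[of "- int m"] by (auto simp: T_def S_def)
  then have "Max T \<in> T" using Max_in by blast
  have "k \<in> S \<longleftrightarrow> k \<le> Max T" for k
  proof
    assume k: "k \<in> S"
    show "k \<le> Max T"
    proof (cases "k \<ge> - int m")
      case True
      then have "k \<in> T" using k ub by (auto simp: T_def)
      then show ?thesis using \<open>finite T\<close> by simp
    next
      case False
      then show ?thesis using Max_ge[OF \<open>finite T\<close> \<open>- int m \<in> T\<close>] by linarith
    qed
  next
    assume "k \<le> Max T"
    then show "k \<in> S" using down \<open>Max T \<in> T\<close> by (auto simp: T_def)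
  qed
  then show ?thesis by (auto simp: S_def)
qed

definition flr :: "'a \<Rightarrow> int" where
  "flr g = (SOME e. \<forall>k::int. y [^] k \<preceq> g \<longleftrightarrow> k \<le> e)"

lemma flr: "g \<in> carrier G \<Longrightarrow> y [^] (k::int) \<preceq> g \<longleftrightarrow> k \<le> flr g"
  using someI_ex[OF ex_floor[of g]] unfolding flr_def by blast

lemma flr_mono: "g \<preceq> h \<Longrightarrow> flr g \<le> flr h"
  using flr[of g "flr g"] flr[of h "flr g"] le_trans le_carrier by blast

lemma flr_pow: "flr (y [^] (k::int)) = k"
  using flr[of "y [^] k"] y_pow_le_iff by (metis order_antisym order_refl y_pow_carrier)

lemma flr_one: "flr \<one> = 0"
  using flr_pow[of 0] by simp

lemma flr_less: "g \<in> carrier G \<Longrightarrow> g \<preceq> y [^] (flr g + 1) \<and> g \<noteq> y [^] (flr g + 1)"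
  using flr[of g "flr g + 1"] le_total[of g "y [^] (flr g + 1)"] by auto

text \<open>A quasimorphism on all of \<open>G\<close>: only powers of \<open>y\<close> are ever
  multiplied from the right, so \<open>g\<close> and \<open>h\<close> may lie outside
  \<open>N\<close>.\<close>

lemma flr_mult:
  assumes g: "g \<in> carrier G" and h: "h \<in> carrier G"
  shows "flr g + flr h \<le> flr (g \<otimes> h)" "flr (g \<otimes> h) \<le> flr g + flr h + 1"
proof -
  have "y [^] (flr g + flr h) = y [^] flr g \<otimes> y [^] flr h" using y_carrier by (simp add: int_pow_mult)
  also have "\<dots> \<preceq> g \<otimes> y [^] flr h" using le_mult_right_N flr[OF g] N_int_pow y by simp
  also have "\<dots> \<preceq> g \<otimes> h" using le_mult_left flr[OF h] g by simp
  finally show "flr g + flr h \<le> flr (g \<otimes> h)" using flr g h by simp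
  have 1: "g \<otimes> h \<preceq> g \<otimes> y [^] (flr h + 1)" using flr_less[OF h] le_mult_left g by blast
  have "g \<otimes> y [^] (flr h + 1) \<preceq> y [^] (flr g + 1) \<otimes> y [^] (flr h + 1)"
    using flr_less[OF g] le_mult_right_N N_int_pow y by blast
  also have "\<dots> = y [^] (flr g + flr h + 2)" using y_carrier by (simp add: int_pow_mult[symmetric] algebra_simps)
  finally have 2: "g \<otimes> y [^] (flr h + 1) \<preceq> y [^] (flr g + flr h + 2)" .
  \<comment> \<open>Adding two upper bounds gives \<open>flr g + flr h + 2\<close>; strictness of
    the one for \<open>h\<close> excludes this value and leaves a defect of 1.\<close>
  have "\<not> y [^] (flr g + flr h + 2) \<preceq> g \<otimes> h"
  proof
    assume "y [^] (flr g + flr h + 2) \<preceq> g \<otimes> h"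
    then have "g \<otimes> y [^] (flr h + 1) \<preceq> g \<otimes> h" using 2 le_trans by blast
    then have "g \<otimes> h = g \<otimes> y [^] (flr h + 1)" using 1 le_antisym by blast
    then show False using flr_less[OF h] g h by simp
  qed
  then show "flr (g \<otimes> h) \<le> flr g + flr h + 1" using flr g h by fastforce
qed

text \<open>Two products contribute at most 2, and the values at \<open>c\<close> and
  \<open>inv c\<close> add up to 0 or -1.\<close>

lemma flr_conj:
  assumes "c \<in> carrier G" "x \<in> carrier G"
  shows "\<bar>flr (c \<otimes> x \<otimes> inv c) - flr x\<bar> \<le> 2"
  using flr_mult[of c x] flr_mult[of "c \<otimes> x" "inv c"] flr_mult[of c "inv c"] flr_one assms by simp

text \<open>Homogenisation along powers of two. Squaring \<open>x\<close> sends its floor to twice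
  the floor, or one more, so \<open>mean n g\<close> increases with \<open>n\<close> while
  \<open>mean n g + 1 / 2 ^ n\<close> decreases, and the limit exists.\<close>

definition mean :: "nat \<Rightarrow> 'a \<Rightarrow> real" where
  "mean n g = real_of_int (flr (g [^] (2 ^ n :: nat))) / 2 ^ n"

definition slope :: "'a \<Rightarrow> real" where
  "slope g = lim (\<lambda>n. mean n g)"

lemma mean_LIMSEQ:
  assumes g: "g \<in> carrier G"
  shows "(\<lambda>n. mean n g) \<longlonglongrightarrow> slope g"
proof -
  have step: "mean n g \<le> mean (Suc n) g" "mean (Suc n) g + 1 / 2 ^ Suc n \<le> mean n g + 1 / 2 ^ n" for n
  proof -
    define x where "x = g [^] (2 ^ n :: nat)"
    have x: "x \<in> carrier G" using g by (simp add: x_def)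
    have "g [^] (2 ^ Suc n :: nat) = x \<otimes> x" using g by (simp add: x_def nat_pow_mult mult_2)
    then have "2 * flr x \<le> flr (g [^] (2 ^ Suc n :: nat))" "flr (g [^] (2 ^ Suc n :: nat)) \<le> 2 * flr x + 1"
      using flr_mult[OF x x] by auto
    then have *: "2 * real_of_int (flr x) \<le> flr (g [^] (2 ^ Suc n :: nat))"
      "flr (g [^] (2 ^ Suc n :: nat)) \<le> 2 * real_of_int (flr x) + 1" by linarith+
    show "mean n g \<le> mean (Suc n) g" using *(1) by (simp add: mean_def x_def field_simps)
    show "mean (Suc n) g + 1 / 2 ^ Suc n \<le> mean n g + 1 / 2 ^ n"
    proof -
      have "(flr (g [^] (2 ^ Suc n :: nat)) + 1) / 2 ^ Suc n \<le> (2 * real_of_int (flr x) + 2) / 2 ^ Suc n"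
        using *(2) by (intro divide_right_mono) auto
      also have "\<dots> = (flr x + 1) / 2 ^ n" by (simp add: add_divide_distrib)
      finally show ?thesis by (simp add: mean_def x_def add_divide_distrib)
    qed
  qed
  have "mean n g + 1 / 2 ^ n \<le> mean 0 g + 1" for n
  proof (induction n)
    case (Suc n)
    then show ?case using step(2)[of n] by linarith
  qed simp
  moreover have "1 / 2 ^ n \<ge> (0::real)" for n by simp
  ultimately have "mean n g \<le> mean 0 g + 1" for n by (smt (verit))
  then have "convergent (\<lambda>n. mean n g)"
    using incseq_convergent[of "\<lambda>n. mean n g" "mean 0 g + 1"] step(1)
    by (metis convergentI incseq_SucI)
  then show ?thesis unfolding slope_def by (simp add: convergent_LIMSEQ_iff)
qed

text \<open>An error bounded before division by \<open>2 ^ n\<close> disappears in the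
  limit.\<close>

lemma slope_close:
  assumes "x \<in> carrier G" "(\<lambda>n. a n) \<longlonglongrightarrow> l" "\<And>n. \<bar>2 ^ n * (mean n x - a n)\<bar> \<le> C"
  shows "slope x = l"
proof -
  have "\<bar>mean n x - a n\<bar> \<le> C * (1 / 2) ^ n" for n
  proof -
    have "2 ^ n * \<bar>mean n x - a n\<bar> \<le> C" using assms(3)[of n] by (simp add: abs_mult)
    then have "\<bar>mean n x - a n\<bar> \<le> C / 2 ^ n" by (simp add: pos_le_divide_eq mult.commute)
    then show ?thesis by (simp add: power_one_over)
  qed
  moreover have "(\<lambda>n. C * (1 / 2) ^ n) \<longlonglongrightarrow> 0"
    by (intro tendsto_mult_right_zero LIMSEQ_realpow_zero) auto
  ultimately have "(\<lambda>n. mean n x - a n) \<longlonglongrightarrow> 0"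
    by (intro Lim_null_comparison[of "\<lambda>n. mean n x - a n"]) auto
  then have "(\<lambda>n. (mean n x - a n) + a n) \<longlonglongrightarrow> 0 + l" using assms(2) by (rule tendsto_add)
  then show ?thesis using mean_LIMSEQ[OF assms(1)] LIMSEQ_unique by fastforce
qed

text \<open>Inside a word, replacing a neighbouring \<open>g h\<close> by \<open>h g\<close> makes
  the word larger, since both factors lie in \<open>N\<close> and the order is two-sided there.
  Sorting the letters gives the two extremes.\<close>

lemma pow_between:
  assumes gh: "g \<in> N" "h \<in> N" and le: "g \<otimes> h \<preceq> h \<otimes> g"
  shows "g [^] m \<otimes> h [^] m \<preceq> (g \<otimes> h) [^] (m::nat)" "(g \<otimes> h) [^] m \<preceq> h [^] m \<otimes> g [^] (m::nat)"
proof -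
  have c: "g \<in> carrier G" "h \<in> carrier G" using gh N_carrier by auto
  note R = le_mult_right_N and L = le_mult_left
  have A: "g \<otimes> h [^] m \<preceq> h [^] m \<otimes> g" for m :: nat
  proof (induction m)
    case (Suc m)
    have "g \<otimes> h [^] m \<otimes> h \<preceq> h [^] m \<otimes> g \<otimes> h" using R[OF Suc gh(2)] .
    also have "h [^] m \<otimes> g \<otimes> h \<preceq> h [^] m \<otimes> (h \<otimes> g)" using L[OF le, of "h [^] m"] c by (simp add: m_assoc)
    finally show ?case using c by (simp add: m_assoc)
  qed (use c in simp)
  have B: "g [^] m \<otimes> h \<preceq> h \<otimes> g [^] m" for m :: nat
  proof (induction m)
    case (Suc m)
    have "g [^] m \<otimes> (g \<otimes> h) \<preceq> g [^] m \<otimes> (h \<otimes> g)" using L[OF le, of "g [^] m"] c by simp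
    also have "g [^] m \<otimes> (h \<otimes> g) \<preceq> h \<otimes> g [^] m \<otimes> g" using R[OF Suc gh(1)] c by (simp add: m_assoc)
    finally show ?case using c by (simp add: m_assoc)
  qed (use c in simp)
  show "g [^] m \<otimes> h [^] m \<preceq> (g \<otimes> h) [^] m"
  proof (induction m)
    case (Suc m)
    have "g [^] m \<otimes> (g \<otimes> h [^] m) \<otimes> h \<preceq> g [^] m \<otimes> (h [^] m \<otimes> g) \<otimes> h"
      using R[OF L[OF A] gh(2)] c by simp
    also have "g [^] m \<otimes> (h [^] m \<otimes> g) \<otimes> h \<preceq> (g \<otimes> h) [^] m \<otimes> (g \<otimes> h)"
      using R[OF Suc subgroup.m_closed[OF N gh]] c by (simp add: m_assoc)
    finally show ?case using c by (simp add: m_assoc)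
  qed (use c in simp)
  show "(g \<otimes> h) [^] m \<preceq> h [^] m \<otimes> g [^] m"
  proof (induction m)
    case (Suc m)
    have "(g \<otimes> h) [^] m \<otimes> (g \<otimes> h) \<preceq> h [^] m \<otimes> g [^] m \<otimes> (g \<otimes> h)"
      using R[OF Suc subgroup.m_closed[OF N gh]] .
    also have "h [^] m \<otimes> g [^] m \<otimes> (g \<otimes> h) \<preceq> h [^] m \<otimes> (h \<otimes> g [^] Suc m)"
      using L[OF B[of "Suc m"], of "h [^] m"] c by (simp add: m_assoc)
    finally show ?case using c by (simp add: m_assoc)
  qed (use c in simp)
qed

lemma pow_mult_swap:
  assumes "g \<in> carrier G" "h \<in> carrier G"
  shows "(g \<otimes> h) [^] (m::nat) = g \<otimes> (h \<otimes> g) [^] m \<otimes> inv g"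
proof -
  have "(g \<otimes> h) [^] m \<otimes> g = g \<otimes> (h \<otimes> g) [^] m"
  proof (induction m)
    case (Suc m)
    have "(g \<otimes> h) [^] Suc m \<otimes> g = ((g \<otimes> h) [^] m \<otimes> g) \<otimes> (h \<otimes> g)" using assms by (simp add: m_assoc)
    then show ?case using Suc assms by (simp add: m_assoc)
  qed (use assms in simp)
  then have "(g \<otimes> h) [^] m \<otimes> g \<otimes> inv g = g \<otimes> (h \<otimes> g) [^] m \<otimes> inv g" by simp
  then show ?thesis using assms by (simp add: m_assoc)
qed

lemma pow_conj:
  assumes "c \<in> carrier G" "x \<in> carrier G"
  shows "(c \<otimes> x \<otimes> inv c) [^] (m::nat) = c \<otimes> x [^] m \<otimes> inv c"
  using pow_mult_swap[of c "x \<otimes> inv c" m] assms by (simp add: m_assoc)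

text \<open>The bound does not depend on \<open>m\<close>, which the quasimorphism property alone
  would not give. It is 1 if \<open>g\<close> and \<open>h\<close> are in the favourable order;
  otherwise conjugating the power of \<open>g h\<close> into that of \<open>h g\<close> costs 2
  more.\<close>

lemma flr_pow_mult:
  assumes "g \<in> N" "h \<in> N"
  shows "\<bar>flr ((g \<otimes> h) [^] (m::nat)) - (flr (g [^] m) + flr (h [^] m))\<bar> \<le> 3"
proof -
  have c: "g \<in> carrier G" "h \<in> carrier G" "g [^] m \<in> carrier G" "h [^] m \<in> carrier G"
    using assms N_carrier by auto
  have "g \<otimes> h \<preceq> h \<otimes> g \<or> h \<otimes> g \<preceq> g \<otimes> h" using le_total c by simp
  then show ?thesis
  proof
    assume "g \<otimes> h \<preceq> h \<otimes> g"
    from pow_between[OF assms this, of m, THEN flr_mono] show ?thesis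
      using flr_mult[OF c(3,4)] flr_mult[OF c(4,3)] by linarith
  next
    assume "h \<otimes> g \<preceq> g \<otimes> h"
    from pow_between[OF assms(2,1) this, of m, THEN flr_mono]
    have "\<bar>flr ((h \<otimes> g) [^] m) - (flr (g [^] m) + flr (h [^] m))\<bar> \<le> 1"
      using flr_mult[OF c(3,4)] flr_mult[OF c(4,3)] by linarith
    then show ?thesis using flr_conj[OF c(1), of "(h \<otimes> g) [^] m"] c
      by (simp add: pow_mult_swap[OF c(1,2)])
  qed
qed

lemma slope_mult:
  assumes "g \<in> N" "h \<in> N"
  shows "slope (g \<otimes> h) = slope g + slope h"
proof (rule slope_close)
  have c: "g \<in> carrier G" "h \<in> carrier G" using assms N_carrier by auto
  then show "g \<otimes> h \<in> carrier G" by simp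
  show "(\<lambda>n. mean n g + mean n h) \<longlonglongrightarrow> slope g + slope h" using c mean_LIMSEQ by (intro tendsto_add) auto
  show "\<bar>2 ^ n * (mean n (g \<otimes> h) - (mean n g + mean n h))\<bar> \<le> 3" for n
  proof -
    have "2 ^ n * (mean n (g \<otimes> h) - (mean n g + mean n h)) = real_of_int (flr ((g \<otimes> h) [^] (2 ^ n :: nat)) -
        (flr (g [^] (2 ^ n :: nat)) + flr (h [^] (2 ^ n :: nat))))"
      by (simp add: mean_def right_diff_distrib distrib_left)
    then show ?thesis using flr_pow_mult[OF assms, of "2 ^ n"] by linarith
  qed
qed

lemma slope_conj:
  assumes "c \<in> carrier G" "x \<in> carrier G"
  shows "slope (c \<otimes> x \<otimes> inv c) = slope x"
proof (rule slope_close)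
  show "c \<otimes> x \<otimes> inv c \<in> carrier G" using assms by simp
  show "(\<lambda>n. mean n x) \<longlonglongrightarrow> slope x" using assms mean_LIMSEQ by auto
  show "\<bar>2 ^ n * (mean n (c \<otimes> x \<otimes> inv c) - mean n x)\<bar> \<le> 2" for n
  proof -
    have "2 ^ n * (mean n (c \<otimes> x \<otimes> inv c) - mean n x) =
        real_of_int (flr (c \<otimes> x [^] (2 ^ n :: nat) \<otimes> inv c) - flr (x [^] (2 ^ n :: nat)))"
      using assms by (simp add: mean_def right_diff_distrib pow_conj)
    then show ?thesis using flr_conj[OF assms(1) nat_pow_closed[OF assms(2)], of "2 ^ n"] by linarith
  qed
qed

lemma slope_y: "slope y = 1"
proof (rule slope_close)
  show "y \<in> carrier G" by (rule y_carrier)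
  show "(\<lambda>n. 1) \<longlonglongrightarrow> (1::real)" by simp
  show "\<bar>2 ^ n * (mean n y - 1)\<bar> \<le> 0" for n
  proof -
    have "y [^] (2 ^ n :: nat) = y [^] int (2 ^ n)" by (simp only: int_pow_int)
    then show ?thesis by (simp only: mean_def flr_pow) simp
  qed
qed

end

section \<open>Homomorphisms onto the integers\<close>

text \<open>The transfer map followed by \<phi>. The elements \<open>d g c\<close> of
  \<open>N\<close> measure how \<open>g\<close> fails to respect the coset representatives; they
  form a cocycle, so the sum over all cosets is additive in \<open>g\<close>.\<close>

lemma (in group) transfer_hom:
  fixes \<phi> :: "'a \<Rightarrow> real"
  assumes N: "subgroup N G" and fin: "finite (rcosets N)"
    and \<phi>: "\<And>x y. x \<in> N \<Longrightarrow> y \<in> N \<Longrightarrow> \<phi> (x \<otimes> y) = \<phi> x + \<phi> y"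
    and conj: "\<And>c n. c \<in> carrier G \<Longrightarrow> n \<in> N \<Longrightarrow> c \<otimes> n \<otimes> inv c \<in> N"
      "\<And>c n. c \<in> carrier G \<Longrightarrow> n \<in> N \<Longrightarrow> \<phi> (c \<otimes> n \<otimes> inv c) = \<phi> n"
  shows "\<exists>\<psi>. add_hom G \<psi> \<and> (\<forall>n\<in>N. \<psi> n = real (card (rcosets N)) * \<phi> n)"
proof -
  have NG: "N \<subseteq> carrier G" using subgroup.subset[OF N] .
  define rep where "rep c = (SOME x. x \<in> c)" for c :: "'a set"
  have rep: "rep c \<in> carrier G" "c = N #> rep c" if c: "c \<in> rcosets N" for c
  proof -
    obtain a where a: "a \<in> carrier G" "c = N #> a" using c by (auto simp: RCOSETS_def)
    have "a \<in> c" using rcos_self[OF a(1) N] a by simp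
    then have r: "rep c \<in> c" unfolding rep_def by (rule someI)
    then show "rep c \<in> carrier G" using r_coset_subset_G[OF NG a(1)] a by auto
    show "c = N #> rep c" using repr_independence[OF _ a(1) N] r a by blast
  qed
  have shift: "c #> g \<in> rcosets N" "c #> g = N #> (rep c \<otimes> g)" if "c \<in> rcosets N" "g \<in> carrier G" for c g
  proof -
    show eq: "c #> g = N #> (rep c \<otimes> g)"
      using rep[OF that(1)] coset_mult_assoc[OF NG _ that(2)] by metis
    show "c #> g \<in> rcosets N" unfolding eq using rep[OF that(1)] that(2) by (auto simp: RCOSETS_def)
  qed
  define d where "d g c = rep c \<otimes> g \<otimes> inv (rep (c #> g))" for g c
  have d: "d g c \<in> N" if "c \<in> rcosets N" "g \<in> carrier G" for g c
  proof -
    have r: "rep (c #> g) \<in> carrier G" using rep shift that by blast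
    have "rep (c #> g) \<in> N #> rep (c #> g)" using rcos_self[OF r N] .
    then have "rep (c #> g) \<in> N #> (rep c \<otimes> g)" using rep(2) shift that by metis
    then obtain n where n: "n \<in> N" "rep (c #> g) = n \<otimes> (rep c \<otimes> g)" by (auto simp: r_coset_def)
    then have "d g c = (rep c \<otimes> g) \<otimes> inv (rep c \<otimes> g) \<otimes> inv n"
      using rep(1)[OF that(1)] that(2) NG by (simp add: d_def inv_mult_group m_assoc subset_iff)
    also have "\<dots> = inv n" using rep(1)[OF that(1)] that(2) NG n(1) by (simp only: r_inv m_closed) auto
    finally show ?thesis using n N by (simp add: subgroup.m_inv_closed)
  qed
  define \<psi> where "\<psi> g = (\<Sum>c\<in>rcosets N. \<phi> (d g c))" for g
  have "add_hom G \<psi>" unfolding add_hom_def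
  proof (intro ballI)
    fix g h assume gh: "g \<in> carrier G" "h \<in> carrier G"
    have "\<phi> (d (g \<otimes> h) c) = \<phi> (d g c) + \<phi> (d h (c #> g))" if c: "c \<in> rcosets N" for c
    proof -
      have "c \<subseteq> carrier G" using rep[OF c] r_coset_subset_G[OF NG] by metis
      then have "c #> (g \<otimes> h) = (c #> g) #> h" using coset_mult_assoc gh by simp
      then have "d (g \<otimes> h) c = d g c \<otimes> d h (c #> g)"
        using rep(1)[OF c] rep(1)[OF shift(1)[OF c gh(1)]] gh
          rep(1)[OF shift(1)[OF shift(1)[OF c gh(1)] gh(2)]] by (simp add: d_def m_assoc)
      then show ?thesis using \<phi> d c gh shift(1) by simp
    qed
    then have "\<psi> (g \<otimes> h) = \<psi> g + (\<Sum>c\<in>rcosets N. \<phi> (d h (c #> g)))"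
      by (simp add: \<psi>_def sum.distrib)
    \<comment> \<open>Right translation by \<open>g\<close> permutes the cosets.\<close>
    also have "(\<Sum>c\<in>rcosets N. \<phi> (d h (c #> g))) = \<psi> h"
      unfolding \<psi>_def
    proof (rule sum.reindex_bij_witness[of _ "\<lambda>c. c #> inv g" "\<lambda>c. c #> g"])
      fix c assume c: "c \<in> rcosets N"
      have cG: "c \<subseteq> carrier G" using rep[OF c] r_coset_subset_G[OF NG] by metis
      show "c #> g #> inv g = c" "c #> inv g #> g = c"
        using cG gh by (simp_all add: coset_mult_assoc coset_mult_one)
      show "c #> g \<in> rcosets N" "c #> inv g \<in> rcosets N" using shift c gh by auto
    qed simp
    finally show "\<psi> (g \<otimes> h) = \<psi> g + \<psi> h" .
  qed
  moreover have "\<psi> n = real (card (rcosets N)) * \<phi> n" if n: "n \<in> N" for n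
  proof -
    \<comment> \<open>An element of the normal subgroup \<open>N\<close> fixes each coset, so
      \<open>d n c\<close> is a conjugate of \<open>n\<close>.\<close>
    have "\<phi> (d n c) = \<phi> n" if c: "c \<in> rcosets N" for c
    proof -
      have r: "rep c \<in> carrier G" using rep c by blast
      have "rep c \<otimes> n \<in> N #> rep c"
        using conj(1)[OF r n] r n NG by (auto simp: r_coset_def m_assoc intro!: bexI[of _ "rep c \<otimes> n \<otimes> inv (rep c)"])
      then have "N #> (rep c \<otimes> n) = N #> rep c" using repr_independence[OF _ r N] by simp
      then have "c #> n = c" using shift(2)[OF c] rep(2)[OF c] n NG by auto
      then show ?thesis using conj(2)[OF r n] by (simp add: d_def)
    qed
    then show ?thesis by (simp add: \<psi>_def)
  qed
  ultimately show ?thesis by blast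
qed

text \<open>The reals form a vector space over the rationals, and a nonzero vector extends to a
  basis. This replaces real values by rational ones without killing a chosen nonzero value.\<close>

lemma ex_rat_functional:
  assumes "x \<noteq> 0"
  shows "\<exists>f :: real \<Rightarrow> rat. (\<forall>a b. f (a + b) = f a + f b) \<and> f x = 1"
proof -
  interpret vector_space_pair "\<lambda>(r::rat) (x::real). of_rat r * x" "(*) :: rat \<Rightarrow> rat \<Rightarrow> rat"
    by unfold_locales (simp_all add: algebra_simps of_rat_add of_rat_mult)
  have "vs1.independent {x}" using assms by (simp add: vs1.independent_insert)
  from linear_independent_extend[OF this, of "\<lambda>_. 1"]
  obtain f where f: "Vector_Spaces.linear (\<lambda>(r::rat) (x::real). of_rat r * x) (*) f" "f x = (1::rat)" by auto
  then show ?thesis using Vector_Spaces.linear.axioms(3)[OF f(1)] 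
    by (intro exI[of _ f]) (simp add: module_hom_def module_hom_axioms_def Vector_Spaces.linear_iff)
qed

lemma (in group) add_hom_int_generator:
  fixes \<omega> :: "'a \<Rightarrow> int"
  assumes \<omega>: "add_hom G \<omega>" and y: "y \<in> carrier G" "\<omega> y \<noteq> 0"
  shows "\<exists>t\<in>carrier G. \<exists>m>0. \<omega> t = m \<and> (\<forall>g\<in>carrier G. m dvd \<omega> g)"
proof -
  define Q where "Q n \<longleftrightarrow> n > 0 \<and> (\<exists>g\<in>carrier G. \<omega> g = int n)" for n
  define m where "m = (LEAST n. Q n)"
  have "Q (nat \<bar>\<omega> y\<bar>)" unfolding Q_def
    using y add_hom_inv[OF \<omega> y(1)] by (cases "\<omega> y > 0") (auto intro: bexI[of _ y] bexI[of _ "inv y"])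
  then have "Q m" unfolding m_def by (rule LeastI)
  then obtain t where t: "t \<in> carrier G" "\<omega> t = int m" "m > 0" by (auto simp: Q_def)
  have dvd: "int m dvd \<omega> g" if g: "g \<in> carrier G" for g
  proof (rule ccontr)
    assume "\<not> int m dvd \<omega> g"
    then have pos: "\<omega> g mod int m > 0" using t(3) by (simp add: dvd_eq_mod_eq_0 order.not_eq_order_implies_strict)
    have "\<omega> (g \<otimes> t [^] (- (\<omega> g div int m))) = \<omega> g mod int m"
      using g t by (simp add: add_hom_mult[OF \<omega>] add_hom_int_pow[OF \<omega>] minus_div_mult_eq_mod)
    then have "Q (nat (\<omega> g mod int m))" unfolding Q_def using pos g t(1)
      by (intro conjI bexI[of _ "g \<otimes> t [^] (- (\<omega> g div int m))"]) auto
    then have "m \<le> nat (\<omega> g mod int m)" unfolding m_def by (rule Least_le)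
    then show False using t(3) pos_mod_bound[of "int m" "\<omega> g"] by linarith
  qed
  then show ?thesis using t by (intro bexI[of _ t] exI[of _ "int m"]) auto
qed

lemma (in group) ex_int_epi_of_real_hom:
  fixes \<psi> :: "'a \<Rightarrow> real"
  assumes S: "finite S" "S \<subseteq> carrier G" "generate G S = carrier G"
    and \<psi>: "add_hom G \<psi>" "y \<in> carrier G" "\<psi> y \<noteq> 0"
  shows "\<exists>\<phi> :: 'a \<Rightarrow> int. add_hom G \<phi> \<and> (\<exists>t\<in>carrier G. \<phi> t = 1)"
proof -
  obtain f :: "real \<Rightarrow> rat" where f: "\<And>a b. f (a + b) = f a + f b" "f (\<psi> y) = 1"
    using ex_rat_functional[OF \<psi>(3)] by blast
  define \<chi>' where "\<chi>' g = f (\<psi> g)" for g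
  have \<chi>': "add_hom G \<chi>'" using \<psi>(1) f(1) by (simp add: add_hom_def \<chi>'_def)
  define den where "den s = snd (quotient_of (\<chi>' s))" for s
  have den: "den s > 0" "of_int (den s) * \<chi>' s \<in> \<int>" for s
  proof -
    obtain p q where pq: "quotient_of (\<chi>' s) = (p, q)" by fastforce
    then have "q > 0" "\<chi>' s = of_int p / of_int q" using quotient_of_denom_pos quotient_of_div by blast+
    then show "den s > 0" "of_int (den s) * \<chi>' s \<in> \<int>" using pq by (auto simp: den_def)
  qed
  \<comment> \<open>A common denominator for the finitely many generators clears the denominators on
    the whole group.\<close>
  define D where "D = (\<Prod>s\<in>S. den s)"
  have D0: "D > 0" unfolding D_def by (intro prod_pos den(1) ballI)
  have DS: "of_int D * \<chi>' s \<in> \<int>" if "s \<in> S" for s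
  proof -
    have "D = (\<Prod>s\<in>S - {s}. den s) * den s" unfolding D_def using S(1) that by (simp add: prod.remove mult.commute)
    then have "of_int D * \<chi>' s = of_int (\<Prod>s\<in>S - {s}. den s) * (of_int (den s) * \<chi>' s)"
      by (simp only: of_int_mult mult.assoc)
    then show ?thesis using den(2) by (metis Ints_mult Ints_of_int)
  qed
  have "of_int D * \<chi>' g \<in> \<int>" if "g \<in> generate G S" for g
    using that
  proof induction
    case one
    then show ?case by (simp add: add_hom_one[OF \<chi>'])
  next
    case (incl h)
    then show ?case by (rule DS)
  next
    case (inv h)
    then show ?case using DS[of h] S(2) by (simp add: add_hom_inv[OF \<chi>'] subset_iff)
  next
    case (eng g h)
    then have "g \<in> carrier G" "h \<in> carrier G" using S(3) by auto
    then show ?case using eng by (simp add: add_hom_mult[OF \<chi>'] distrib_left)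
  qed
  then have int: "of_int D * \<chi>' g \<in> \<int>" if "g \<in> carrier G" for g using that S(3) by simp
  define \<omega> where "\<omega> g = \<lfloor>of_int D * \<chi>' g\<rfloor>" for g
  have \<omega>i: "of_int (\<omega> g) = of_int D * \<chi>' g" if "g \<in> carrier G" for g
    using int[OF that] by (simp add: \<omega>_def)
  have \<omega>: "add_hom G \<omega>" unfolding add_hom_def
  proof (intro ballI)
    fix g h assume "g \<in> carrier G" "h \<in> carrier G"
    then have "(of_int (\<omega> (g \<otimes> h)) :: rat) = of_int (\<omega> g + \<omega> h)"
      by (simp add: \<omega>i add_hom_mult[OF \<chi>'] distrib_left)
    then show "\<omega> (g \<otimes> h) = \<omega> g + \<omega> h" by (simp only: of_int_eq_iff)
  qed
  have "\<omega> y = D" by (simp add: \<omega>_def \<chi>'_def f(2))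
  obtain t m where t: "t \<in> carrier G" "\<omega> t = m" "m > 0" and dvd: "\<forall>g\<in>carrier G. m dvd \<omega> g"
    using add_hom_int_generator[OF \<omega> \<psi>(2)] \<open>\<omega> y = D\<close> D0 by auto
  have "add_hom G (\<lambda>g. \<omega> g div m)"
    using dvd by (auto simp: add_hom_def add_hom_mult[OF \<omega>] div_plus_div_distrib_dvd_left)
  moreover have "\<omega> t div m = 1" using t by simp
  ultimately show ?thesis using t(1) by (intro exI[of _ "\<lambda>g. \<omega> g div m"]) auto
qed

lemma (in group) ex_int_epi:
  assumes S: "finite S" "S \<subseteq> carrier G" "generate G S = carrier G" and ntriv: "carrier G \<noteq> {\<one>}"
    and cones: "countable {P. positive_cone G P}" "positive_cone G P0"
  shows "\<exists>\<phi> :: 'a \<Rightarrow> int. add_hom G \<phi> \<and> (\<exists>t\<in>carrier G. \<phi> t = 1)"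
proof -
  obtain P where P: "positive_cone G P" and orb: "finite ((\<lambda>g. conj_set G g P) ` carrier G)"
    using finite_conj_orbit[OF cones] by blast
  interpret cone_ordered G P by unfold_locales (rule P)
  define \<O> where "\<O> = (\<lambda>g. conj_set G g P) ` carrier G"
  have OG: "Q \<subseteq> carrier G" if "Q \<in> \<O>" for Q using that by (auto simp: \<O>_def conj_set_def)
  have Oconj: "conj_set G g Q \<in> \<O>" if "g \<in> carrier G" "Q \<in> \<O>" for g Q
    using that by (auto simp: \<O>_def conj_set_conj_set)
  have PO: "P \<in> \<O>" unfolding \<O>_def by (rule image_eqI[of _ _ \<one>]) (auto simp: conj_set_one P_subset)
  \<comment> \<open>The kernel of the action on the finite orbit, hence normal and of finite index,
    and contained in the stabiliser of \<open>P\<close>.\<close>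
  define N where "N = {n \<in> carrier G. \<forall>Q\<in>\<O>. conj_set G n Q = Q}"
  have Ninv: "inv n \<in> N" if n: "n \<in> N" for n
  proof -
    have "conj_set G (inv n) Q = Q" if "Q \<in> \<O>" for Q
    proof -
      have nc: "n \<in> carrier G" and nQ: "conj_set G n Q = Q" using n that by (auto simp: N_def)
      have "conj_set G (inv n) (conj_set G n Q) = conj_set G (inv n \<otimes> n) Q"
        using nc by (intro conj_set_conj_set) auto
      then show ?thesis using nc nQ OG[OF that] by (simp add: conj_set_one)
    qed
    then show ?thesis using n by (simp add: N_def)
  qed
  have N: "subgroup N G"
  proof (rule subgroupI)
    show "N \<subseteq> carrier G" by (auto simp: N_def)
    have "\<one> \<in> N" using OG by (auto simp: N_def conj_set_one)
    then show "N \<noteq> {}" by auto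
    show "a \<otimes> b \<in> N" if "a \<in> N" "b \<in> N" for a b
      using that by (simp add: N_def flip: conj_set_conj_set)
  qed (rule Ninv)
  have conjN: "c \<otimes> n \<otimes> inv c \<in> N" if "c \<in> carrier G" "n \<in> N" for c n
  proof -
    have "conj_set G (c \<otimes> n \<otimes> inv c) Q = Q" if Q: "Q \<in> \<O>" for Q
    proof -
      have "conj_set G n (conj_set G (inv c) Q) = conj_set G (inv c) Q"
        using \<open>n \<in> N\<close> Oconj[of "inv c" Q] Q \<open>c \<in> carrier G\<close> by (simp add: N_def)
      moreover have "conj_set G (c \<otimes> n \<otimes> inv c) Q = conj_set G c (conj_set G n (conj_set G (inv c) Q))"
        using that \<open>c \<in> carrier G\<close> \<open>n \<in> N\<close> by (simp add: N_def conj_set_conj_set m_assoc)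
      ultimately show ?thesis using \<open>c \<in> carrier G\<close> OG[OF Q] by (simp add: conj_set_conj_set conj_set_one)
    qed
    then show ?thesis using that by (simp add: N_def)
  qed
  have conjP: "inv n \<otimes> x \<otimes> n \<in> P" if "n \<in> N" "x \<in> P" for n x
  proof -
    have "x \<in> conj_set G n P" using that PO by (simp add: N_def)
    then show ?thesis using that by (auto simp: conj_set_def N_def m_assoc)
  qed
  define act where "act g = restrict (conj_set G g) \<O>" for g
  have "act ` carrier G \<subseteq> \<O> \<rightarrow>\<^sub>E \<O>" using Oconj by (auto simp: act_def)
  moreover have "finite \<O>" using orb by (simp add: \<O>_def)
  ultimately have finact: "finite (act ` carrier G)" by (meson finite_PiE finite_subset)
  have actN: "inv a \<otimes> b \<in> N" if "act a = act b" "a \<in> carrier G" "b \<in> carrier G" for a b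
  proof -
    have "conj_set G (inv a \<otimes> b) Q = Q" if Q: "Q \<in> \<O>" for Q
    proof -
      have "conj_set G a Q = conj_set G b Q" using fun_cong[OF \<open>act a = act b\<close>, of Q] Q by (simp add: act_def)
      then have "conj_set G (inv a) (conj_set G a Q) = conj_set G (inv a) (conj_set G b Q)" by simp
      then show ?thesis using \<open>a \<in> carrier G\<close> \<open>b \<in> carrier G\<close> OG[OF Q]
        by (simp add: conj_set_conj_set conj_set_one)
    qed
    then show ?thesis using that by (simp add: N_def)
  qed
  have fin: "finite (rcosets N)"
  proof -
    \<comment> \<open>\<open>actN\<close> controls \<open>inv a \<otimes> b\<close>, whereas
      equality of right cosets concerns \<open>a \<otimes> inv b\<close>; hence the
      inverses.\<close>
    have "N #> a = N #> b" if "act (inv a) = act (inv b)" "a \<in> carrier G" "b \<in> carrier G" for a b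
    proof -
      have "a \<otimes> inv b \<in> N" using actN[OF that(1)] that by simp
      then have "a \<in> N #> b" using that by (auto simp: r_coset_def m_assoc intro!: bexI[of _ "a \<otimes> inv b"])
      then show ?thesis using repr_independence[OF _ that(3) N] by simp
    qed
    then have "rcosets N \<subseteq> (\<lambda>f. N #> (SOME a. a \<in> carrier G \<and> act (inv a) = f)) ` act ` carrier G"
      unfolding RCOSETS_def
    proof clarify
      fix a assume *: "\<And>a b. act (inv a) = act (inv b) \<Longrightarrow> a \<in> carrier G \<Longrightarrow> b \<in> carrier G \<Longrightarrow> N #> a = N #> b"
        and a: "a \<in> carrier G"
      define b where "b = (SOME b. b \<in> carrier G \<and> act (inv b) = act (inv a))"
      have "b \<in> carrier G \<and> act (inv b) = act (inv a)" unfolding b_def by (rule someI[of _ a]) (use a in simp)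
      then have "N #> a = N #> b" using * a by metis
      then show "N #> a \<in> (\<lambda>f. N #> (SOME a. a \<in> carrier G \<and> act (inv a) = f)) ` act ` carrier G"
        using a unfolding b_def by (intro image_eqI[of _ _ "act (inv a)"]) auto
    qed
    then show ?thesis using finact finite_subset by blast
  qed
  \<comment> \<open>The largest element of \<open>T\<close> is positive and dominates every
    generator and its inverse.\<close>
  define T where "T = S \<union> m_inv G ` S"
  have T: "finite T" "T \<subseteq> carrier G" using S by (auto simp: T_def)
  have "\<exists>s\<in>S. s \<noteq> \<one>"
  proof (rule ccontr)
    assume "\<not> ?thesis"
    then have "S \<subseteq> {\<one>}" by auto
    then have "carrier G \<subseteq> generate G {\<one>}" using mono_generate S(3) by metis
    then show False using ntriv generate_one by auto
  qed
  then obtain s0 where "s0 \<in> S" "s0 \<noteq> \<one>" by blast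
  then have "s0 \<in> P \<or> inv s0 \<in> P" "s0 \<in> T" "inv s0 \<in> T" using P_total[of s0] S(2) by (auto simp: T_def)
  then obtain s where s: "s \<in> T" "s \<in> P" by blast
  then have "T \<noteq> {}" by blast
  from le_max[OF T(1) this T(2)] obtain x where x: "x \<in> T" "\<And>a. a \<in> T \<Longrightarrow> le a x" by blast
  have xP: "x \<in> P"
  proof -
    have "le \<one> x" using one_le[OF s(2)] x(2)[OF s(1)] le_trans by blast
    moreover have "x \<noteq> \<one>"
    proof
      assume "x = \<one>"
      then have "s = \<one>" using x(2)[OF s(1)] one_le[OF s(2)] le_antisym by blast
      then show False using s P_one by simp
    qed
    ultimately show ?thesis by (auto simp: le_def)
  qed
  have xc: "x \<in> carrier G" using xP P_subset by auto
  \<comment> \<open>Only finitely many permutations of the orbit are available, so two powers of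
    \<open>x\<close> act alike and their quotient \<open>y\<close> lies in \<open>N\<close>.\<close>
  have "\<not> inj (\<lambda>n::nat. act (x [^] n))"
  proof
    assume "inj (\<lambda>n::nat. act (x [^] n))"
    moreover have "range (\<lambda>n::nat. act (x [^] n)) \<subseteq> act ` carrier G" using xc by auto
    ultimately show False using finact by (meson finite_subset range_inj_infinite)
  qed
  then obtain i j :: nat where ij: "i < j" "act (x [^] i) = act (x [^] j)"
    unfolding inj_def by (metis linorder_neq_iff)
  define k where "k = j - i"
  define y where "y = x [^] k"
  have "inv (x [^] i) \<otimes> x [^] j = y"
  proof -
    have "x [^] j = x [^] i \<otimes> x [^] k" using ij xc by (simp add: nat_pow_mult k_def)
    then show ?thesis using xc by (simp add: y_def)
  qed
  then have yN: "y \<in> N" using actN[OF ij(2)] xc by simp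
  have pow: "x [^] n \<in> P \<and> le x (x [^] n)" if "n > 0" for n :: nat
    using that
  proof (induction n)
    case (Suc n)
    show ?case
    proof (cases "n = 0")
      case False
      then have "x [^] n \<in> P" "le x (x [^] n)" using Suc by auto
      moreover have "le (x [^] n \<otimes> \<one>) (x [^] n \<otimes> x)" using le_mult_left[OF one_le[OF xP]] xc by simp
      ultimately show ?thesis using P_mult xP xc by (auto intro: le_trans)
    qed (use xc xP in simp)
  qed simp
  have yP: "y \<in> P" and xy: "le x y" using pow[of k] ij by (auto simp: y_def k_def)
  have yc: "y \<in> carrier G" using yP P_subset by auto
  have yn: "y [^] n \<in> N" for n :: nat
    using subgroup.m_closed[OF N] subgroup.one_closed[OF N] yN by (induction n) auto
  \<comment> \<open>The bounds for two factors can be multiplied because powers of \<open>y\<close>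
    lie in \<open>N\<close>, so that multiplying by them on the right is monotone.\<close>
  have "\<exists>n::nat. le g (y [^] n)" if "g \<in> generate G S" for g
    using that
  proof induction
    case one
    show ?case by (rule exI[of _ 0]) simp
  next
    case (incl h)
    then have "le h y" using x(2)[of h] xy le_trans by (auto simp: T_def)
    then show ?case using yc by (intro exI[of _ 1]) simp
  next
    case (inv h)
    then have "le (inv h) y" using x(2)[of "inv h"] xy le_trans by (auto simp: T_def)
    then show ?case using yc by (intro exI[of _ 1]) simp
  next
    case (eng g h)
    then obtain n m :: nat where nm: "le g (y [^] n)" "le h (y [^] m)" by blast
    have "le (g \<otimes> h) (g \<otimes> y [^] m)" using le_mult_left nm le_carrier by blast
    also have "le (g \<otimes> y [^] m) (y [^] n \<otimes> y [^] m)" using nm(1) yc conjP yn by (intro le_mult_right) auto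
    also have "y [^] n \<otimes> y [^] m = y [^] (n + m)" using yc by (simp add: nat_pow_mult)
    finally show ?case by blast
  qed
  then have cof: "\<exists>n::nat. le g (y [^] n)" if "g \<in> carrier G" for g using that S(3) by simp
  interpret cofinal_ordered G P N y
    by (intro cofinal_ordered.intro cofinal_ordered_axioms.intro cone_ordered_axioms N conjP conjN yN yP cof)
  obtain \<psi> where \<psi>: "add_hom G \<psi>" "\<forall>n\<in>N. \<psi> n = real (card (rcosets N)) * slope n"
    using transfer_hom[OF N fin slope_mult conjN slope_conj] N_carrier by blast
  \<comment> \<open>The index is finite and nonzero, hence the transfer of the slope does not vanish
    at \<open>y\<close>.\<close>
  have "N \<in> rcosets N" using subgroup.subgroup_in_rcosets[OF N is_group] .
  then have "card (rcosets N) \<noteq> 0" using fin by auto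
  then have "\<psi> y \<noteq> 0" using \<psi>(2) yN slope_y by simp
  then show ?thesis using ex_int_epi_of_real_hom[OF S \<psi>(1) yc] by blast
qed

section \<open>Infinite cyclic factors\<close>

lemma (in group) Mod_add_ker_iso:
  fixes \<phi> :: "'a \<Rightarrow> int"
  assumes \<phi>: "add_hom G \<phi>" and t: "t \<in> carrier G" "\<phi> t = 1"
  shows "G Mod add_ker G \<phi> \<cong> integer_group"
proof -
  interpret h: group_hom G integer_group \<phi>
    using \<phi> by (intro group_hom.intro group_hom_axioms.intro is_group group_integer_group)
      (auto simp: hom_def add_hom_def)
  have "k \<in> \<phi> ` carrier G" for k
    using t add_hom_int_pow[OF \<phi> t(1), of k] by (intro image_eqI[of _ _ "t [^] k"]) auto
  then have "\<phi> ` carrier G = carrier integer_group" by auto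
  from h.FactGroup_iso_set[OF this] show ?thesis
    by (auto simp: is_iso_def kernel_def add_ker_def)
qed

lemma (in group) add_ker_of_Mod_iso:
  assumes N: "N \<lhd> G" and iso: "G Mod N \<cong> integer_group"
  shows "\<exists>(\<phi> :: 'a \<Rightarrow> int) t. add_hom G \<phi> \<and> t \<in> carrier G \<and> \<phi> t = 1 \<and> N = add_ker G \<phi>"
proof -
  interpret N: normal N G by (rule N)
  obtain i where i: "i \<in> iso (G Mod N) integer_group" using iso by (auto simp: is_iso_def)
  then have hom: "i \<in> hom (G Mod N) integer_group" and bij: "bij_betw i (carrier (G Mod N)) UNIV"
    by (auto simp: iso_def)
  have c: "N #> x \<in> carrier (G Mod N)" if "x \<in> carrier G" for x
    using that by (auto simp: FactGroup_def RCOSETS_def)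
  define \<phi> where "\<phi> x = i (N #> x)" for x
  have \<phi>: "add_hom G \<phi>" unfolding add_hom_def
  proof (intro ballI)
    fix x y assume xy: "x \<in> carrier G" "y \<in> carrier G"
    then have "N #> (x \<otimes> y) = (N #> x) \<otimes>\<^bsub>G Mod N\<^esub> (N #> y)" by (simp add: FactGroup_def N.rcos_sum)
    then show "\<phi> (x \<otimes> y) = \<phi> x + \<phi> y" using hom c xy by (simp add: \<phi>_def hom_def)
  qed
  obtain A where A: "A \<in> carrier (G Mod N)" "i A = 1" using bij by (metis UNIV_I bij_betw_imp_surj_on imageE)
  then obtain t where t: "t \<in> carrier G" "A = N #> t" by (auto simp: FactGroup_def RCOSETS_def)
  have "x \<in> N \<longleftrightarrow> \<phi> x = 0" if x: "x \<in> carrier G" for x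
  proof
    assume "x \<in> N"
    then have "N #> x = N #> \<one>" using coset_join2[OF x N.is_subgroup] coset_mult_one[OF N.subset] by simp
    then show "\<phi> x = 0" using add_hom_one[OF \<phi>] by (simp add: \<phi>_def)
  next
    assume "\<phi> x = 0"
    then have "i (N #> x) = i (N #> \<one>)" using add_hom_one[OF \<phi>] by (simp add: \<phi>_def)
    then have "N #> x = N #> \<one>" using bij c[OF x] c[of \<one>] by (auto simp: bij_betw_def inj_on_def)
    then show "x \<in> N" using rcos_self[OF x N.is_subgroup] coset_mult_one[OF N.subset] by simp
  qed
  then have "N = add_ker G \<phi>" using N.subset by (auto simp: add_ker_def)
  moreover have "\<phi> t = 1" using t A by (simp add: \<phi>_def)
  ultimately show ?thesis using \<phi> t(1) by blast
qed

lemma (in group) tf_abelian_rank1_of_iso: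
  assumes "G \<cong> integer_group"
  shows "tf_abelian_rank1 G"
proof -
  obtain i where i: "i \<in> iso G integer_group" using assms by (auto simp: is_iso_def)
  then have "i \<in> hom G integer_group" and inj: "inj_on i (carrier G)" and surj: "i ` carrier G = UNIV"
    by (auto simp: iso_def bij_betw_def)
  then have hom: "add_hom G i" by (auto simp: add_hom_def hom_def)
  have eq: "x = y" if "x \<in> carrier G" "y \<in> carrier G" "i x = i y" for x y
    using inj that by (auto simp: inj_on_def)
  have "comm_group G"
    using eq by (intro group_comm_groupI) (auto simp: add_hom_mult[OF hom])
  moreover have "carrier G \<noteq> {\<one>}"
  proof
    assume "carrier G = {\<one>}"
    then have "(1::int) \<in> i ` {\<one>}" using surj by simp
    then show False by (simp add: add_hom_one[OF hom])
  qed
  moreover have "x = \<one>" if "x \<in> carrier G" "(n::nat) > 0" "x [^] n = \<one>" for x n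
    using that eq[of x \<one>] add_hom_nat_pow[OF hom, of x n] add_hom_one[OF hom] by simp
  moreover have "\<exists>(m::int) (n::int). (m \<noteq> 0 \<or> n \<noteq> 0) \<and> a [^] m \<otimes> b [^] n = \<one>"
    if "a \<in> carrier G" "b \<in> carrier G" for a b
  proof (cases "a = \<one>")
    case True
    then show ?thesis by (intro exI[of _ 1] exI[of _ 0]) simp
  next
    case False
    then have "i a \<noteq> 0" using eq[of a \<one>] that add_hom_one[OF hom] by auto
    moreover have "a [^] i b \<otimes> b [^] (- i a) = \<one>"
      using that by (intro eq) (simp_all add: add_hom_mult[OF hom] add_hom_int_pow[OF hom] add_hom_one[OF hom])
    ultimately show ?thesis by (intro exI[of _ "i b"] exI[of _ "- i a"]) simp
  qed
  ultimately show ?thesis unfolding tf_abelian_rank1_def by blast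
qed

text \<open>If \<open>a\<^sup>m b\<^sup>n = 1\<close> with \<open>m\<close>, \<open>n\<close> coprime and \<open>u m + v n = 1\<close>,
  then \<open>c = a\<^sup>v b\<^bsup>-u\<^esup>\<close> satisfies \<open>c\<^sup>n = a\<close> and \<open>c\<^bsup>-m\<^esup> = b\<close>.\<close>

lemma tf_abelian_rank1_common_root:
  fixes Q (structure)
  assumes "tf_abelian_rank1 Q" and ab: "a \<in> carrier Q" "b \<in> carrier Q"
  shows "\<exists>c\<in>carrier Q. \<exists>(k::int) (l::int). a = c [^] k \<and> b = c [^] l"
proof -
  interpret comm_group Q using assms(1) by (simp add: tf_abelian_rank1_def)
  obtain m n :: int where mn: "m \<noteq> 0 \<or> n \<noteq> 0" "a [^] m \<otimes> b [^] n = \<one>"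
    using assms unfolding tf_abelian_rank1_def by blast
  define d where "d = gcd m n"
  define m' where "m' = m div d"
  define n' where "n' = n div d"
  have d: "d > 0" using mn(1) by (auto simp: d_def)
  have m: "m = m' * d" and n: "n = n' * d" by (simp_all add: m'_def n'_def d_def)
  have "coprime m' n'" unfolding m'_def n'_def d_def using mn(1) by (rule div_gcd_coprime)
  then obtain u v where uv: "u * m' + v * n' = 1" using bezout_int[of m' n'] by (metis coprime_imp_gcd_eq_1)
  have "(a [^] m' \<otimes> b [^] n') [^] d = \<one>"
    using mn(2) ab by (simp add: int_pow_distrib int_pow_pow m n)
  then have "(a [^] m' \<otimes> b [^] n') [^] nat d = \<one>" using d by (simp flip: int_pow_int)
  then have e: "a [^] m' \<otimes> b [^] n' = \<one>"
    using assms(1) d ab unfolding tf_abelian_rank1_def by (metis int_pow_closed m_closed zero_less_nat_eq)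
  have e1: "b [^] n' = a [^] (- m')"
    using e ab by (simp add: int_pow_neg) (metis inv_equality inv_inv int_pow_closed m_comm)
  have e2: "a [^] m' = b [^] (- n')"
    using e ab by (simp add: int_pow_neg) (metis inv_equality int_pow_closed)
  define c where "c = a [^] v \<otimes> b [^] (- u)"
  have c: "c \<in> carrier Q" using ab by (simp add: c_def)
  have "c [^] n' = a [^] (v * n') \<otimes> (b [^] n') [^] (- u)"
    using ab by (simp add: c_def int_pow_distrib int_pow_pow mult.commute)
  also have "\<dots> = a [^] (v * n' + u * m')" unfolding e1 using ab by (simp add: int_pow_pow int_pow_mult[symmetric] mult.commute)
  finally have 1: "c [^] n' = a" using uv ab by (simp add: add.commute)
  have "c [^] (- m') = (a [^] m') [^] (- v) \<otimes> b [^] (u * m')"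
    using ab by (simp add: c_def int_pow_distrib int_pow_pow mult.commute)
  also have "\<dots> = b [^] (v * n' + u * m')" unfolding e2 using ab by (simp add: int_pow_pow int_pow_mult[symmetric] mult.commute)
  finally have 2: "c [^] (- m') = b" using uv ab by (simp add: add.commute)
  show ?thesis using c 1 2 by metis
qed

text \<open>Adding the generators one at a time and taking common roots produces a single generator;
  torsion-freeness makes its powers distinct.\<close>

lemma tf_abelian_rank1_fg_iso:
  fixes Q (structure)
  assumes Q: "tf_abelian_rank1 Q" and T: "finite T" "T \<subseteq> carrier Q" "generate Q T = carrier Q"
  shows "Q \<cong> integer_group"
proof -
  interpret comm_group Q using Q by (simp add: tf_abelian_rank1_def)
  have "\<exists>c\<in>carrier Q. \<forall>x\<in>T. \<exists>k::int. x = c [^] k"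
    using T(1,2)
  proof (induction T)
    case (insert x T)
    then obtain c where c: "c \<in> carrier Q" "\<forall>x\<in>T. \<exists>k::int. x = c [^] k" by auto
    obtain e and k l :: int where e: "e \<in> carrier Q" "c = e [^] k" "x = e [^] l"
      using tf_abelian_rank1_common_root[OF Q c(1), of x] insert.prems by auto
    then have "\<forall>y\<in>T. \<exists>j::int. y = e [^] j" using c(2) by (metis int_pow_pow)
    then show ?case using e by (intro bexI[of _ e]) auto
  qed auto
  then obtain c where c: "c \<in> carrier Q" "\<And>x. x \<in> T \<Longrightarrow> \<exists>k::int. x = c [^] k" by auto
  have "\<exists>k::int. x = c [^] k" if "x \<in> generate Q T" for x
    using that
  proof induction
    case one
    show ?case by (rule exI[of _ 0]) simp
  next
    case (inv h)
    then obtain k :: int where "h = c [^] k" using c by blast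
    then show ?case using c(1) by (intro exI[of _ "- k"]) (simp add: int_pow_neg)
  next
    case (eng g h)
    then obtain k l :: int where "g = c [^] k" "h = c [^] l" by blast
    then show ?case using c(1) by (intro exI[of _ "k + l"]) (simp add: int_pow_mult)
  qed (use c in auto)
  then have surj: "range (\<lambda>k::int. c [^] k) = carrier Q" using T(3) c(1) by auto
  have zero: "k = 0" if "c [^] k = \<one>" for k :: int
  proof (rule ccontr)
    assume k: "k \<noteq> 0"
    have "c [^] nat \<bar>k\<bar> = \<one>"
      using that c(1) by (cases "k \<ge> 0") (auto simp: int_pow_neg simp flip: int_pow_int)
    then have "c = \<one>" using Q k c(1) unfolding tf_abelian_rank1_def by (metis zero_less_abs_iff zero_less_nat_eq)
    then have "carrier Q = {\<one>}" using surj by auto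
    then show False using Q by (simp add: tf_abelian_rank1_def)
  qed
  have "inj (\<lambda>k::int. c [^] k)"
  proof (rule injI)
    fix k l :: int assume "c [^] k = c [^] l"
    then have "c [^] (k - l) = \<one>" using c(1) by (simp add: int_pow_diff)
    then show "k = l" using zero by fastforce
  qed
  then have "(\<lambda>k::int. c [^] k) \<in> iso integer_group Q"
    using surj c(1) by (auto simp: iso_def hom_def bij_betw_def int_pow_mult)
  then have "integer_group \<cong> Q" by (auto simp: is_iso_def)
  then show ?thesis using group.iso_sym[OF group_integer_group] by blast
qed

lemma (in group) Mod_fg_iso:
  assumes S: "finite S" "S \<subseteq> carrier G" "generate G S = carrier G"
    and N: "N \<lhd> G" and tf: "tf_abelian_rank1 (G Mod N)"
  shows "G Mod N \<cong> integer_group"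
proof -
  interpret N: normal N G by (rule N)
  interpret h: group_hom G "G Mod N" "\<lambda>a. N #> a"
    by (intro group_hom.intro group_hom_axioms.intro is_group N.factorgroup_is_group N.r_coset_hom_Mod)
  have "generate (G Mod N) ((\<lambda>a. N #> a) ` S) = (\<lambda>a. N #> a) ` carrier G"
    using h.generate_img[OF S(2)] S(3) by simp
  also have "\<dots> = carrier (G Mod N)" by (auto simp: FactGroup_def RCOSETS_def)
  finally show ?thesis using S tf by (intro tf_abelian_rank1_fg_iso[OF tf, of "(\<lambda>a. N #> a) ` S"]) auto
qed

section \<open>Finite generation of subgroups\<close>

lemma (in group) subnormal_series_subgroup:
  assumes "subnormal_series G Hs" "i < length Hs"
  shows "subgroup (Hs ! i) G"
  using assms(2)
proof (induction i)
  case 0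
  then have "Hs ! 0 = carrier G" using assms(1) by (auto simp: subnormal_series_def hd_conv_nth)
  then show ?case by (simp add: subgroup_self)
next
  case (Suc i)
  then have "Hs ! Suc i \<lhd> G\<lparr>carrier := Hs ! i\<rparr>"
    using assms(1) unfolding subnormal_series_def by blast
  then have "subgroup (Hs ! Suc i) (G\<lparr>carrier := Hs ! i\<rparr>)" by (rule normal_imp_subgroup)
  then show ?case using incl_subgroup Suc by auto
qed

text \<open>Induction along the series: \<open>K\<close> is generated by generators of
  \<open>K \<inter> H'\<close> together with one element \<open>t\<close> of least positive height,
  if \<open>K\<close> has an element of nonzero height. It is applied to the terms of an unrelated
  series.\<close>

lemma (in group) fg_subgroup_poly_Z:
  assumes "Hs \<noteq> []" "last Hs = {\<one>}" "subgroup (hd Hs) G"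
    and "\<And>i. Suc i < length Hs \<Longrightarrow> Hs ! Suc i \<lhd> G\<lparr>carrier := Hs ! i\<rparr> \<and> series_factor G Hs i \<cong> integer_group"
    and "subgroup K G" "K \<subseteq> hd Hs"
  shows "\<exists>S. finite S \<and> S \<subseteq> K \<and> generate G S = K"
  using assms
proof (induction Hs arbitrary: K rule: induct_list012)
  case (2 H)
  then have "K = {\<one>}" using subgroup.one_closed by fastforce
  then show ?case using generate_empty by (intro exI[of _ "{}"]) auto
next
  case (3 H H' Hs)
  have H: "subgroup H G" using 3 by simp
  interpret H: group "G\<lparr>carrier := H\<rparr>" using subgroup_imp_group[OF H] .
  have N: "H' \<lhd> G\<lparr>carrier := H\<rparr>" "(G\<lparr>carrier := H\<rparr>) Mod H' \<cong> integer_group"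
    using "3.prems"(4)[of 0] by (auto simp: series_factor_def)
  obtain \<phi> :: "'a \<Rightarrow> int" where \<phi>: "add_hom (G\<lparr>carrier := H\<rparr>) \<phi>" "H' = add_ker (G\<lparr>carrier := H\<rparr>) \<phi>"
    using H.add_ker_of_Mod_iso[OF N] by blast
  have H': "subgroup H' G" using incl_subgroup[OF H] normal_imp_subgroup[OF N(1)] by blast
  have KH: "subgroup (K \<inter> H') G" using "3.prems"(5) H' by (rule subgroups_Inter_pair)
  have steps: "(H' # Hs) ! Suc i \<lhd> G\<lparr>carrier := (H' # Hs) ! i\<rparr> \<and> series_factor G (H' # Hs) i \<cong> integer_group"
    if "Suc i < length (H' # Hs)" for i
    using "3.prems"(4)[of "Suc i"] that by (simp add: series_factor_def)
  obtain S where S: "finite S" "S \<subseteq> K \<inter> H'" "generate G S = K \<inter> H'"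
    using "3.IH"(2)[OF _ _ _ steps KH] "3.prems" H' by auto
  have KG: "K \<subseteq> carrier G" and KsubH: "K \<subseteq> H" using subgroup.subset 3 by auto
  interpret K: group "G\<lparr>carrier := K\<rparr>" using subgroup_imp_group[OF "3.prems"(5)] .
  have \<phi>K: "add_hom (G\<lparr>carrier := K\<rparr>) \<phi>" using \<phi>(1) KsubH by (auto simp: add_hom_def)
  show ?case
  proof (cases "\<exists>y\<in>K. \<phi> y \<noteq> 0")
    case False
    then have "K \<inter> H' = K" using \<phi>(2) KsubH by (auto simp: add_ker_def)
    then show ?thesis using S by auto
  next
    case True
    then have "\<exists>t\<in>K. \<phi> t > 0 \<and> (\<forall>g\<in>K. \<phi> t dvd \<phi> g)"
      using K.add_hom_int_generator[OF \<phi>K] by auto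
    then obtain t and m :: int where t: "t \<in> K" "\<phi> t = m" "m > 0" "\<And>g. g \<in> K \<Longrightarrow> m dvd \<phi> g"
      by blast
    have SK: "insert t S \<subseteq> K" using S t by auto
    have "K \<subseteq> generate G (insert t S)"
    proof
      fix g assume g: "g \<in> K"
      define j where "j = \<phi> g div m"
      have tj: "t [^] j \<in> K" for j :: int using subgroup_int_pow_closed[OF "3.prems"(5) t(1)] .
      have \<phi>tj: "\<phi> (t [^] j) = j * m" for j :: int
        using K.add_hom_int_pow[OF \<phi>K, of t j] int_pow_consistent[OF "3.prems"(5) t(1)] t by simp
      have 1: "g \<otimes> t [^] (- j) \<in> K" using subgroup.m_closed[OF "3.prems"(5) g tj] .
      have "\<phi> (g \<otimes> t [^] (- j)) = 0"
        using add_hom_mult[OF \<phi>K, of g "t [^] (- j)"] g tj t(4)[OF g] by (simp add: \<phi>tj j_def)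
      then have "g \<otimes> t [^] (- j) \<in> generate G S" using 1 S(3) KsubH \<phi>(2) by (auto simp: add_ker_def)
      then have "g \<otimes> t [^] (- j) \<in> generate G (insert t S)" using mono_generate[of S "insert t S"] by auto
      moreover have "t [^] j \<in> generate G (insert t S)"
        using subgroup_int_pow_closed[OF generate_is_subgroup[OF subset_trans[OF SK KG]]]
          generate.incl[of t "insert t S" G] by simp
      ultimately have "(g \<otimes> t [^] (- j)) \<otimes> t [^] j \<in> generate G (insert t S)" by (rule generate.eng)
      moreover have "(g \<otimes> t [^] (- j)) \<otimes> t [^] j = g"
        using g t(1) KG by (simp add: m_assoc int_pow_mult[symmetric] subset_iff)
      ultimately show "g \<in> generate G (insert t S)" by simp
    qed
    moreover have "generate G (insert t S) \<subseteq> K" using generate_subgroup_incl[OF SK "3.prems"(5)] .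
    ultimately show ?thesis using S SK by (intro exI[of _ "insert t S"]) auto
  qed
qed auto

section \<open>Two consecutive factors\<close>

text \<open>Conjugation preserves the sign of an element in a bi-order, but here \<open>b\<close>
  conjugates \<open>a\<close> to its inverse.\<close>

lemma (in group) bi_order_conj_inv_imp_one:
  assumes lt: "bi_order G lt" and ab: "a \<in> carrier G" "b \<in> carrier G" "b \<otimes> a = inv a \<otimes> b"
  shows "a = \<one>"
proof (rule ccontr)
  assume "a \<noteq> \<one>"
  have irrefl: "\<forall>x\<in>carrier G. \<not> lt x x"
    and trans: "\<forall>x\<in>carrier G. \<forall>y\<in>carrier G. \<forall>z\<in>carrier G. lt x y \<longrightarrow> lt y z \<longrightarrow> lt x z"
    and total: "\<forall>x\<in>carrier G. \<forall>y\<in>carrier G. x \<noteq> y \<longrightarrow> lt x y \<or> lt y x"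
    and left: "\<forall>g\<in>carrier G. \<forall>x\<in>carrier G. \<forall>y\<in>carrier G. lt x y \<longrightarrow> lt (g \<otimes> x) (g \<otimes> y)"
    and right: "\<forall>g\<in>carrier G. \<forall>x\<in>carrier G. \<forall>y\<in>carrier G. lt x y \<longrightarrow> lt (x \<otimes> g) (y \<otimes> g)"
    using lt unfolding bi_order_def left_order_def by - (elim conjE, assumption)+
  have L: "lt (z \<otimes> x) (z \<otimes> y)" if "lt x y" "x \<in> carrier G" "y \<in> carrier G" "z \<in> carrier G" for x y z
    using left that by simp
  have R: "lt (x \<otimes> z) (y \<otimes> z)" if "lt x y" "x \<in> carrier G" "y \<in> carrier G" "z \<in> carrier G" for x y z
    using right that by simp
  have asym: "\<not> lt y x" if "lt x y" "x \<in> carrier G" "y \<in> carrier G" for x y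
    using irrefl trans that by blast
  have flip: "lt \<one> (inv x)" if "x \<in> carrier G" "lt x \<one>" for x
    using L[OF that(2,1), of "inv x"] that(1) by simp
  have conj: "lt \<one> (inv a)" if "lt \<one> a"
  proof -
    have "lt (b \<otimes> \<one>) (b \<otimes> a)" using L[OF that _ _ ab(2)] ab(1) by blast
    then have "lt b (inv a \<otimes> b)" using ab by simp
    then have "lt (b \<otimes> inv b) (inv a \<otimes> b \<otimes> inv b)" by (rule R) (use ab in auto)
    then show ?thesis using ab by (simp add: m_assoc)
  qed
  have conj': "lt (inv a) \<one>" if "lt a \<one>"
  proof -
    have "lt (b \<otimes> a) (b \<otimes> \<one>)" using L[OF that _ _ ab(2)] ab(1) by blast
    then have "lt (inv a \<otimes> b) b" using ab by simp
    then have "lt (inv a \<otimes> b \<otimes> inv b) (b \<otimes> inv b)" by (rule R) (use ab in auto)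
    then show ?thesis using ab by (simp add: m_assoc)
  qed
  have "lt \<one> a \<or> lt a \<one>" using total ab \<open>a \<noteq> \<one>\<close> by simp
  then show False
  proof
    assume "lt \<one> a"
    then have "lt (a \<otimes> \<one>) (a \<otimes> inv a)" by (intro L conj) (use ab in auto)
    then have "lt a \<one>" using ab by simp
    then show False using asym[OF \<open>lt \<one> a\<close>] ab by simp
  next
    assume "lt a \<one>"
    then have "lt \<one> (inv a)" "lt (inv a) \<one>" using flip conj' ab by auto
    then show False using asym ab by simp
  qed
qed

text \<open>The pair (\<phi>, \<psi>) embeds the quotient into the free abelian group of rank two,
  which carries the lexicographic order.\<close>

lemma (in group) bi_orderable_Mod_of_homs:
  fixes \<phi> \<psi> :: "'a \<Rightarrow> int"
  assumes \<phi>: "add_hom G \<phi>" and \<psi>: "add_hom G \<psi>" and N: "N \<lhd> G"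
    and ker: "N = {x \<in> carrier G. \<phi> x = 0 \<and> \<psi> x = 0}"
  shows "bi_orderable (G Mod N)"
proof -
  interpret N: normal N G by (rule N)
  define rep where "rep A = (SOME x. x \<in> carrier G \<and> A = N #> x)" for A
  have rep: "rep A \<in> carrier G" "A = N #> rep A" if "A \<in> carrier (G Mod N)" for A
  proof -
    have "\<exists>x. x \<in> carrier G \<and> A = N #> x" using that unfolding carrier_FactGroup by blast
    then have *: "rep A \<in> carrier G \<and> A = N #> rep A" unfolding rep_def by (rule someI_ex)
    show "rep A \<in> carrier G" using * by (rule conjunct1)
    show "A = N #> rep A" using * by (rule conjunct2)
  qed
  define f g where "f A = \<phi> (rep A)" and "g A = \<psi> (rep A)" for A
  have fg: "f (N #> x) = \<phi> x" "g (N #> x) = \<psi> x" if x: "x \<in> carrier G" for x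
  proof -
    have c: "N #> x \<in> carrier (G Mod N)" using x by (auto simp: carrier_FactGroup)
    define r where "r = rep (N #> x)"
    have r: "r \<in> carrier G" using rep(1)[OF c] by (simp add: r_def)
    have eq: "N #> x = N #> r" unfolding r_def by (rule rep(2)[OF c])
    have "x \<in> N #> r" using rcos_self[OF x N.is_subgroup] by (simp only: eq)
    then obtain n where "n \<in> N" and x_eq: "x = n \<otimes> r" unfolding r_coset_def by blast
    have n: "n \<in> carrier G" "\<phi> n = 0" "\<psi> n = 0" using \<open>n \<in> N\<close> ker by blast+
    have "\<phi> x = \<phi> r" "\<psi> x = \<psi> r"
      unfolding x_eq using n r by (simp_all add: add_hom_mult[OF \<phi>] add_hom_mult[OF \<psi>])
    then show "f (N #> x) = \<phi> x" "g (N #> x) = \<psi> x" by (simp_all add: f_def g_def r_def)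
  qed
  define lt where "lt A B \<longleftrightarrow> f A < f B \<or> f A = f B \<and> g A < g B" for A B
  have mult: "f (A <#> B) = f A + f B" "g (A <#> B) = g A + g B"
    if AB: "A \<in> carrier (G Mod N)" "B \<in> carrier (G Mod N)" for A B
  proof -
    obtain x y where xy: "x \<in> carrier G" "y \<in> carrier G" "A = N #> x" "B = N #> y"
      using AB unfolding carrier_FactGroup by blast
    have eq: "A <#> B = N #> (x \<otimes> y)" unfolding xy(3,4) using xy(1,2) by (rule N.rcos_sum)
    show "f (A <#> B) = f A + f B"
      unfolding eq unfolding xy(3,4) fg[OF xy(1)] fg[OF xy(2)] fg[OF m_closed[OF xy(1,2)]]
      using xy(1,2) by (rule add_hom_mult[OF \<phi>])
    show "g (A <#> B) = g A + g B"
      unfolding eq unfolding xy(3,4) fg[OF xy(1)] fg[OF xy(2)] fg[OF m_closed[OF xy(1,2)]]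
      using xy(1,2) by (rule add_hom_mult[OF \<psi>])
  qed
  have inj: "A = B" if AB: "A \<in> carrier (G Mod N)" "B \<in> carrier (G Mod N)" "f A = f B" "g A = g B" for A B
  proof -
    obtain x y where xy: "x \<in> carrier G" "y \<in> carrier G" "A = N #> x" "B = N #> y"
      using AB(1,2) unfolding carrier_FactGroup by blast
    have "\<phi> x = \<phi> y" "\<psi> x = \<psi> y"
      using AB(3,4) unfolding xy(3,4) fg[OF xy(1)] fg[OF xy(2)] by blast+
    then have n: "x \<otimes> inv y \<in> N" unfolding ker using xy(1,2)
      by (simp add: add_hom_mult[OF \<phi>] add_hom_mult[OF \<psi>] add_hom_inv[OF \<phi>] add_hom_inv[OF \<psi>])
    have "x = x \<otimes> inv y \<otimes> y" using xy(1,2) by (simp add: m_assoc)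
    then have "x \<in> N #> y" using n unfolding r_coset_def by blast
    then show ?thesis unfolding xy(3,4) using repr_independence[OF _ xy(2) N.is_subgroup] by blast
  qed
  have "bi_order (G Mod N) lt"
    unfolding bi_order_def left_order_def
  proof (intro conjI ballI impI)
    show "lt A B \<or> lt B A" if "A \<in> carrier (G Mod N)" "B \<in> carrier (G Mod N)" "A \<noteq> B" for A B
      using inj[OF that(1,2)] that(3) unfolding lt_def by linarith
  qed (auto simp: lt_def mult)
  then show ?thesis by (auto simp: bi_orderable_def)
qed

text \<open>Two consecutive infinite cyclic factors \<open>G/K\<close> and \<open>K/N\<close>, where \<open>K\<close> is the kernel of \<open>\<phi>\<close>
  and \<open>N\<close> that of \<open>\<psi>\<close>.\<close>

locale two_step = group G for G (structure) +
  fixes \<phi> :: "'a \<Rightarrow> int" and t and \<psi> :: "'a \<Rightarrow> int" and s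
  assumes \<phi>: "add_hom G \<phi>" and t: "t \<in> carrier G" "\<phi> t = 1"
    and \<psi>: "add_hom (G\<lparr>carrier := add_ker G \<phi>\<rparr>) \<psi>" and s: "s \<in> add_ker G \<phi>" "\<psi> s = 1"
    and ker_invariant: "\<And>c x. c \<in> carrier G \<Longrightarrow> x \<in> add_ker G \<phi> \<Longrightarrow> \<psi> x = 0 \<Longrightarrow> \<psi> (c \<otimes> x \<otimes> inv c) = 0"
begin

abbreviation "K \<equiv> add_ker G \<phi>"

lemma K: "subgroup K G"
  using add_ker_subgroup[OF \<phi>] .

lemma K_carrier: "x \<in> K \<Longrightarrow> x \<in> carrier G"
  by (simp add: add_ker_def)

lemma K_conj: "c \<in> carrier G \<Longrightarrow> x \<in> K \<Longrightarrow> c \<otimes> x \<otimes> inv c \<in> K"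
  by (simp add: add_ker_def add_hom_mult[OF \<phi>] add_hom_inv[OF \<phi>])

lemma K_mult: "x \<in> K \<Longrightarrow> y \<in> K \<Longrightarrow> x \<otimes> y \<in> K"
  using subgroup.m_closed[OF K] .

lemma K_inv: "x \<in> K \<Longrightarrow> inv x \<in> K"
  using subgroup.m_inv_closed[OF K] .

lemma psi_mult: "x \<in> K \<Longrightarrow> y \<in> K \<Longrightarrow> \<psi> (x \<otimes> y) = \<psi> x + \<psi> y"
  using add_hom_mult[OF \<psi>] by simp

lemma psi_one: "\<psi> \<one> = 0"
  using psi_mult[of \<one> \<one>] subgroup.one_closed[OF K] by simp

lemma psi_inv: "x \<in> K \<Longrightarrow> \<psi> (inv x) = - \<psi> x"
  using psi_mult[of x "inv x"] psi_one K_inv K_carrier by simp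

lemma K_pow: "x \<in> K \<Longrightarrow> x [^] (k::int) \<in> K"
  using subgroup_int_pow_closed[OF K] .

lemma psi_pow:
  assumes "x \<in> K"
  shows "\<psi> (x [^] (k::int)) = k * \<psi> x"
proof -
  interpret K: group "G\<lparr>carrier := K\<rparr>" using subgroup_imp_group[OF K] .
  show ?thesis using K.add_hom_int_pow[OF \<psi>, of x k] int_pow_consistent[OF K assms] assms by simp
qed

lemma conj_mult:
  assumes "c \<in> carrier G" "x \<in> carrier G" "y \<in> carrier G"
  shows "c \<otimes> (x \<otimes> y) \<otimes> inv c = (c \<otimes> x \<otimes> inv c) \<otimes> (c \<otimes> y \<otimes> inv c)"
  using assms by (simp add: m_assoc)

text \<open>Modulo the kernel of \<psi>, which is invariant, \<open>K\<close> is infinite cyclic and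
  generated by \<open>s\<close>. So conjugation by \<open>c\<close> multiplies by an integer, read
  off at \<open>s\<close>.\<close>

lemma psi_conj:
  assumes c: "c \<in> carrier G" and x: "x \<in> K"
  shows "\<psi> (c \<otimes> x \<otimes> inv c) = \<psi> x * \<psi> (c \<otimes> s \<otimes> inv c)"
proof -
  define z where "z = x \<otimes> s [^] (- \<psi> x)"
  have z: "z \<in> K" "\<psi> z = 0" using x K_mult K_pow s by (simp_all add: z_def psi_mult psi_pow)
  have x': "x = z \<otimes> s [^] \<psi> x" using x s K_carrier by (simp add: z_def m_assoc int_pow_neg)
  have sp: "c \<otimes> s [^] k \<otimes> inv c = (c \<otimes> s \<otimes> inv c) [^] k" for k :: int
  proof -
    have nat: "c \<otimes> u [^] n \<otimes> inv c = (c \<otimes> u \<otimes> inv c) [^] n" if u: "u \<in> carrier G" for u and n :: nat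
    proof (induction n)
      case (Suc n)
      have "c \<otimes> u [^] Suc n \<otimes> inv c = (c \<otimes> u [^] n \<otimes> inv c) \<otimes> (c \<otimes> u \<otimes> inv c)"
        using conj_mult[OF c, of "u [^] n" u] u by simp
      then show ?case using Suc by simp
    qed (use c in simp)
    have sc: "s \<in> carrier G" using s K_carrier by blast
    show ?thesis
    proof (cases k rule: int_cases2)
      case (nonneg n)
      then show ?thesis using nat[OF sc] by (simp add: int_pow_int)
    next
      case (nonpos n)
      have "inv (c \<otimes> s \<otimes> inv c) = c \<otimes> inv s \<otimes> inv c" using c sc by (simp add: inv_mult_group m_assoc)
      then have "(c \<otimes> s \<otimes> inv c) [^] k = (c \<otimes> inv s \<otimes> inv c) [^] n"
        using c sc nonpos nat_pow_inv[of "c \<otimes> s \<otimes> inv c" n] by (simp add: int_pow_neg_int)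
      also have "\<dots> = c \<otimes> s [^] k \<otimes> inv c"
        using c sc nonpos nat[of "inv s" n] by (simp add: int_pow_neg_int nat_pow_inv)
      finally show ?thesis by simp
    qed
  qed
  have "\<psi> (c \<otimes> x \<otimes> inv c) = \<psi> ((c \<otimes> z \<otimes> inv c) \<otimes> (c \<otimes> s [^] \<psi> x \<otimes> inv c))"
    using conj_mult[OF c, of z "s [^] \<psi> x"] x' z s K_carrier K_pow by simp
  also have "\<dots> = \<psi> (c \<otimes> z \<otimes> inv c) + \<psi> (c \<otimes> s [^] \<psi> x \<otimes> inv c)"
    using K_conj[OF c] z s K_pow by (intro psi_mult) auto
  also have "\<dots> = \<psi> x * \<psi> (c \<otimes> s \<otimes> inv c)"
    using ker_invariant[OF c z] K_conj[OF c s(1)] by (simp add: sp psi_pow)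
  finally show ?thesis .
qed

text \<open>The integers belonging to \<open>t\<close> and to \<open>inv t\<close> have product
  1.\<close>

lemma conj_sign: "\<psi> (t \<otimes> s \<otimes> inv t) = 1 \<or> \<psi> (t \<otimes> s \<otimes> inv t) = -1"
proof -
  have "t \<otimes> (inv t \<otimes> s \<otimes> inv (inv t)) \<otimes> inv t = s" using t s K_carrier by (simp add: m_assoc)
  then have "\<psi> (inv t \<otimes> s \<otimes> inv (inv t)) * \<psi> (t \<otimes> s \<otimes> inv t) = 1"
    using psi_conj[OF t(1) K_conj[OF _ s(1)], of "inv t"] t s by simp
  then show ?thesis by (metis abs_zmult_eq_1 abs_eq_iff mult.commute abs_one)
qed

text \<open>If \<open>t\<close> acts trivially on the second factor, then \<psi> extends to
  \<open>G\<close> by first removing the power of \<open>t\<close> from \<open>g\<close>.\<close>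

lemma split_hom:
  assumes "\<psi> (t \<otimes> s \<otimes> inv t) = 1"
  shows "\<exists>\<Psi>. add_hom G \<Psi> \<and> \<Psi> t = 0 \<and> (\<forall>x\<in>K. \<Psi> x = \<psi> x)"
proof -
  have inv1: "\<psi> (t \<otimes> x \<otimes> inv t) = \<psi> x" if "x \<in> K" for x using psi_conj[OF t(1) that] assms by simp
  have tc: "t [^] k \<in> carrier G" for k :: int using t by simp
  have nat: "\<psi> (t [^] n \<otimes> x \<otimes> inv (t [^] n)) = \<psi> x" if "x \<in> K" for x and n :: nat
  proof (induction n)
    case 0
    then show ?case using that K_carrier by simp
  next
    case (Suc n)
    have "t [^] Suc n = t \<otimes> t [^] n" using t nat_pow_Suc2 by simp
    then have "t [^] Suc n \<otimes> x \<otimes> inv (t [^] Suc n) = t \<otimes> (t [^] n \<otimes> x \<otimes> inv (t [^] n)) \<otimes> inv t"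
      using t that K_carrier by (simp add: inv_mult_group m_assoc)
    then show ?case using inv1[OF K_conj[OF _ that], of "t [^] n"] t Suc by simp
  qed
  have int: "\<psi> (t [^] k \<otimes> x \<otimes> inv (t [^] k)) = \<psi> x" if x: "x \<in> K" for x and k :: int
  proof (cases k rule: int_cases2)
    case (nonneg n)
    then show ?thesis using nat[OF x] by (simp add: int_pow_int)
  next
    case (nonpos n)
    define w where "w = t [^] n"
    have w: "w \<in> carrier G" using t by (simp add: w_def)
    have k: "t [^] k = inv w" using nonpos t by (simp add: w_def int_pow_neg_int)
    have "w \<otimes> (inv w \<otimes> x \<otimes> inv (inv w)) \<otimes> inv w = x" using w x K_carrier by (simp add: m_assoc)
    then show ?thesis using nat[OF K_conj[OF _ x], of "inv w" n] w by (simp add: k w_def[symmetric])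
  qed
  define h where "h g = g \<otimes> t [^] (- \<phi> g)" for g
  have h: "h g \<in> K" if "g \<in> carrier G" for g
    using that t by (simp add: h_def add_ker_def add_hom_mult[OF \<phi>] add_hom_int_pow[OF \<phi>])
  have "add_hom G (\<lambda>g. \<psi> (h g))" unfolding add_hom_def
  proof (intro ballI)
    fix x y assume xy: "x \<in> carrier G" "y \<in> carrier G"
    have "h (x \<otimes> y) = x \<otimes> y \<otimes> (t [^] (- \<phi> y) \<otimes> t [^] (- \<phi> x))"
      using xy t by (simp add: h_def add_hom_mult[OF \<phi>] int_pow_mult[symmetric] algebra_simps)
    also have "\<dots> = h x \<otimes> (t [^] \<phi> x \<otimes> h y \<otimes> inv (t [^] \<phi> x))"
      using xy t by (simp add: h_def m_assoc int_pow_neg)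
    finally show "\<psi> (h (x \<otimes> y)) = \<psi> (h x) + \<psi> (h y)"
      using psi_mult[OF h[OF xy(1)] K_conj[OF tc h[OF xy(2)]]] int[OF h[OF xy(2)]] by simp
  qed
  moreover have "\<psi> (h t) = 0" using t psi_one by (simp add: h_def int_pow_neg)
  moreover have "\<psi> (h x) = \<psi> x" if "x \<in> K" for x using that by (simp add: h_def add_ker_def)
  ultimately show ?thesis by blast
qed

text \<open>The quotient is the Klein bottle group: \<open>t\<close> conjugates \<open>s\<close> to
  its inverse modulo \<open>N\<close>.\<close>

lemma not_bi_orderable_of_sign:
  assumes sign: "\<psi> (t \<otimes> s \<otimes> inv t) = -1" and N: "N \<lhd> G" "N = add_ker (G\<lparr>carrier := K\<rparr>) \<psi>"
  shows "\<not> bi_orderable (G Mod N)"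
proof
  assume "bi_orderable (G Mod N)"
  then obtain lt where lt: "bi_order (G Mod N) lt" by (auto simp: bi_orderable_def)
  interpret N: normal N G by (rule N)
  interpret Q: group "G Mod N" by (rule N.factorgroup_is_group)
  have mem: "x \<in> N \<longleftrightarrow> x \<in> K \<and> \<psi> x = 0" for x
    using N(2) unfolding add_ker_def[of "G\<lparr>carrier := K\<rparr>"] by auto
  have sc: "s \<in> carrier G" using s K_carrier by blast
  have c: "N #> s \<in> carrier (G Mod N)" "N #> t \<in> carrier (G Mod N)"
    using sc t by (auto simp: carrier_FactGroup)
  have "\<psi> (t \<otimes> s \<otimes> inv t \<otimes> s) = 0" using psi_mult[OF K_conj[OF t(1) s(1)] s(1)] sign s by simp
  then have "t \<otimes> s \<otimes> inv t \<otimes> s \<in> N" using K_mult[OF K_conj[OF t(1) s(1)] s(1)] mem by simp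
  then have "N #> (t \<otimes> s) = N #> (inv s \<otimes> t)"
  proof -
    assume n: "t \<otimes> s \<otimes> inv t \<otimes> s \<in> N"
    have "t \<otimes> s = (t \<otimes> s \<otimes> inv t \<otimes> s) \<otimes> (inv s \<otimes> t)" using sc t by (simp add: m_assoc)
    then have "t \<otimes> s \<in> N #> (inv s \<otimes> t)" using n by (auto simp: r_coset_def)
    then show ?thesis using repr_independence[OF _ _ N.is_subgroup] sc t by (metis inv_closed m_closed)
  qed
  then have "(N #> t) <#> (N #> s) = (inv\<^bsub>G Mod N\<^esub> (N #> s)) <#> (N #> t)"
    using sc t N.inv_FactGroup[OF c(1)] by (simp add: N.rcos_sum N.rcos_inv)
  then have "N #> s = N" using Q.bi_order_conj_inv_imp_one[OF lt c] by simp
  then have "s \<in> N" using rcos_self[OF sc N.is_subgroup] by simp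
  then show False using mem s by simp
qed

lemma sign_of_not_bi_orderable:
  assumes N: "N \<lhd> G" "N = add_ker (G\<lparr>carrier := K\<rparr>) \<psi>" and "\<not> bi_orderable (G Mod N)"
  shows "\<psi> (t \<otimes> s \<otimes> inv t) = -1"
proof (rule ccontr)
  assume "\<psi> (t \<otimes> s \<otimes> inv t) \<noteq> -1"
  then obtain \<Psi> where \<Psi>: "add_hom G \<Psi>" "\<forall>x\<in>K. \<Psi> x = \<psi> x" using split_hom conj_sign by blast
  then have "N = {x \<in> carrier G. \<phi> x = 0 \<and> \<Psi> x = 0}" by (auto simp: N(2) add_ker_def)
  then show False using bi_orderable_Mod_of_homs[OF \<phi> \<Psi>(1) N(1)] assms(3) by blast
qed

text \<open>If \<psi> is positive on \<open>h\<close>, the product of positive elements is positive.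
  If it is negative, \<open>t\<close> is moved to the right of \<open>h\<close>: the conjugate of
  \<open>h\<close> by \<open>t\<close> has positive \<psi>.\<close>

lemma coset_in_cone:
  assumes P: "positive_cone G P" and tP: "t \<in> P" and K_pos: "\<And>x. x \<in> K \<Longrightarrow> \<psi> x > 0 \<Longrightarrow> x \<in> P"
    and sign: "\<psi> (t \<otimes> s \<otimes> inv t) = -1" and h: "h \<in> K"
  shows "t \<otimes> h \<in> P"
proof -
  note P = positive_coneD[OF P]
  have *: "u \<otimes> x \<in> P" if u: "u \<in> P" "\<And>x. x \<in> K \<Longrightarrow> \<psi> (u \<otimes> x \<otimes> inv u) = - \<psi> x" and x: "x \<in> K" "\<psi> x \<noteq> 0" for u x
  proof (cases "\<psi> x > 0")
    case True
    then show ?thesis using P(2)[OF u(1)] K_pos x by blast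
  next
    case False
    have uc: "u \<in> carrier G" using u(1) P(1) by blast
    have "\<psi> (u \<otimes> x \<otimes> inv u) > 0" using u(2)[OF x(1)] x(2) False by simp
    then have "u \<otimes> x \<otimes> inv u \<in> P" using K_pos K_conj uc x(1) by blast
    then have "u \<otimes> x \<otimes> inv u \<otimes> u \<in> P" using u(1) P(2) by blast
    then show ?thesis using uc x(1) K_carrier by (simp add: m_assoc)
  qed
  have tconj: "\<psi> (t \<otimes> x \<otimes> inv t) = - \<psi> x" if "x \<in> K" for x using psi_conj[OF t(1) that] sign by simp
  show ?thesis
  proof (cases "\<psi> h = 0")
    case False
    then show ?thesis using *[OF tP tconj h] by blast
  next
    case True
    \<comment> \<open>With \<psi> zero on \<open>h\<close> neither argument decides. The product
      \<open>t \<otimes> w\<close> is positive and inverts the factor just as \<open>t\<close> does,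
      so the argument applies again to \<open>t \<otimes> w\<close> and
      \<open>inv s\<close>.\<close>
    define w where "w = h \<otimes> s"
    have w: "w \<in> K" "\<psi> w = 1" using h s True K_mult by (simp_all add: w_def psi_mult)
    have wc: "w \<in> carrier G" using w K_carrier by blast
    have "t \<otimes> w \<in> P" using *[OF tP tconj w(1)] w(2) by simp
    moreover have "\<psi> ((t \<otimes> w) \<otimes> x \<otimes> inv (t \<otimes> w)) = - \<psi> x" if x: "x \<in> K" for x
    proof -
      have "(t \<otimes> w) \<otimes> x \<otimes> inv (t \<otimes> w) = t \<otimes> (w \<otimes> x \<otimes> inv w) \<otimes> inv t"
        using t wc x K_carrier by (simp add: m_assoc inv_mult_group)
      then show ?thesis using tconj[OF K_conj[OF wc x]] psi_mult w x K_mult K_inv psi_inv by simp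
    qed
    ultimately have "t \<otimes> w \<otimes> inv s \<in> P" using * K_inv[OF s(1)] psi_inv[OF s(1)] s(2) by simp
    then show ?thesis using t h s K_carrier by (simp add: w_def m_assoc)
  qed
qed

end

section \<open>The Tararin series\<close>

text \<open>The elements of positive height are the products of \<open>t\<close> and of kernel
  elements in which \<open>t\<close> occurs at least once; finitely many generators of the kernel
  suffice as labels.\<close>

lemma (in group) rational_lex:
  fixes \<phi> :: "'a \<Rightarrow> int"
  assumes \<phi>: "add_hom G \<phi>" and t: "t \<in> carrier G" "\<phi> t = 1"
    and S: "finite S" "S \<subseteq> add_ker G \<phi>" "generate G S = add_ker G \<phi>"
    and Q: "rational (G\<lparr>carrier := add_ker G \<phi>\<rparr>) Q"
  shows "rational G ({x \<in> carrier G. \<phi> x > 0} \<union> Q)"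
proof -
  obtain E :: "(nat \<times> 'a \<times> nat) set" and I F where fin: "finite E" "finite I" "finite F"
    and E: "\<forall>(p, x, q)\<in>E. x \<in> add_ker G \<phi>" and QE: "Q = {g. \<exists>p\<in>I. \<exists>q\<in>F. gpath G E p g q}"
    using Q unfolding rational_def by auto
  define A where "A = S \<union> m_inv G ` S"
  have A: "finite A" "A \<subseteq> add_ker G \<phi>"
    using S subgroup.m_inv_closed[OF add_ker_subgroup[OF \<phi>]] by (auto simp: A_def)
  have Ac: "A \<subseteq> carrier G" using A(2) by (auto simp: add_ker_def)
  \<comment> \<open>Old vertices are shifted by 2. The edge from 0 to 1 enforces one
    \<open>t\<close>, and the loops at 1 allow further letters \<open>t\<close> and generators of
    the kernel with their inverses.\<close>
  define E2 where "E2 = (\<lambda>(p, x, q). (p + 2, x, q + 2)) ` E \<union> {(0, t, 1), (1, t, 1)} \<union> (\<lambda>x. (1, x, 1)) ` A"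
  have closed: "x \<in> carrier G" if "(p, x, q) \<in> E2" for p x q
    using that E t Ac by (auto simp: E2_def add_ker_def)
  have old1: "gpath G E2 (p + 2) g (q + 2)" if "gpath G E p g q" for p g q
    using that
  proof induction
    case (step p x r g q)
    then have "(p + 2, x, r + 2) \<in> E2" by (force simp: E2_def)
    then show ?case using step.IH by (rule gpath.step)
  qed (rule gpath.nil)
  have old2: "\<exists>q. q' = q + 2 \<and> gpath G E p g q" if "gpath G E2 p' g q'" "p' = p + 2" for p' p g q'
    using that
  proof (induction arbitrary: p)
    case (step p' x r' g q')
    then obtain r where r: "r' = r + 2" "(p, x, r) \<in> E" by (auto simp: E2_def)
    with step.IH[of r] show ?case by (auto intro: gpath.step)
  qed (auto intro: gpath.nil)
  have new1: "q' = 1 \<and> \<phi> g \<ge> 0" if "gpath G E2 p' g q'" "p' = 1" for p' g q'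
    using that
  proof induction
    case (step p' x r' g q')
    then have "r' = 1" "\<phi> x \<ge> 0" "x \<in> carrier G" using t A(2) closed by (auto simp: E2_def add_ker_def)
    moreover have "g \<in> carrier G" using gpath_closed[OF step.hyps(2) closed] .
    ultimately show ?case using step.IH by (simp add: add_hom_mult[OF \<phi>])
  qed (simp add: add_hom_one[OF \<phi>])
  have new0: "\<phi> g > 0" if "gpath G E2 0 g 1" for g
    using that
  proof cases
    case (step x r' h)
    then have "r' = 1" "x = t" by (auto simp: E2_def)
    moreover have "h \<in> carrier G" using gpath_closed[OF step(3) closed] .
    ultimately show ?thesis using step new1[of 1 h 1] t by (simp add: add_hom_mult[OF \<phi>])
  qed simp
  have loop: "gpath G E2 1 x 1" if "x \<in> insert t A" for x
  proof -
    have "(1, x, 1) \<in> E2" using that by (auto simp: E2_def)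
    then have "gpath G E2 1 (x \<otimes> \<one>) 1" using gpath.step[OF _ gpath.nil] by metis
    moreover have "x \<in> carrier G" using that t Ac by auto
    ultimately show ?thesis by simp
  qed
  have genl: "gpath G E2 1 g 1" if "g \<in> generate G S" for g
    using that
  proof induction
    case one
    show ?case by (rule gpath.nil)
  next
    case (incl h)
    then show ?case by (intro loop) (simp add: A_def)
  next
    case (inv h)
    then show ?case by (intro loop) (simp add: A_def)
  next
    case (eng g h)
    show ?case using gpath_append[OF eng.IH closed] .
  qed
  have tn: "gpath G E2 1 (t [^] n) 1" for n :: nat
  proof (induction n)
    case (Suc n)
    have "gpath G E2 1 (t [^] n \<otimes> t) 1" by (rule gpath_append[OF Suc loop closed]) auto
    then show ?case by simp
  qed (auto intro: gpath.nil)
  have pos: "gpath G E2 0 g 1" if g: "g \<in> carrier G" "\<phi> g > 0" for g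
  proof -
    \<comment> \<open>One factor \<open>t\<close> is spent on the edge from 0 to 1, the other
      \<open>n\<close> on loops; the rest \<open>h\<close> has height zero.\<close>
    define n where "n = nat (\<phi> g - 1)"
    define h where "h = inv (t [^] n) \<otimes> (inv t \<otimes> g)"
    have "\<phi> h = 0" using g t by (simp add: h_def n_def add_hom_mult[OF \<phi>] add_hom_inv[OF \<phi>]
        add_hom_nat_pow[OF \<phi>] add_hom_int_pow[OF \<phi>])
    moreover have "h \<in> carrier G" using g t by (simp add: h_def)
    ultimately have "gpath G E2 1 h 1" using genl S(3) by (simp add: add_ker_def)
    then have "gpath G E2 1 (t [^] n \<otimes> h) 1" using gpath_append[OF tn _ closed] by simp
    moreover have "(0, t, 1) \<in> E2" by (simp add: E2_def)
    ultimately have "gpath G E2 0 (t \<otimes> (t [^] n \<otimes> h)) 1" using gpath.step by metis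
    then show ?thesis using g t by (simp add: h_def)
  qed
  show ?thesis
  proof (rule rationalI)
    show "finite E2" "finite (insert 0 ((\<lambda>p. p + 2) ` I))" "finite (insert 1 ((\<lambda>p. p + 2) ` F))"
      using fin A by (auto simp: E2_def)
    show "x \<in> carrier G" if "(p, x, q) \<in> E2" for p x q using closed that .
    show "{x \<in> carrier G. \<phi> x > 0} \<union> Q =
        {g. \<exists>p\<in>insert 0 ((\<lambda>p. p + 2) ` I). \<exists>q\<in>insert 1 ((\<lambda>p. p + 2) ` F). gpath G E2 p g q}" (is "_ = ?R")
    proof (intro equalityI subsetI)
      fix g assume "g \<in> {x \<in> carrier G. \<phi> x > 0} \<union> Q"
      then show "g \<in> ?R" using pos old1 QE by blast
    next
      fix g assume "g \<in> ?R"
      then obtain p q where pq: "p = 0 \<or> (\<exists>p'\<in>I. p = p' + 2)" "q = 1 \<or> (\<exists>q'\<in>F. q = q' + 2)" "gpath G E2 p g q"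
        by blast
      have gc: "g \<in> carrier G" using gpath_closed[OF pq(3) closed] .
      have zero: "q = 1" if "p = 0"
        using pq(3)
      proof cases
        case nil
        then show ?thesis using that pq(2) by auto
      next
        case (step x r h)
        then have "r = 1" using that by (auto simp: E2_def)
        then show ?thesis using new1 step(3) by blast
      qed
      show "g \<in> {x \<in> carrier G. \<phi> x > 0} \<union> Q"
      proof (cases "p = 0")
        case True
        then show ?thesis using new0 zero pq(3) gc by simp
      next
        case False
        then obtain p' where p': "p' \<in> I" "p = p' + 2" using pq(1) by blast
        from old2[OF pq(3) p'(2)] obtain q' where q': "q = q' + 2" "gpath G E p' g q'" by blast
        then show ?thesis using p' pq(2) QE by auto
      qed
    qed
  qed
qed

lemma (in group) rational_of_positive_half:
  fixes \<phi> :: "'a \<Rightarrow> int"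
  assumes \<phi>: "add_hom G \<phi>" and t: "t \<in> carrier G" "\<phi> t = 1"
    and S: "finite S" "S \<subseteq> add_ker G \<phi>" "generate G S = add_ker G \<phi>"
    and P: "positive_cone G P" "{x \<in> carrier G. \<phi> x > 0} \<subseteq> P"
    and Q: "rational (G\<lparr>carrier := add_ker G \<phi>\<rparr>) (P \<inter> add_ker G \<phi>)"
  shows "rational G P"
proof -
  note cone = positive_coneD[OF P(1)]
  have "\<phi> x \<ge> 0" if x: "x \<in> P" for x
  proof (rule ccontr)
    assume "\<not> \<phi> x \<ge> 0"
    moreover have xc: "x \<in> carrier G" using x cone(1) by blast
    ultimately have "inv x \<in> {x \<in> carrier G. \<phi> x > 0}" using add_hom_inv[OF \<phi> xc] by simp
    then have "inv x \<in> P" using P(2) by blast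
    then show False using cone(5)[OF x] by blast
  qed
  then have "\<phi> x > 0 \<or> \<phi> x = 0" if "x \<in> P" for x using that by (simp add: less_le)
  then have "P \<subseteq> {x \<in> carrier G. \<phi> x > 0} \<union> (P \<inter> add_ker G \<phi>)"
    using cone(1) unfolding add_ker_def by blast
  then have "P = {x \<in> carrier G. \<phi> x > 0} \<union> (P \<inter> add_ker G \<phi>)" using P(2) by blast
  then show ?thesis using rational_lex[OF \<phi> t S Q] by simp
qed

lemma (in group) positive_half_of_coset:
  fixes \<phi> :: "'a \<Rightarrow> int"
  assumes \<phi>: "add_hom G \<phi>" and t: "t \<in> P" "\<phi> t = 1" and P: "positive_cone G P"
    and coset: "\<And>h. h \<in> add_ker G \<phi> \<Longrightarrow> t \<otimes> h \<in> P"
  shows "{x \<in> carrier G. \<phi> x > 0} \<subseteq> P"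
proof clarify
  note cone = positive_coneD[OF P]
  fix g assume g: "g \<in> carrier G" "\<phi> g > 0"
  have tc: "t \<in> carrier G" using t cone(1) by blast
  \<comment> \<open>Chosen such that \<open>g\<close> is
    \<open>t [^] n \<otimes> (t \<otimes> h)\<close> with \<open>h\<close> of height zero.\<close>
  define n where "n = nat (\<phi> g - 1)"
  define h where "h = inv t \<otimes> (inv (t [^] n) \<otimes> g)"
  have "\<phi> h = 0" using g t tc by (simp add: h_def n_def add_hom_mult[OF \<phi>] add_hom_inv[OF \<phi>]
        add_hom_nat_pow[OF \<phi>] add_hom_int_pow[OF \<phi>])
  then have th: "t \<otimes> h \<in> P" using g tc by (intro coset) (simp add: h_def add_ker_def)
  have "t [^] k \<otimes> (t \<otimes> h) \<in> P" for k :: nat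
  proof (induction k)
    case 0
    then show ?case using th cone(1) by auto
  next
    case (Suc k)
    have "t \<otimes> (t [^] k \<otimes> (t \<otimes> h)) \<in> P" using cone(2)[OF t(1) Suc] .
    moreover have "t [^] Suc k = t \<otimes> t [^] k" using tc nat_pow_Suc2 by simp
    ultimately show ?case using tc g by (simp add: h_def m_assoc)
  qed
  then have "t [^] n \<otimes> (t \<otimes> h) \<in> P" .
  then show "g \<in> P" using tc g by (simp add: h_def)
qed

section \<open>From a Tararin series to rational cones\<close>

lemma add_hom_uminus: "add_hom G \<phi> \<Longrightarrow> add_hom G (\<lambda>x. - \<phi> x)"
  by (simp add: add_hom_def)

lemma add_ker_uminus: "add_ker G (\<lambda>x. - \<phi> x) = add_ker G \<phi>"
  by (simp add: add_ker_def)

lemma tararin_series_tl: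
  assumes "tararin_series G (H # H' # L)"
  shows "tararin_series (G\<lparr>carrier := H'\<rparr>) (H' # L)"
proof -
  note T = assms[unfolded tararin_series_def subnormal_series_def series_factor_def]
  have 1: "\<And>i. Suc i < length (H # H' # L) \<Longrightarrow> (H # H' # L) ! Suc i \<lhd> G\<lparr>carrier := (H # H' # L) ! i\<rparr>"
    and 2: "\<And>i. Suc i < length (H # H' # L) \<Longrightarrow>
       tf_abelian_rank1 (G\<lparr>carrier := (H # H' # L) ! i\<rparr> Mod ((H # H' # L) ! Suc i))"
    and 3: "\<And>i. Suc (Suc i) < length (H # H' # L) \<Longrightarrow>
       (H # H' # L) ! Suc (Suc i) \<lhd> G\<lparr>carrier := (H # H' # L) ! i\<rparr> \<and>
       \<not> bi_orderable (G\<lparr>carrier := (H # H' # L) ! i\<rparr> Mod ((H # H' # L) ! Suc (Suc i)))"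
    and 4: "last (H # H' # L) = {\<one>\<^bsub>G\<^esub>}"
    using T by blast+
  show ?thesis unfolding tararin_series_def subnormal_series_def series_factor_def
    using 1[of "Suc _"] 2[of "Suc _"] 3[of "Suc _"] 4 by auto
qed

text \<open>The second claim is what drives the induction: knowing that one half of
  \<open>H'\<close> lies in \<open>P\<close> is the input for deciding the sign of all of the coset
  of \<open>t\<close>. It allows either sign because \<phi> is determined only up to sign by its
  kernel.\<close>

lemma tararin_all_cones:
  assumes "group G" "tararin_series G Hs"
    and "\<And>H. H \<in> set Hs \<Longrightarrow> \<exists>S. finite S \<and> S \<subseteq> H \<and> generate G S = H"
  shows "(\<forall>P. positive_cone G P \<longrightarrow> rational G P) \<and>
    (\<forall>(\<phi> :: 'a \<Rightarrow> int) t P. add_hom G \<phi> \<longrightarrow> t \<in> carrier G \<longrightarrow> \<phi> t = 1 \<longrightarrow> 1 < length Hs \<longrightarrow>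
      Hs ! 1 = add_ker G \<phi> \<longrightarrow> positive_cone G P \<longrightarrow>
      {x \<in> carrier G. \<phi> x > 0} \<subseteq> P \<or> {x \<in> carrier G. \<phi> x < 0} \<subseteq> P)"
  using assms
proof (induction Hs arbitrary: G rule: induct_list012)
  case 1
  then show ?case by (simp add: tararin_series_def subnormal_series_def)
next
  case (2 H G)
  then have "hd [H] = carrier G" "last [H] = {\<one>\<^bsub>G\<^esub>}"
    unfolding tararin_series_def subnormal_series_def by blast+
  then have "carrier G = {\<one>\<^bsub>G\<^esub>}" by simp
  then have "P = {}" if "positive_cone G P" for P using that by (auto simp: positive_cone_def)
  moreover have "rational G {}" unfolding rational_def
    by (intro exI[of _ "{}"]) auto
  ultimately show ?case by auto
next
  case (3 H H' L G)
  interpret group G by (rule "3.prems"(1))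
  note T = "3.prems"(2)
  have HG: "H = carrier G" using T by (simp add: tararin_series_def subnormal_series_def)
  have N: "H' \<lhd> G" "tf_abelian_rank1 (G Mod H')"
    using T unfolding tararin_series_def subnormal_series_def series_factor_def
    by (auto simp: HG dest!: spec[of _ 0])
  have H'G: "subgroup H' G" using normal_imp_subgroup[OF N(1)] .
  let ?G1 = "G\<lparr>carrier := H'\<rparr>"
  interpret G1: group ?G1 using subgroup_imp_group[OF H'G] .
  have T1: "tararin_series ?G1 (H' # L)" using tararin_series_tl[OF T] .
  have fg1: "\<exists>S. finite S \<and> S \<subseteq> K \<and> generate ?G1 S = K" if K: "K \<in> set (H' # L)" for K
  proof -
    obtain S where S: "finite S" "S \<subseteq> K" "generate G S = K" using "3.prems"(3)[of K] K by auto
    obtain i where "i < length (H' # L)" "K = (H' # L) ! i" using K by (metis in_set_conv_nth)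
    then have "K \<subseteq> H'" using G1.subnormal_series_subgroup[of "H' # L" i] T1 subgroup.subset
      by (fastforce simp: tararin_series_def)
    then show ?thesis using S generate_consistent[OF _ H'G, of S] by auto
  qed
  note IH = "3.IH"(2)[OF G1.is_group T1 fg1]
  have half: "{x \<in> carrier G. \<phi> x > 0} \<subseteq> P"
    if p: "add_hom G \<phi>" "H' = add_ker G \<phi>" and t': "t \<in> P" "\<phi> t = 1" and P: "positive_cone G P"
    for \<phi> :: "'a \<Rightarrow> int" and t P
  proof (rule positive_half_of_coset[OF p(1) t' P])
    fix h assume h: "h \<in> add_ker G \<phi>"
    have tc: "t \<in> carrier G" using t' positive_coneD(1)[OF P] by blast
    show "t \<otimes>\<^bsub>G\<^esub> h \<in> P"
    proof (cases L)
      case Nil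
      then have "H' = {\<one>\<^bsub>G\<^esub>}" using T1 by (simp add: tararin_series_def subnormal_series_def)
      then show ?thesis using h p(2) t' tc by simp
    next
      case (Cons H'' L')
      have N2: "H'' \<lhd> ?G1" "tf_abelian_rank1 (?G1 Mod H'')"
        using T1 unfolding Cons tararin_series_def subnormal_series_def series_factor_def
        by (auto dest!: spec[of _ 0])
      have N3: "H'' \<lhd> G" "\<not> bi_orderable (G Mod H'')"
        using T unfolding Cons tararin_series_def by (auto simp: HG dest!: spec[of _ 0])
      obtain S1 where S1: "finite S1" "S1 \<subseteq> carrier ?G1" "generate ?G1 S1 = carrier ?G1" using fg1[of H'] by auto
      obtain \<psi>0 :: "'a \<Rightarrow> int" and s0 where \<psi>0: "add_hom ?G1 \<psi>0" "s0 \<in> H'" "\<psi>0 s0 = 1" "H'' = add_ker ?G1 \<psi>0"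
        using G1.add_ker_of_Mod_iso[OF N2(1) G1.Mod_fg_iso[OF S1 N2]] by auto
      have "positive_cone ?G1 (P \<inter> H')" using positive_cone_restrict[OF H'G P] .
      then have "{x \<in> H'. \<psi>0 x > 0} \<subseteq> P \<inter> H' \<or> {x \<in> H'. \<psi>0 x < 0} \<subseteq> P \<inter> H'"
        using IH[THEN conjunct2, rule_format, OF _ \<psi>0(1) _ \<psi>0(3)] \<psi>0(2,4) by (simp add: Cons) blast
      \<comment> \<open>Negating the homomorphism and inverting its generator, if necessary, makes
        the half contained in \<open>P\<close> the positive one.\<close>
      then obtain \<psi> :: "'a \<Rightarrow> int" and s where q: "add_hom ?G1 \<psi>" "s \<in> H'" "\<psi> s = 1" "H'' = add_ker ?G1 \<psi>"
        and pos: "{x \<in> H'. \<psi> x > 0} \<subseteq> P"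
      proof (elim disjE)
        assume "{x \<in> H'. \<psi>0 x > 0} \<subseteq> P \<inter> H'"
        then show ?thesis using \<psi>0 by (intro that[of \<psi>0 s0]) auto
      next
        assume "{x \<in> H'. \<psi>0 x < 0} \<subseteq> P \<inter> H'"
        moreover have "\<psi>0 (inv\<^bsub>G\<^esub> s0) = -1"
          using G1.add_hom_inv[OF \<psi>0(1), of s0] \<psi>0 m_inv_consistent[OF H'G] by simp
        ultimately show ?thesis using \<psi>0 subgroup.m_inv_closed[OF H'G]
          by (intro that[of "\<lambda>x. - \<psi>0 x" "inv\<^bsub>G\<^esub> s0"]) (auto simp: add_ker_uminus intro: add_hom_uminus)
      qed
      have H'': "x \<in> H'' \<longleftrightarrow> x \<in> H' \<and> \<psi> x = 0" for x unfolding q(4) add_ker_def by simp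
      interpret N3: normal H'' G by (rule N3)
      interpret two_step G \<phi> t \<psi> s
      proof
        show "\<psi> (c \<otimes>\<^bsub>G\<^esub> x \<otimes>\<^bsub>G\<^esub> inv\<^bsub>G\<^esub> c) = 0" if "c \<in> carrier G" "x \<in> add_ker G \<phi>" "\<psi> x = 0" for c x
        proof -
          have "x \<in> H'" unfolding p(2) by (rule that(2))
          then have "x \<in> H''" using H'' that(3) by blast
          then have "c \<otimes>\<^bsub>G\<^esub> x \<otimes>\<^bsub>G\<^esub> inv\<^bsub>G\<^esub> c \<in> H''" using N3.inv_op_closed2 that(1) by blast
          then show ?thesis using H'' by blast
        qed
      qed (use p t' tc q in simp_all)
      have "\<psi> (t \<otimes>\<^bsub>G\<^esub> s \<otimes>\<^bsub>G\<^esub> inv\<^bsub>G\<^esub> t) = -1"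
        using sign_of_not_bi_orderable[OF N3(1) _ N3(2)] q(4) p(2) by simp
      then show ?thesis using coset_in_cone[OF P t'(1) _ _ h] pos p(2) by blast
    qed
  qed
  have sign: "{x \<in> carrier G. \<phi> x > 0} \<subseteq> P \<or> {x \<in> carrier G. \<phi> x < 0} \<subseteq> P"
    if \<phi>: "add_hom G \<phi>" "H' = add_ker G \<phi>" and t: "t \<in> carrier G" "\<phi> t = 1" and P: "positive_cone G P"
    for \<phi> :: "'a \<Rightarrow> int" and t P
  proof -
    have "t \<noteq> \<one>\<^bsub>G\<^esub>" using t add_hom_one[OF \<phi>(1)] by auto
    then consider "t \<in> P" | "inv\<^bsub>G\<^esub> t \<in> P" using positive_coneD(4)[OF P t(1)] by blast
    then show ?thesis
    proof cases
      case 1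
      then show ?thesis using half[OF \<phi> _ t(2) P] by blast
    next
      case 2
      then show ?thesis
        using half[OF add_hom_uminus[OF \<phi>(1)] _ 2 _ P] \<phi>(2) add_hom_inv[OF \<phi>(1) t(1)] t(2)
        by (simp add: add_ker_uminus)
    qed
  qed
  obtain S where S: "finite S" "S \<subseteq> carrier G" "generate G S = carrier G"
    using "3.prems"(3)[of H] HG by auto
  obtain S' where S': "finite S'" "S' \<subseteq> H'" "generate G S' = H'" using "3.prems"(3)[of H'] by auto
  obtain \<phi> :: "'a \<Rightarrow> int" and t where \<phi>: "add_hom G \<phi>" "t \<in> carrier G" "\<phi> t = 1" "H' = add_ker G \<phi>"
    using add_ker_of_Mod_iso[OF N(1) Mod_fg_iso[OF S N]] by blast
  have "rational G P" if P: "positive_cone G P" for P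
  proof -
    have R: "rational ?G1 (P \<inter> H')" using IH positive_cone_restrict[OF H'G P] by blast
    from sign[OF \<phi>(1,4,2,3) P] show ?thesis
    proof
      assume "{x \<in> carrier G. \<phi> x > 0} \<subseteq> P"
      then show ?thesis using rational_of_positive_half[OF \<phi>(1-3) S'(1) _ _ P] S' R \<phi>(4) by simp
    next
      assume "{x \<in> carrier G. \<phi> x < 0} \<subseteq> P"
      then show ?thesis
        using rational_of_positive_half[OF add_hom_uminus[OF \<phi>(1)] inv_closed[OF \<phi>(2)] _ S'(1) _ _ P] S' R \<phi>(3,4)
          add_hom_inv[OF \<phi>(1,2)] by (simp add: add_ker_uminus)
    qed
  qed
  then show ?case using sign by (simp add: HG)
qed

text \<open>Composing \<psi> with a conjugation gives another homomorphism on the kernel of \<phi>;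
  countability forces its kernel to contain that of \<psi>, so \<open>N\<close> is normal. If
  \<open>t\<close> acted trivially, \<psi> would extend to \<open>G\<close> independently of \<phi>,
  with uncountably many cones.\<close>

lemma (in group) all_rational_two_step:
  fixes \<phi> \<psi> :: "'a \<Rightarrow> int"
  assumes rat: "all_rational G" and p: "add_hom G \<phi>" "t \<in> carrier G" "\<phi> t = 1"
    and q: "add_hom (G\<lparr>carrier := add_ker G \<phi>\<rparr>) \<psi>" "s \<in> add_ker G \<phi>" "\<psi> s = 1"
    and N: "N = add_ker (G\<lparr>carrier := add_ker G \<phi>\<rparr>) \<psi>"
  shows "N \<lhd> G" "\<not> bi_orderable (G Mod N)"
proof -
  let ?K = "add_ker G \<phi>"
  let ?G1 = "G\<lparr>carrier := ?K\<rparr>"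
  have K: "subgroup ?K G" using add_ker_subgroup[OF p(1)] .
  interpret G1: group ?G1 using subgroup_imp_group[OF K] .
  have rat1: "all_rational ?G1" using all_rational_add_ker[OF p rat] .
  then obtain P1 where P1: "positive_cone ?G1 P1" by (auto simp: all_rational_def)
  have conjK: "c \<otimes> x \<otimes> inv c \<in> ?K" if "c \<in> carrier G" "x \<in> ?K" for c x
    using that by (simp add: add_ker_def add_hom_mult[OF p(1)] add_hom_inv[OF p(1)])
  have inv: "\<psi> (c \<otimes> x \<otimes> inv c) = 0" if c: "c \<in> carrier G" and x: "x \<in> ?K" "\<psi> x = 0" for c x
  proof -
    have "add_hom ?G1 (\<lambda>x. \<psi> (c \<otimes> x \<otimes> inv c))" unfolding add_hom_def
    proof (intro ballI)
      fix a b assume ab: "a \<in> carrier ?G1" "b \<in> carrier ?G1"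
      then have "c \<otimes> (a \<otimes> b) \<otimes> inv c = (c \<otimes> a \<otimes> inv c) \<otimes> (c \<otimes> b \<otimes> inv c)"
        using c by (simp add: add_ker_def m_assoc)
      then show "\<psi> (c \<otimes> (a \<otimes>\<^bsub>?G1\<^esub> b) \<otimes> inv c) = \<psi> (c \<otimes> a \<otimes> inv c) + \<psi> (c \<otimes> b \<otimes> inv c)"
        using add_hom_mult[OF q(1), of "c \<otimes> a \<otimes> inv c" "c \<otimes> b \<otimes> inv c"] conjK[OF c] ab by simp
    qed
    from G1.add_ker_mono_of_countable_cones[OF G1.countable_cones[OF rat1] P1 this q(1), of s]
    have "add_ker ?G1 \<psi> \<subseteq> add_ker ?G1 (\<lambda>x. \<psi> (c \<otimes> x \<otimes> inv c))" using q by simp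
    moreover have "x \<in> add_ker ?G1 \<psi>" using x by (simp add: add_ker_def)
    ultimately show ?thesis unfolding add_ker_def[of ?G1] by blast
  qed
  interpret two_step G \<phi> t \<psi> s by unfold_locales (fact p q inv)+
  have Nx: "x \<in> N \<longleftrightarrow> x \<in> ?K \<and> \<psi> x = 0" for x by (simp add: N add_ker_def)
  have "subgroup N G" unfolding N using incl_subgroup[OF K G1.add_ker_subgroup[OF q(1)]] .
  then show norm: "N \<lhd> G" unfolding normal_inv_iff using Nx inv conjK by blast
  have "\<psi> (t \<otimes> s \<otimes> inv t) \<noteq> 1"
  proof
    assume "\<psi> (t \<otimes> s \<otimes> inv t) = 1"
    then obtain \<Psi> where \<Psi>: "add_hom G \<Psi>" "\<Psi> t = 0" "\<forall>x\<in>?K. \<Psi> x = \<psi> x" using split_hom by blast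
    obtain P where P: "positive_cone G P" using rat by (auto simp: all_rational_def)
    have sc: "s \<in> carrier G" "\<phi> s = 0" using q(2) by (auto simp: add_ker_def)
    have "\<phi> t * \<Psi> s \<noteq> \<phi> s * \<Psi> t" using p(3) q(2,3) \<Psi> sc by simp
    then have "uncountable {P. positive_cone G P}"
      by (rule uncountable_cones_rank2[OF p(1) \<Psi>(1) P p(2) sc(1)])
    then show False using countable_cones[OF rat] by blast
  qed
  then show "\<not> bi_orderable (G Mod N)" using conj_sign not_bi_orderable_of_sign[OF _ norm N] by blast
qed

text \<open>Rationality of all cones is recorded for every term because the uniqueness proof works
  inside each of them.\<close>

lemma (in group) all_rational_imp_tararin_series:
  assumes rat: "all_rational G"
  shows "\<exists>Hs. tararin_series G Hs \<and> (\<forall>i. Suc i < length Hs \<longrightarrow> series_factor G Hs i \<cong> integer_group) \<and>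
    (\<forall>i<length Hs. all_rational (G\<lparr>carrier := Hs ! i\<rparr>))"
proof -
  define good where "good H \<longleftrightarrow> subgroup H G \<and> all_rational (G\<lparr>carrier := H\<rparr>)" for H
  have grp: "group (G\<lparr>carrier := H\<rparr>)" if "good H" for H using that subgroup_imp_group by (simp add: good_def)
  \<comment> \<open>The premises are put inside the existential so that the choice below yields
    functions defined on all sets \<open>H\<close>.\<close>
  have "\<exists>(\<phi> :: 'a \<Rightarrow> int) t. good H \<longrightarrow> H \<noteq> {\<one>} \<longrightarrow> add_hom (G\<lparr>carrier := H\<rparr>) \<phi> \<and> t \<in> H \<and> \<phi> t = 1" for H
  proof (cases "good H \<and> H \<noteq> {\<one>}")
    case True
    then interpret H: group "G\<lparr>carrier := H\<rparr>" using grp by blast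
    have r: "all_rational (G\<lparr>carrier := H\<rparr>)" using True by (simp add: good_def)
    then obtain P where P: "positive_cone (G\<lparr>carrier := H\<rparr>) P" "rational (G\<lparr>carrier := H\<rparr>) P"
      by (auto simp: all_rational_def)
    obtain S where S: "finite S" "S \<subseteq> carrier (G\<lparr>carrier := H\<rparr>)"
      "generate (G\<lparr>carrier := H\<rparr>) S = carrier (G\<lparr>carrier := H\<rparr>)"
      using H.rational_cone_generated(1)[OF P] by blast
    have "carrier (G\<lparr>carrier := H\<rparr>) \<noteq> {\<one>\<^bsub>G\<lparr>carrier := H\<rparr>\<^esub>}" using True by simp
    from H.ex_int_epi[OF S this H.countable_cones[OF r] P(1)] show ?thesis by auto
  qed blast
  then obtain ph :: "'a set \<Rightarrow> 'a \<Rightarrow> int" and tt where ph: "\<And>H. good H \<Longrightarrow> H \<noteq> {\<one>} \<Longrightarrow>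
      add_hom (G\<lparr>carrier := H\<rparr>) (ph H) \<and> tt H \<in> H \<and> ph H (tt H) = 1"
    by metis
  define K where "K n = rec_nat (carrier G) (\<lambda>_ H. add_ker (G\<lparr>carrier := H\<rparr>) (ph H)) n" for n
  have K0: "K 0 = carrier G" and KS: "K (Suc n) = add_ker (G\<lparr>carrier := K n\<rparr>) (ph (K n))" for n
    by (simp_all add: K_def)
  have next_good: "good (add_ker (G\<lparr>carrier := H\<rparr>) (ph H))" if H: "good H" "H \<noteq> {\<one>}" for H
  proof -
    interpret H: group "G\<lparr>carrier := H\<rparr>" using grp H by blast
    have p: "add_hom (G\<lparr>carrier := H\<rparr>) (ph H)" "tt H \<in> carrier (G\<lparr>carrier := H\<rparr>)" "ph H (tt H) = 1"
      using ph[OF H] by auto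
    have "all_rational (G\<lparr>carrier := H\<rparr>)" "subgroup H G" using H by (auto simp: good_def)
    then show ?thesis using H.all_rational_add_ker[OF p] incl_subgroup[OF _ H.add_ker_subgroup[OF p(1)]]
      by (simp add: good_def)
  qed
  have good0: "good (K 0)" using rat subgroup_self by (simp add: good_def K0)
  have "\<exists>n. K n = {\<one>}"
  proof (rule ccontr)
    assume "\<nexists>n. K n = {\<one>}"
    then have ne: "K n \<noteq> {\<one>}" for n by blast
    have g: "good (K n)" for n
      by (induction n) (use good0 next_good ne KS in auto)
    obtain P where P: "positive_cone G P" using rat by (auto simp: all_rational_def)
    have "uncountable {P. positive_cone G P}"
    proof (rule uncountable_cones_chain[where K = K and \<phi> = "\<lambda>n. ph (K n)" and s = "\<lambda>n. tt (K n)"])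
      show "subgroup (K n) G" for n using g by (simp add: good_def)
      show "add_hom (G\<lparr>carrier := K n\<rparr>) (ph (K n))" "tt (K n) \<in> K n" "ph (K n) (tt (K n)) = 1" for n
        using ph[OF g ne] by auto
    qed (fact K0 KS P)+
    then show False using countable_cones[OF rat] by blast
  qed
  \<comment> \<open>Beyond the first trivial term the chosen homomorphisms are unspecified, so the
    series stops there.\<close>
  define n where "n = (LEAST n. K n = {\<one>})"
  have Kn: "K n = {\<one>}" unfolding n_def using \<open>\<exists>n. K n = {\<one>}\<close> by (rule LeastI_ex)
  have ne: "K i \<noteq> {\<one>}" if "i < n" for i using not_less_Least[OF that[unfolded n_def]] .
  have g: "good (K i)" if "i \<le> n" for i
    using that by (induction i) (use good0 next_good ne KS in auto)
  define Hs where "Hs = map K [0..<Suc n]"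
  have nth: "Hs ! i = K i" if "i \<le> n" for i
    using that by (auto simp: Hs_def simp del: upt_Suc)
  have len: "length Hs = Suc n" by (simp add: Hs_def)
  have one: "K (Suc i) \<lhd> G\<lparr>carrier := K i\<rparr> \<and> G\<lparr>carrier := K i\<rparr> Mod K (Suc i) \<cong> integer_group \<and>
      tf_abelian_rank1 (G\<lparr>carrier := K i\<rparr> Mod K (Suc i))" if i: "i < n" for i
  proof -
    interpret H: group "G\<lparr>carrier := K i\<rparr>" using grp g i by simp
    have p: "add_hom (G\<lparr>carrier := K i\<rparr>) (ph (K i))" "tt (K i) \<in> carrier (G\<lparr>carrier := K i\<rparr>)"
      "ph (K i) (tt (K i)) = 1"
      using ph[OF g ne] i by auto
    have norm: "K (Suc i) \<lhd> G\<lparr>carrier := K i\<rparr>" unfolding KS using H.add_ker_normal[OF p(1)] .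
    have iso: "G\<lparr>carrier := K i\<rparr> Mod K (Suc i) \<cong> integer_group" unfolding KS using H.Mod_add_ker_iso[OF p] .
    show ?thesis using norm iso group.tf_abelian_rank1_of_iso[OF normal.factorgroup_is_group[OF norm] iso] by blast
  qed
  have two: "K (Suc (Suc i)) \<lhd> G\<lparr>carrier := K i\<rparr> \<and> \<not> bi_orderable (G\<lparr>carrier := K i\<rparr> Mod K (Suc (Suc i)))"
    if i: "Suc i < n" for i
  proof -
    interpret H: group "G\<lparr>carrier := K i\<rparr>" using grp g i by simp
    have p: "add_hom (G\<lparr>carrier := K i\<rparr>) (ph (K i))" "tt (K i) \<in> carrier (G\<lparr>carrier := K i\<rparr>)"
      "ph (K i) (tt (K i)) = 1"
      using ph[OF g ne] i by auto
    have q: "add_hom (G\<lparr>carrier := K (Suc i)\<rparr>) (ph (K (Suc i)))" "tt (K (Suc i)) \<in> K (Suc i)"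
      "ph (K (Suc i)) (tt (K (Suc i))) = 1"
      using ph[OF g ne] i by auto
    have "all_rational (G\<lparr>carrier := K i\<rparr>)" using g i by (simp add: good_def)
    from H.all_rational_two_step[OF this p, of "ph (K (Suc i))" "tt (K (Suc i))", OF _ _ q(3) refl] q(1,2)
    show ?thesis by (simp add: KS)
  qed
  have "tararin_series G Hs" unfolding tararin_series_def subnormal_series_def series_factor_def
  proof (intro conjI allI impI)
    show "Hs \<noteq> []" using len by auto
    show "hd Hs = carrier G" using nth[of 0] K0 \<open>Hs \<noteq> []\<close> by (simp add: hd_conv_nth)
    show "last Hs = {\<one>}" using nth[of n] Kn \<open>Hs \<noteq> []\<close> len by (simp add: last_conv_nth)
  qed (use one two nth len in auto)
  moreover have "series_factor G Hs i \<cong> integer_group" if "Suc i < length Hs" for i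
    using one that nth len by (simp add: series_factor_def)
  moreover have "all_rational (G\<lparr>carrier := Hs ! i\<rparr>)" if "i < length Hs" for i
    using g that nth len by (simp add: good_def)
  ultimately show ?thesis by blast
qed

section \<open>Uniqueness of the series\<close>

lemma (in group) tararin_series_nontrivial:
  assumes T: "tararin_series G Hs" and i: "Suc i < length Hs"
  shows "Hs ! i \<noteq> {\<one>}"
proof
  assume eq: "Hs ! i = {\<one>}"
  define Q where "Q = series_factor G Hs i"
  have Q: "tf_abelian_rank1 Q" using T i unfolding Q_def tararin_series_def by blast
  have "carrier Q = (\<lambda>x. Hs ! Suc i #>\<^bsub>G\<lparr>carrier := {\<one>}\<rparr>\<^esub> x) ` {\<one>}"
    by (simp add: Q_def series_factor_def carrier_FactGroup eq)
  then obtain A where A: "carrier Q = {A}" by auto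
  interpret Q: comm_group Q using Q by (simp add: tf_abelian_rank1_def)
  have "carrier Q = {\<one>\<^bsub>Q\<^esub>}" using A Q.one_closed by auto
  then show False using Q by (simp add: tf_abelian_rank1_def)
qed

text \<open>Inductively both next terms are kernels of nonzero integer homomorphisms on the same
  group, which has countably many cones, so they agree. Neither series can continue past the trivial
  group, so the lengths agree.\<close>

lemma (in group) tararin_series_unique:
  assumes Hs: "tararin_series G Hs" and Ks: "tararin_series G Ks"
    and rat: "\<And>i. i < length Hs \<Longrightarrow> all_rational (G\<lparr>carrier := Hs ! i\<rparr>)"
  shows "Ks = Hs"
proof -
  have sub: "subnormal_series G Hs" "subnormal_series G Ks" using Hs Ks by (auto simp: tararin_series_def)
  then have ne: "Hs \<noteq> []" "Ks \<noteq> []" by (auto simp: subnormal_series_def)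
  have last: "Hs ! (length Hs - 1) = {\<one>}" "Ks ! (length Ks - 1) = {\<one>}"
    using sub ne by (auto simp: subnormal_series_def last_conv_nth)
  have eq: "Ks ! i = Hs ! i" if "i < length Hs" "i < length Ks" for i
    using that
  proof (induction i)
    case 0
    then show ?case using sub ne by (simp add: subnormal_series_def hd_conv_nth)
  next
    case (Suc i)
    let ?G = "G\<lparr>carrier := Hs ! i\<rparr>"
    have same: "Ks ! i = Hs ! i" using Suc by simp
    interpret H: group ?G using subgroup_imp_group subnormal_series_subgroup[OF sub(1)] Suc by simp
    have r: "all_rational ?G" using rat Suc by simp
    then obtain P where P: "positive_cone ?G P" "rational ?G P" by (auto simp: all_rational_def)
    obtain S where S: "finite S" "S \<subseteq> carrier ?G" "generate ?G S = carrier ?G"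
      using H.rational_cone_generated(1)[OF P] by blast
    have ker: "\<exists>(\<phi> :: 'a \<Rightarrow> int) t. add_hom ?G \<phi> \<and> t \<in> carrier ?G \<and> \<phi> t = 1 \<and> N = add_ker ?G \<phi>"
      if "N \<lhd> ?G" "tf_abelian_rank1 (?G Mod N)" for N
      using H.add_ker_of_Mod_iso[OF that(1) H.Mod_fg_iso[OF S that]] .
    have "Hs ! Suc i \<lhd> ?G" "tf_abelian_rank1 (?G Mod (Hs ! Suc i))"
      using Hs Suc.prems unfolding tararin_series_def subnormal_series_def series_factor_def by auto
    from ker[OF this] obtain \<phi> :: "'a \<Rightarrow> int" and t
      where \<phi>: "add_hom ?G \<phi>" "t \<in> carrier ?G" "\<phi> t = 1" "Hs ! Suc i = add_ker ?G \<phi>" by blast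
    have "Ks ! Suc i \<lhd> ?G" "tf_abelian_rank1 (?G Mod (Ks ! Suc i))"
      using Ks Suc.prems same[symmetric] unfolding tararin_series_def subnormal_series_def series_factor_def by auto
    from ker[OF this] obtain \<psi> :: "'a \<Rightarrow> int" and s
      where \<psi>: "add_hom ?G \<psi>" "s \<in> carrier ?G" "\<psi> s = 1" "Ks ! Suc i = add_ker ?G \<psi>" by blast
    note mono = H.add_ker_mono_of_countable_cones[OF H.countable_cones[OF r] P(1)]
    show ?case unfolding \<phi>(4) \<psi>(4)
      using mono[OF \<phi>(1) \<psi>(1,2)] mono[OF \<psi>(1) \<phi>(1,2)] \<phi>(3) \<psi>(3) by simp
  qed
  have "length Ks = length Hs"
  proof (rule ccontr)
    assume "length Ks \<noteq> length Hs"
    then consider "length Ks < length Hs" | "length Hs < length Ks" by linarith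
    then show False
    proof cases
      case 1
      then have "Suc (length Ks - 1) < length Hs" "Hs ! (length Ks - 1) = {\<one>}"
        using eq[of "length Ks - 1"] last ne by auto
      then show False using tararin_series_nontrivial[OF Hs] by blast
    next
      case 2
      then have "Suc (length Hs - 1) < length Ks" "Ks ! (length Hs - 1) = {\<one>}"
        using eq[of "length Hs - 1"] last ne by auto
      then show False using tararin_series_nontrivial[OF Ks] by blast
    qed
  qed
  then show ?thesis using eq by (intro nth_equalityI) auto
qed

theorem theorem4p9:
  fixes G :: "('a, 'b) monoid_scheme"
  assumes "group G" and "finitely_generated G" and "left_orderable G"
  shows "(\<forall>lt. left_order G lt \<longrightarrow> regular_left_order G lt) \<longleftrightarrow>
         (tararin_group G \<and> poly_Z G)"
proof -
  interpret group G by (rule assms(1))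
  have "(\<forall>lt. left_order G lt \<longrightarrow> regular_left_order G lt) \<longleftrightarrow> all_rational G"
    using assms(3) unfolding all_regular_iff left_orderable_iff all_rational_def by blast
  also have "\<dots> \<longleftrightarrow> tararin_group G \<and> poly_Z G"
  proof
    assume "all_rational G"
    then obtain Hs where Hs: "tararin_series G Hs" "\<forall>i. Suc i < length Hs \<longrightarrow> series_factor G Hs i \<cong> integer_group"
      "\<forall>i<length Hs. all_rational (G\<lparr>carrier := Hs ! i\<rparr>)"
      using all_rational_imp_tararin_series by blast
    have "tararin_group G" unfolding tararin_group_def
      using Hs(1) tararin_series_unique[OF Hs(1)] Hs(3) by (intro ex1I[of _ Hs]) blast+
    moreover have "poly_Z G" unfolding poly_Z_def using Hs by (auto simp: tararin_series_def)
    ultimately show "tararin_group G \<and> poly_Z G" by blast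
  next
    assume *: "tararin_group G \<and> poly_Z G"
    then obtain Hs where Hs: "tararin_series G Hs" unfolding tararin_group_def by blast
    obtain Ks where Ks: "subnormal_series G Ks" "\<forall>i. Suc i < length Ks \<longrightarrow> series_factor G Ks i \<cong> integer_group"
      using * unfolding poly_Z_def by blast
    \<comment> \<open>The terms of \<open>Hs\<close> are subgroups of a poly-infinite-cyclic group;
      the series \<open>Ks\<close> proving this may be a different one.\<close>
    have "\<exists>S. finite S \<and> S \<subseteq> H \<and> generate G S = H" if "H \<in> set Hs" for H
    proof -
      obtain i where "i < length Hs" "H = Hs ! i" using \<open>H \<in> set Hs\<close> by (metis in_set_conv_nth)
      then have H: "subgroup H G" using subnormal_series_subgroup Hs by (simp add: tararin_series_def)
      show ?thesis
      proof (rule fg_subgroup_poly_Z[OF _ _ _ _ H])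
        show "Ks \<noteq> []" "last Ks = {\<one>\<^bsub>G\<^esub>}" "subgroup (hd Ks) G" "H \<subseteq> hd Ks"
          using Ks(1) subgroup_self subgroup.subset[OF H] by (auto simp: subnormal_series_def)
        show "Ks ! Suc i \<lhd> G\<lparr>carrier := Ks ! i\<rparr> \<and> series_factor G Ks i \<cong> integer_group"
          if "Suc i < length Ks" for i
          using Ks that by (auto simp: subnormal_series_def)
      qed
    qed
    with tararin_all_cones[OF assms(1) Hs] have "\<forall>P. positive_cone G P \<longrightarrow> rational G P" by blast
    then show "all_rational G" using assms(3) unfolding left_orderable_iff all_rational_def by blast
  qed
  finally show ?thesis .
qed

end
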